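(* Let $A(\cdot):[0,\tau]\to\mathcal{L}(D,X)$ be a strongly measurable and bounded function such that $A(t)\in\mathscr{MR}$ for every $t\in[0,\tau]$ and such that $A(\cdot)$ satisfies the relative $\nu$-Dini condition for some $\nu\in(1,\infty)$. Let $U=(U(t,s))_{0\le s\le t\le\tau}$ be the evolution family on $X$ associated with $A(\cdot)$. Let $P(\cdot):[0,\tau]\to\mathcal{L}(D,X)$ be a strongly measurable and bounded function for which there exist $\mu\in(1,\infty)$ and a constant $c>0$ such that, for all $0\le s<\tau'<\tau$, $$\left(\int_s^{\tau'}\|P(t)U(t,s)x\|^{\mu}\,dt\right)^{1/\mu}\le c\,\|x\|\qquad(x\in D).$$ Define $A^P(t):=A(t)+P(t)$ for $t\in[0,\tau]$. Then $A^P(\cdot)\in\mathscr{MR}_q(0,\tau)$ for every $q\in(1,\mu]$.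
   Context: $(X,\|\cdot\|)$ and $(D,\|\cdot\|_D)$ are Banach spaces with $D$ continuously and densely embedded in $X$, and $\tau>0$ is fixed. Maximal regularity space: for $p\in(1,\infty)$ and $a<b$, $\mathrm{MR}_p(a,b):=W^{1,p}(a,b;X)\cap L^p(a,b;D)$ with norm $\|u\|_{W^{1,p}(a,b;X)}+\|u\|_{L^p(a,b;D)}$. Trace space: $\mathrm{Tr}_p:=\{u(a):u\in\mathrm{MR}_p(a,b)\}$ with norm $\|x\|_{\mathrm{Tr}_p}:=\inf\{\|u\|_{\mathrm{MR}_p(a,b)}:u(a)=x\}$; it does not depend on $(a,b)$ (up to equivalent norms), is isomorphic to the real interpolation space $(X,D)_{1-1/p,p}$, and $D\hookrightarrow\mathrm{Tr}_p\hookrightarrow X$ continuously and densely. Single operators: $A\in\mathcal{L}(D,X)$ has maximal $L^p$-regularity if for every bounded interval $(a,b)$ and every $f\in L^p(a,b;X)$ there is a unique $u\in\mathrm{MR}_p(a,b)$ with $\dot u(t)+Au(t)=f(t)$ for a.e. $t\in[a,b]$ and $u(a)=0$. This property is independent of $p\in(1,\infty)$, and one writes $A\in\mathscr{MR}$. Operator functions: for a strongly measurable and bounded $B(\cdot):[0,\tau]\to\mathcal{L}(D,X)$ and $p\in(1,\infty)$, $B(\cdot)\in\mathscr{MR}_p(0,\tau)$ means that for every sub-interval $[a,b]\subseteq[0,\tau]$ and every $f\in L^p(a,b;X)$ there is a unique $u\in\mathrm{MR}_p(a,b)$ with $\dot u(t)+B(t)u(t)=f(t)$ for a.e. $t\in[a,b]$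 and $u(a)=0$. Relative $\nu$-Dini condition: there exist $\eta\ge0$ and a continuous $\omega:[0,\tau]\to[0,\infty)$ with $\omega(0)=0$ and $\int_0^\tau(\omega(t)/t)^\nu\,dt<\infty$ such that $\|A(t)x-A(s)x\|\le\omega(|t-s|)\|x\|_D+\eta\|x\|$ for all $x\in D$, $s,t\in[0,\tau]$. Evolution family on a Banach space: a family $(U(t,s))_{0\le s\le t\le\tau}$ of bounded operators with $U(s,s)=I$, $U(t,s)=U(t,r)U(r,s)$ for $0\le s\le r\le t\le\tau$, and $(t,s)\mapsto U(t,s)$ strongly continuous. Evolution family associated with $A(\cdot)$: under the stated assumptions on $A(\cdot)$ it is known that $A(\cdot)\in\mathscr{MR}_p(0,\tau)$ for all $p\in(1,\infty)$ and that there is a unique bounded evolution family $U$ on $X$ such that, for all $p\in(1,\infty)$, $s\in[0,\tau)$ and $x\in\mathrm{Tr}_p$, $U(\cdot,s)x$ is the unique $u\in\mathrm{MR}_p(s,\tau)$ with $\dot u(t)+A(t)u(t)=0$ for a.e. $t\in[s,\tau]$ and $u(s)=x$. In particular $U(t,s)x\in D$ for a.e. $t\in[s,\tau]$. *)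

theory Defs
  imports "HOL-Analysis.Analysis"
begin

(* Real Banach spaces: complex ones are covered by restriction of scalars, since complex linearity
   plays no role in the notions below.  The space D is a type of its own, and its inclusion into X
   is a bounded linear map j.  The norm of x in X for x in D is thus norm (j x), and an element y
   of X that lies in D is recognised by y \<in> range j, its D-version being inv j y. *)

definition dense_embedding :: "('d::banach \<Rightarrow>\<^sub>L 'x::banach) \<Rightarrow> bool" where
  "dense_embedding j \<longleftrightarrow>
     inj (blinfun_apply j) \<and> closure (range (blinfun_apply j)) = UNIV"

definition in_D :: "('d::banach \<Rightarrow>\<^sub>L 'x::banach) \<Rightarrow> 'x \<Rightarrow> bool" where
  "in_D j y \<longleftrightarrow> y \<in> range (blinfun_apply j)"

definition to_D :: "('d::banach \<Rightarrow>\<^sub>L 'x::banach) \<Rightarrow> 'x \<Rightarrow> 'd" where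
  "to_D j y = inv (blinfun_apply j) y"

(* Strong (Bochner) measurability.  Borel measurability and the library's Bochner integral are
   appropriate only for separable targets, and no separability is assumed here. *)
definition strongly_measurable_on :: "real set \<Rightarrow> (real \<Rightarrow> 'b::real_normed_vector) \<Rightarrow> bool" where
  "strongly_measurable_on S f \<longleftrightarrow>
     (\<exists>\<sigma> :: nat \<Rightarrow> real \<Rightarrow> 'b.
        (\<forall>n. simple_function (lebesgue_on S) (\<sigma> n)) \<and>
        (AE t in lebesgue_on S. (\<lambda>n. \<sigma> n t) \<longlonglongrightarrow> f t))"

(* For operator functions measurability is understood in the strong operator topology; this is
   implied by Bochner measurability with respect to the operator norm. *)
definition op_strongly_measurable_on ::
    "real set \<Rightarrow> (real \<Rightarrow> 'd::real_normed_vector \<Rightarrow>\<^sub>L 'x::real_normed_vector) \<Rightarrow> bool" where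
  "op_strongly_measurable_on S B \<longleftrightarrow>
     (\<forall>x. strongly_measurable_on S (\<lambda>t. blinfun_apply (B t) x))"

definition Lp_space :: "real \<Rightarrow> real \<Rightarrow> real \<Rightarrow> (real \<Rightarrow> 'b::real_normed_vector) set" where
  "Lp_space p a b =
     {f. strongly_measurable_on {a..b} f \<and>
         integrable (lebesgue_on {a..b}) (\<lambda>t. norm (f t) powr p)}"

(* v is the (distributional) derivative of u on (a,b), where u is the continuous representative:
   u(t) = u(a) + \<integral>\<^sub>a\<^sup>t v(s) ds on [a,b].  It is used only for v in L^p, p > 1; such v are Bochner
   integrable, and the Henstock-Kurzweil integral below then exists and is the Bochner integral,
   whatever the Banach space. *)
definition has_weak_derivative_on ::
    "real \<Rightarrow> real \<Rightarrow> (real \<Rightarrow> 'x::banach) \<Rightarrow> (real \<Rightarrow> 'x) \<Rightarrow> bool" where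
  "has_weak_derivative_on a b u v \<longleftrightarrow>
     (\<forall>t\<in>{a..b}. (v has_integral (u t - u a)) {a..t})"

(* Elements are represented by their continuous representatives, so that u(a) makes sense. *)
definition W1p_space :: "real \<Rightarrow> real \<Rightarrow> real \<Rightarrow> (real \<Rightarrow> 'x::banach) set" where
  "W1p_space p a b =
     {u \<in> Lp_space p a b. \<exists>v \<in> Lp_space p a b. has_weak_derivative_on a b u v}"

definition MR_space ::
    "('d::banach \<Rightarrow>\<^sub>L 'x::banach) \<Rightarrow> real \<Rightarrow> real \<Rightarrow> real \<Rightarrow> (real \<Rightarrow> 'x) set" where
  "MR_space j p a b =
     {u \<in> W1p_space p a b.
        (AE t in lebesgue_on {a..b}. in_D j (u t)) \<and> (\<lambda>t. to_D j (u t)) \<in> Lp_space p a b}"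

definition trace_space ::
    "('d::banach \<Rightarrow>\<^sub>L 'x::banach) \<Rightarrow> real \<Rightarrow> real \<Rightarrow> real \<Rightarrow> 'x set" where
  "trace_space j p a b = {u a | u. u \<in> MR_space j p a b}"

definition MR_solution ::
    "('d::banach \<Rightarrow>\<^sub>L 'x::banach) \<Rightarrow> real \<Rightarrow> real \<Rightarrow> real \<Rightarrow>
     (real \<Rightarrow> 'd \<Rightarrow>\<^sub>L 'x) \<Rightarrow> (real \<Rightarrow> 'x) \<Rightarrow> 'x \<Rightarrow> (real \<Rightarrow> 'x) \<Rightarrow> bool" where
  "MR_solution j p a b B f x u \<longleftrightarrow>
     u \<in> MR_space j p a b \<and>
     (\<exists>v \<in> Lp_space p a b. has_weak_derivative_on a b u v \<and>
        (AE t in lebesgue_on {a..b}. v t + blinfun_apply (B t) (to_D j (u t)) = f t)) \<and>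
     u a = x"

(* Uniqueness in MR_p(a,b): as functions on [a,b], the values elsewhere being irrelevant. *)
definition unique_MR_solution ::
    "('d::banach \<Rightarrow>\<^sub>L 'x::banach) \<Rightarrow> real \<Rightarrow> real \<Rightarrow> real \<Rightarrow>
     (real \<Rightarrow> 'd \<Rightarrow>\<^sub>L 'x) \<Rightarrow> (real \<Rightarrow> 'x) \<Rightarrow> 'x \<Rightarrow> (real \<Rightarrow> 'x) \<Rightarrow> bool" where
  "unique_MR_solution j p a b B f x u \<longleftrightarrow>
     MR_solution j p a b B f x u \<and>
     (\<forall>w. MR_solution j p a b B f x w \<longrightarrow> (\<forall>t\<in>{a..b}. w t = u t))"

definition maximal_Lp_regularity ::
    "('d::banach \<Rightarrow>\<^sub>L 'x::banach) \<Rightarrow> real \<Rightarrow> ('d \<Rightarrow>\<^sub>L 'x) \<Rightarrow> bool" where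
  "maximal_Lp_regularity j p A \<longleftrightarrow>
     (\<forall>a b. a < b \<longrightarrow>
        (\<forall>f \<in> Lp_space p a b. \<exists>u. unique_MR_solution j p a b (\<lambda>_. A) f 0 u))"

(* Maximal L^p-regularity of a single operator does not depend on p in (1,\<infinity>). *)
definition MR_operator :: "('d::banach \<Rightarrow>\<^sub>L 'x::banach) \<Rightarrow> ('d \<Rightarrow>\<^sub>L 'x) \<Rightarrow> bool" where
  "MR_operator j A \<longleftrightarrow> (\<forall>p>1. maximal_Lp_regularity j p A)"

definition MR_family ::
    "('d::banach \<Rightarrow>\<^sub>L 'x::banach) \<Rightarrow> real \<Rightarrow> real \<Rightarrow> (real \<Rightarrow> 'd \<Rightarrow>\<^sub>L 'x) \<Rightarrow> bool" where
  "MR_family j p \<tau> B \<longleftrightarrow>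
     (\<forall>a b. 0 \<le> a \<and> a < b \<and> b \<le> \<tau> \<longrightarrow>
        (\<forall>f \<in> Lp_space p a b. \<exists>u. unique_MR_solution j p a b B f 0 u))"

definition relative_Dini ::
    "('d::banach \<Rightarrow>\<^sub>L 'x::banach) \<Rightarrow> real \<Rightarrow> real \<Rightarrow> (real \<Rightarrow> 'd \<Rightarrow>\<^sub>L 'x) \<Rightarrow> bool" where
  "relative_Dini j \<nu> \<tau> A \<longleftrightarrow>
     (\<exists>\<eta>\<ge>0. \<exists>\<omega> :: real \<Rightarrow> real.
        continuous_on {0..\<tau>} \<omega> \<and> (\<forall>t\<in>{0..\<tau>}. 0 \<le> \<omega> t) \<and> \<omega> 0 = 0 \<and>
        integrable (lebesgue_on {0..\<tau>}) (\<lambda>t. (\<omega> t / t) powr \<nu>) \<and>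
        (\<forall>x. \<forall>s\<in>{0..\<tau>}. \<forall>t\<in>{0..\<tau>}.
           norm (blinfun_apply (A t) x - blinfun_apply (A s) x)
             \<le> \<omega> \<bar>t - s\<bar> * norm x + \<eta> * norm (blinfun_apply j x)))"

(* The operator U(t,s) is written U t s; only 0 \<le> s \<le> t \<le> \<tau> matters. *)
definition evolution_family :: "real \<Rightarrow> (real \<Rightarrow> real \<Rightarrow> 'x::banach \<Rightarrow>\<^sub>L 'x) \<Rightarrow> bool" where
  "evolution_family \<tau> U \<longleftrightarrow>
     (\<forall>s\<in>{0..\<tau>}. U s s = id_blinfun) \<and>
     (\<forall>s r t. 0 \<le> s \<and> s \<le> r \<and> r \<le> t \<and> t \<le> \<tau> \<longrightarrow> U t s = U t r o\<^sub>L U r s) \<and>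
     (\<forall>x. continuous_on {(t, s). 0 \<le> s \<and> s \<le> t \<and> t \<le> \<tau>} (\<lambda>(t, s). blinfun_apply (U t s) x))"

(* The trace space does not depend on the interval; (0,\<tau>) is used to define it. *)
definition associated_evolution_family ::
    "('d::banach \<Rightarrow>\<^sub>L 'x::banach) \<Rightarrow> real \<Rightarrow> (real \<Rightarrow> 'd \<Rightarrow>\<^sub>L 'x) \<Rightarrow>
     (real \<Rightarrow> real \<Rightarrow> 'x \<Rightarrow>\<^sub>L 'x) \<Rightarrow> bool" where
  "associated_evolution_family j \<tau> A U \<longleftrightarrow>
     evolution_family \<tau> U \<and>
     bounded {U t s | t s. 0 \<le> s \<and> s \<le> t \<and> t \<le> \<tau>} \<and>
     (\<forall>p>1. \<forall>s\<in>{0..<\<tau>}. \<forall>x \<in> trace_space j p 0 \<tau>.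
        unique_MR_solution j p s \<tau> A (\<lambda>_. 0) x (\<lambda>t. blinfun_apply (U t s) x))"

(* For x in D, U(t,s)x lies in D for almost every t, so that P(t)U(t,s)x makes sense a.e.
   Integrability is part of the condition because the library assigns the value 0 to the integral
   of a function that is not integrable. *)
definition Lmu_estimate ::
    "('d::banach \<Rightarrow>\<^sub>L 'x::banach) \<Rightarrow> real \<Rightarrow> (real \<Rightarrow> real \<Rightarrow> 'x \<Rightarrow>\<^sub>L 'x) \<Rightarrow>
     (real \<Rightarrow> 'd \<Rightarrow>\<^sub>L 'x) \<Rightarrow> real \<Rightarrow> real \<Rightarrow> bool" where
  "Lmu_estimate j \<tau> U P \<mu> c \<longleftrightarrow>
     (\<forall>s \<tau>' x. 0 \<le> s \<and> s < \<tau>' \<and> \<tau>' < \<tau> \<longrightarrow>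
        (let g = (\<lambda>t. norm (blinfun_apply (P t)
                      (to_D j (blinfun_apply (U t s) (blinfun_apply j x)))) powr \<mu>)
         in integrable (lebesgue_on {s..\<tau>'}) g \<and>
            (LINT t|lebesgue_on {s..\<tau>'}. g t) powr (1 / \<mu>) \<le> c * norm (blinfun_apply j x)))"

end

theory Submission
  imports Defs
begin

text \<open>
  The theorem is a perturbation argument. Let \<open>S\<close> be the solution operator on an interval \<open>[a,b]\<close>, that
  is, \<open>u = S f\<close> solves \<open>u' + A u = f\<close>, \<open>u a = 0\<close>. The ansatz \<open>u = S g\<close> turns \<open>u' + (A + P) u = f\<close> into
  \<open>g + P (S g) = f\<close>, which a Neumann series solves as soon as \<open>f \<mapsto> P (S f)\<close> has norm less than one on
  \<open>L\<^sup>q\<close> (\<open>well_posed_perturb\<close>). By the variation of constants formula \<open>S f\<close> is the integral of \<open>U t s (f s)\<close>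
  over \<open>s\<close>, so that the hypothesis on \<open>P\<close> and Minkowski's inequality for integrals suggest the bound
  \<open>C * \<parallel>f\<parallel>\<^sub>1\<close> for the norm of \<open>P (S f)\<close> in \<open>L\<^sup>q\<close>, and \<open>\<parallel>f\<parallel>\<^sub>1 \<le> (b - a) powr (1 - 1 / q) * \<parallel>f\<parallel>\<^sub>q\<close> is small on
  short intervals (\<open>perturbation_estimate\<close>). This gives maximal regularity of \<open>A + P\<close> on short intervals.
  Longer intervals are reached by concatenation, where the evolution family supplies the solutions
  with nonzero initial values (\<open>well_posed_concat\<close>).

  Maximal regularity of \<open>A\<close> itself is proved in the same way. Near a point \<open>t0\<close> the function \<open>A\<close> is a small
  perturbation of the constant \<open>A t0\<close>: the Dini condition splits \<open>A t - A t0\<close> into a part that is small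
  relative to the norm of \<open>D\<close> and a part that is bounded with respect to the norm of \<open>X\<close>, and the latter
  is small on short intervals since solutions start at zero. Compactness makes the length of the
  intervals uniform (\<open>well_posed_short\<close>), and concatenation does the rest.

  Both perturbation steps rely on a priori estimates with a constant that is uniform in the
  subinterval. They follow from unique solvability alone, by Zabreiko's lemma (\<open>Zabreiko_Lp\<close>),
  a form of the closed graph theorem. As \<open>D\<close> and \<open>X\<close> need not be separable, the \<open>L\<^sup>p\<close>-spaces of strongly
  measurable functions are developed from Pettis' criterion (\<open>strongly_measurable_on_iff\<close>), and integrals
  are Henstock-Kurzweil integrals, obtained as limits of integrals of continuous functions
  (\<open>has_integral_L1_limit\<close>).
\<close>

section \<open>Strong measurability\<close>

text \<open>Since the restriction of Lebesgue measure to a measurable set is complete, the exceptional set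
  itself is a null set, not merely contained in one.\<close>
lemma AE_lebesgue_on_iff_null:
  fixes S :: "'a::euclidean_space set"
  assumes "S \<in> sets lebesgue"
  shows "(AE t in lebesgue_on S. Q t) \<longleftrightarrow> {t\<in>S. \<not> Q t} \<in> null_sets lebesgue"
proof
  assume "AE t in lebesgue_on S. Q t"
  then obtain N where N: "{t \<in> space (lebesgue_on S). \<not> Q t} \<subseteq> N" "N \<in> null_sets (lebesgue_on S)"
    unfolding eventually_ae_filter by blast
  then have "N \<in> null_sets lebesgue"
    using assms by (simp add: null_sets_restrict_space)
  then show "{t\<in>S. \<not> Q t} \<in> null_sets lebesgue"
    using N(1) completion.complete2 by simp
next
  assume "{t\<in>S. \<not> Q t} \<in> null_sets lebesgue"
  then have "{t\<in>S. \<not> Q t} \<in> null_sets (lebesgue_on S)"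
    using assms by (auto simp: null_sets_restrict_space)
  then show "AE t in lebesgue_on S. Q t"
    by (simp add: AE_I')
qed

lemma AE_lebesgue_on_iff_negligible:
  fixes S :: "'a::euclidean_space set"
  assumes "S \<in> sets lebesgue"
  shows "(AE t in lebesgue_on S. Q t) \<longleftrightarrow> negligible {t\<in>S. \<not> Q t}"
  by (simp add: AE_lebesgue_on_iff_null[OF assms] negligible_iff_null_sets)

lemma AE_lebesgue_on_subset:
  fixes S :: "'a::euclidean_space set"
  assumes "AE t in lebesgue_on S. Q t" "T \<subseteq> S" "S \<in> sets lebesgue" "T \<in> sets lebesgue"
  shows "AE t in lebesgue_on T. Q t"
  using assms unfolding AE_lebesgue_on_iff_negligible[OF assms(3)] AE_lebesgue_on_iff_negligible[OF assms(4)]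
  by (auto elim!: negligible_subset)

lemma AE_lebesgue_on_Un:
  fixes S :: "'a::euclidean_space set"
  assumes "AE t in lebesgue_on S. Q t" "AE t in lebesgue_on T. Q t"
    "S \<in> sets lebesgue" "T \<in> sets lebesgue" "R \<subseteq> S \<union> T" "R \<in> sets lebesgue"
  shows "AE t in lebesgue_on R. Q t"
proof -
  have "negligible ({t\<in>S. \<not> Q t} \<union> {t\<in>T. \<not> Q t})"
    using assms by (simp add: AE_lebesgue_on_iff_negligible)
  then have "negligible {t\<in>R. \<not> Q t}"
    by (rule negligible_subset) (use assms(5) in auto)
  then show ?thesis using assms(6) by (simp add: AE_lebesgue_on_iff_negligible)
qed

lemma AE_lebesgue_on_neq:
  fixes m :: real
  shows "AE t in lebesgue_on {a..b}. t \<noteq> m"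
  by (subst AE_lebesgue_on_iff_negligible, simp, rule negligible_subset[OF negligible_sing[of m]]) auto

lemma AE_lebesgue_on_mem: "AE t in lebesgue_on S. t \<in> S"
  by (rule AE_I2) simp

text \<open>By completeness every subset of the exceptional set is measurable, whatever the value space.\<close>
lemma borel_measurable_lebesgue_on_AE_cong:
  fixes f g :: "'a::euclidean_space \<Rightarrow> 'b::topological_space"
  assumes f: "f \<in> borel_measurable (lebesgue_on S)" and S: "S \<in> sets lebesgue"
    and eq: "AE t in lebesgue_on S. f t = g t"
  shows "g \<in> borel_measurable (lebesgue_on S)"
proof (rule measurableI)
  fix B :: "'b set" assume "B \<in> sets borel"
  define N where "N = {t\<in>S. f t \<noteq> g t}"
  have N: "N \<in> null_sets lebesgue" using eq S by (simp add: AE_lebesgue_on_iff_null N_def)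
  have sub: "M \<in> sets lebesgue" if "M \<subseteq> N" for M
    using completion.complete2[OF that N] by (simp add: null_sets_def)
  have 1: "f -` B \<inter> S \<in> sets lebesgue"
    using measurable_sets[OF f \<open>B \<in> sets borel\<close>] S by (simp add: sets_restrict_space_iff)
  have "g -` B \<inter> S = ((f -` B \<inter> S) - N) \<union> (g -` B \<inter> S \<inter> N)"
    by (auto simp: N_def)
  moreover have "\<dots> \<in> sets lebesgue"
    using 1 sub[of "g -` B \<inter> S \<inter> N"] sub[of N] by blast
  ultimately have "g -` B \<inter> S \<in> sets lebesgue" by simp
  then show "g -` B \<inter> space (lebesgue_on S) \<in> sets (lebesgue_on S)"
    using S by (simp add: sets_restrict_space_iff)
qed auto

lemma borel_measurable_lebesgue_on_LIMSEQ_AE: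
  fixes g :: "'a::euclidean_space \<Rightarrow> 'b::real_normed_vector"
  assumes f[measurable]: "\<And>n. f n \<in> borel_measurable (lebesgue_on S)" and S: "S \<in> sets lebesgue"
    and lim: "AE t in lebesgue_on S. (\<lambda>n. f n t) \<longlonglongrightarrow> g t"
  shows "g \<in> borel_measurable (lebesgue_on S)"
proof -
  define N where "N = {t\<in>S. \<not> ((\<lambda>n. f n t) \<longlonglongrightarrow> g t)}"
  have "N \<in> null_sets lebesgue" using lim S by (simp add: AE_lebesgue_on_iff_null N_def)
  then have [measurable]: "N \<in> sets (lebesgue_on S)"
    using S by (auto simp: null_sets_def sets_restrict_space_iff N_def)
  have "(\<lambda>t. if t \<in> N then 0 else g t) \<in> borel_measurable (lebesgue_on S)"
  proof (rule borel_measurable_LIMSEQ_metric)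
    show "(\<lambda>t. if t \<in> N then 0 else f n t) \<in> borel_measurable (lebesgue_on S)" for n by simp
    show "(\<lambda>n. if t \<in> N then 0 else f n t) \<longlonglongrightarrow> (if t \<in> N then 0 else g t)"
      if "t \<in> space (lebesgue_on S)" for t using that by (auto simp: N_def)
  qed
  moreover have "AE t in lebesgue_on S. (if t \<in> N then 0 else g t) = g t"
    using lim AE_space by eventually_elim (auto simp: N_def)
  ultimately show ?thesis
    using S borel_measurable_lebesgue_on_AE_cong by blast
qed

text \<open>Pettis' criterion. A Borel function with almost all values in the closure of a countable set is
  approximated by a nearest point among the first \<open>n\<close> members of that set. The criterion is what
  makes strong measurability stable under limits almost everywhere, which the definition by simple
  functions does not show.\<close>
lemma strongly_measurable_on_iff:
  fixes f :: "real \<Rightarrow> 'b::real_normed_vector"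
  assumes S: "S \<in> sets lebesgue"
  shows "strongly_measurable_on S f \<longleftrightarrow> f \<in> borel_measurable (lebesgue_on S) \<and>
    (\<exists>C. countable C \<and> (AE t in lebesgue_on S. f t \<in> closure C))"
proof
  assume "strongly_measurable_on S f"
  then obtain \<sigma> where simp: "\<And>n. simple_function (lebesgue_on S) (\<sigma> n)"
    and lim: "AE t in lebesgue_on S. (\<lambda>n. \<sigma> n t) \<longlonglongrightarrow> f t"
    unfolding strongly_measurable_on_def by blast
  have "f \<in> borel_measurable (lebesgue_on S)"
    by (rule borel_measurable_lebesgue_on_LIMSEQ_AE[OF borel_measurable_simple_function[OF simp] S lim])
  moreover have "countable (\<Union>n. \<sigma> n ` S)"
    using simp by (auto intro!: countable_UN simp: simple_function_def intro: countable_finite)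
  moreover have "AE t in lebesgue_on S. f t \<in> closure (\<Union>n. \<sigma> n ` S)"
    using lim AE_space
  proof eventually_elim
    case (elim t)
    then show ?case unfolding closure_sequential by (auto intro!: exI[of _ "\<lambda>n. \<sigma> n t"])
  qed
  ultimately show "f \<in> borel_measurable (lebesgue_on S) \<and>
    (\<exists>C. countable C \<and> (AE t in lebesgue_on S. f t \<in> closure C))" by blast
next
  assume "f \<in> borel_measurable (lebesgue_on S) \<and>
    (\<exists>C. countable C \<and> (AE t in lebesgue_on S. f t \<in> closure C))"
  then obtain C where f[measurable]: "f \<in> borel_measurable (lebesgue_on S)" and C: "countable C"
    and cl: "AE t in lebesgue_on S. f t \<in> closure C" by blast
  define e where "e = from_nat_into (insert 0 C)"
  have e: "range e = insert 0 C"
    unfolding e_def using C by (intro range_from_nat_into) auto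
  \<comment> \<open>Taking the least index of a nearest point makes the choice measurable.\<close>
  define best where "best n t i \<longleftrightarrow> i \<le> n \<and> (\<forall>l\<in>{..n}. dist (e i) (f t) \<le> dist (e l) (f t))"
    for n t and i :: nat
  define k where "k n t = (LEAST i. best n t i)" for n t
  have ex: "\<exists>i. best n t i" for n t
  proof -
    let ?M = "(\<lambda>i. dist (e i) (f t)) ` {..n}"
    have "Min ?M \<in> ?M" by (rule Min_in) auto
    then obtain i where "i \<le> n" "dist (e i) (f t) = Min ?M" by force
    then show ?thesis by (auto simp: best_def intro!: exI[of _ i])
  qed
  have k: "best n t (k n t)" for n t
    unfolding k_def using ex by (rule LeastI_ex)
  have [measurable]: "(\<lambda>t. dist c (f t)) \<in> borel_measurable (lebesgue_on S)" for c
    by (rule measurable_compose[OF f borel_measurable_continuous_onI]) (intro continuous_intros)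
  have "(\<lambda>t. k n t) \<in> measurable (lebesgue_on S) (count_space UNIV)" for n
    unfolding k_def best_def by measurable
  then have "simple_function (lebesgue_on S) (\<lambda>t. k n t)" for n
    unfolding simple_function_eq_measurable using k
    by (auto intro!: finite_subset[of "k n ` S" "{..n}"] simp: best_def)
  then have "simple_function (lebesgue_on S) (\<lambda>t. e (k n t))" for n
    by (rule simple_function_compose1[where g = e])
  moreover have "AE t in lebesgue_on S. (\<lambda>n. e (k n t)) \<longlonglongrightarrow> f t"
    using cl
  proof eventually_elim
    case (elim t)
    show ?case
    proof (rule metric_LIMSEQ_I)
      fix \<epsilon> :: real assume "0 < \<epsilon>"
      then obtain y where "y \<in> C" "dist y (f t) < \<epsilon>" using elim by (meson closure_approachable)
      then obtain i where i: "dist (e i) (f t) < \<epsilon>" using e by (metis imageE insertI2)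
      have "dist (e (k n t)) (f t) < \<epsilon>" if "n \<ge> i" for n
        using k[of n t] i that unfolding best_def by (meson atMost_iff le_less_trans)
      then show "\<exists>no. \<forall>n\<ge>no. dist (e (k n t)) (f t) < \<epsilon>" by blast
    qed
  qed
  ultimately show "strongly_measurable_on S f"
    unfolding strongly_measurable_on_def by (intro exI[of _ "\<lambda>n t. e (k n t)"]) blast
qed

lemma strongly_measurable_on_imp_borel:
  "strongly_measurable_on S f \<Longrightarrow> S \<in> sets lebesgue \<Longrightarrow> f \<in> borel_measurable (lebesgue_on S)"
  by (simp add: strongly_measurable_on_iff)

lemma strongly_measurable_on_AE_cong:
  assumes "strongly_measurable_on S f" "AE t in lebesgue_on S. f t = g t"
  shows "strongly_measurable_on S g"
proof -
  obtain \<sigma> where "\<And>n. simple_function (lebesgue_on S) (\<sigma> n)"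
    and lim: "AE t in lebesgue_on S. (\<lambda>n. \<sigma> n t) \<longlonglongrightarrow> f t"
    using assms(1) unfolding strongly_measurable_on_def by blast
  moreover have "AE t in lebesgue_on S. (\<lambda>n. \<sigma> n t) \<longlonglongrightarrow> g t"
    using lim assms(2) by eventually_elim simp
  ultimately show ?thesis unfolding strongly_measurable_on_def by blast
qed

lemma strongly_measurable_on_LIMSEQ:
  assumes f: "\<And>n. strongly_measurable_on S (f n)" and S: "S \<in> sets lebesgue"
    and lim: "AE t in lebesgue_on S. (\<lambda>n. f n t) \<longlonglongrightarrow> g t"
  shows "strongly_measurable_on S g"
proof -
  have "\<forall>n. \<exists>C. countable C \<and> (AE t in lebesgue_on S. f n t \<in> closure C)"
    using f S by (simp add: strongly_measurable_on_iff)
  then obtain C where C: "\<And>n. countable (C n)" "\<And>n. AE t in lebesgue_on S. f n t \<in> closure (C n)"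
    by metis
  have "g \<in> borel_measurable (lebesgue_on S)"
    by (rule borel_measurable_lebesgue_on_LIMSEQ_AE[OF strongly_measurable_on_imp_borel[OF f S] S lim])
  moreover have "AE t in lebesgue_on S. \<forall>n. f n t \<in> closure (C n)"
    using C(2) by (simp add: AE_all_countable)
  then have "AE t in lebesgue_on S. g t \<in> closure (\<Union>n. C n)"
    using lim
  proof eventually_elim
    case (elim t)
    then have "\<And>n. f n t \<in> closure (\<Union>n. C n)"
      by (meson UNIV_I UN_upper closure_mono subsetD)
    then show ?case using elim(2) closed_sequentially[of "closure (\<Union>n. C n)" "\<lambda>n. f n t"] by simp
  qed
  moreover have "countable (\<Union>n. C n)" using C(1) by blast
  ultimately show ?thesis using S by (auto simp: strongly_measurable_on_iff)
qed

lemma strongly_measurable_on_comp2: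
  assumes "strongly_measurable_on S f" "strongly_measurable_on S g"
    and h: "\<And>p. isCont (\<lambda>(x, y). h x y) p"
  shows "strongly_measurable_on S (\<lambda>t. h (f t) (g t))"
proof -
  obtain \<sigma> \<rho> where \<sigma>: "\<And>n. simple_function (lebesgue_on S) (\<sigma> n)"
    and \<rho>: "\<And>n. simple_function (lebesgue_on S) (\<rho> n)"
    and lim: "AE t in lebesgue_on S. (\<lambda>n. \<sigma> n t) \<longlonglongrightarrow> f t" "AE t in lebesgue_on S. (\<lambda>n. \<rho> n t) \<longlonglongrightarrow> g t"
    using assms(1,2) unfolding strongly_measurable_on_def by blast
  have "simple_function (lebesgue_on S) (\<lambda>t. h (\<sigma> n t) (\<rho> n t))" for n
    by (rule simple_function_compose2[where h = h, OF \<sigma>[of n] \<rho>[of n]])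
  moreover have "AE t in lebesgue_on S. (\<lambda>n. h (\<sigma> n t) (\<rho> n t)) \<longlonglongrightarrow> h (f t) (g t)"
    using lim
  proof eventually_elim
    case (elim t)
    have "(\<lambda>n. (\<sigma> n t, \<rho> n t)) \<longlonglongrightarrow> (f t, g t)" using elim by (rule tendsto_Pair)
    have "(\<lambda>n. case (\<sigma> n t, \<rho> n t) of (x, y) \<Rightarrow> h x y) \<longlonglongrightarrow> (case (f t, g t) of (x, y) \<Rightarrow> h x y)"
      by (rule isCont_tendsto_compose[where g = "\<lambda>(x, y). h x y"]) fact+
    then show ?case by simp
  qed
  ultimately show ?thesis unfolding strongly_measurable_on_def
    by (intro exI[of _ "\<lambda>n t. h (\<sigma> n t) (\<rho> n t)"]) blast
qed

lemma strongly_measurable_on_const: "strongly_measurable_on S (\<lambda>_. c)"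
  unfolding strongly_measurable_on_def by (rule exI[of _ "\<lambda>_ _. c"]) simp

lemma strongly_measurable_on_comp:
  assumes "strongly_measurable_on S f" and h: "\<And>x. isCont h x"
  shows "strongly_measurable_on S (\<lambda>t. h (f t))"
proof -
  have "isCont (\<lambda>(x, y::real). h x) p" for p
  proof -
    have "isCont (\<lambda>p::_ \<times> real. h (fst p)) p" by (intro isCont_o2[OF isCont_fst h]) simp
    then show ?thesis by (simp add: case_prod_beta')
  qed
  then show ?thesis
    by (rule strongly_measurable_on_comp2[OF assms(1) strongly_measurable_on_const[of S "0::real"], of "\<lambda>x _. h x"])
qed

lemma strongly_measurable_on_real:
  assumes "f \<in> borel_measurable (lebesgue_on S)" "S \<in> sets lebesgue"
  shows "strongly_measurable_on S (f :: real \<Rightarrow> 'b::euclidean_space)"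
proof -
  obtain C :: "'b set" where "countable C" "\<And>x. x \<in> closure C"
  proof -
    obtain C :: "'b set" where C: "countable C" "\<And>X. open X \<Longrightarrow> X \<noteq> {} \<Longrightarrow> \<exists>d\<in>C. d \<in> X"
      using countable_dense_exists[where 'a='b] by blast
    have "x \<in> closure C" for x
      unfolding closure_iff_nhds_not_empty using C(2) by fast
    then show thesis using that C(1) by blast
  qed
  then show ?thesis using assms by (auto simp: strongly_measurable_on_iff)
qed

lemma strongly_measurable_on_subset:
  assumes "strongly_measurable_on S f" "T \<subseteq> S" "S \<in> sets lebesgue" "T \<in> sets lebesgue"
  shows "strongly_measurable_on T f"
  using assms by (auto simp: strongly_measurable_on_iff intro: measurable_restrict_mono AE_lebesgue_on_subset)

lemma strongly_measurable_on_zero_extend: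
  assumes f: "strongly_measurable_on T f" and S: "S \<in> sets lebesgue" and T: "T \<in> sets lebesgue" and "T \<subseteq> S"
  shows "strongly_measurable_on S (\<lambda>t. if t \<in> T then f t else 0)"
proof -
  obtain \<sigma> where \<sigma>: "\<And>n. simple_function (lebesgue_on T) (\<sigma> n)"
    and lim: "AE t in lebesgue_on T. (\<lambda>n. \<sigma> n t) \<longlonglongrightarrow> f t"
    using f unfolding strongly_measurable_on_def by blast
  have "simple_function (lebesgue_on S) (\<lambda>t. if t \<in> T then \<sigma> n t else 0)" for n
    unfolding simple_function_def
  proof
    have "(\<lambda>t. if t \<in> T then \<sigma> n t else 0) ` space (lebesgue_on S) \<subseteq> insert 0 (\<sigma> n ` T)" by auto
    then show "finite ((\<lambda>t. if t \<in> T then \<sigma> n t else 0) ` space (lebesgue_on S))"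
      using simple_functionD(1)[OF \<sigma>[of n]] by (auto elim: finite_subset)
    have meas: "\<sigma> n -` {y} \<inter> T \<in> sets lebesgue" for y
      using simple_functionD(2)[OF \<sigma>[of n], of "{y}"] T by (simp add: sets_restrict_space_iff)
    have "(\<lambda>t. if t \<in> T then \<sigma> n t else 0) -` {y} \<inter> S = (\<sigma> n -` {y} \<inter> T) \<union> (if y = 0 then S - T else {})" for y
      using \<open>T \<subseteq> S\<close> by (auto split: if_splits)
    moreover have "\<dots> y \<in> sets lebesgue" for y
      using meas S T by auto
    ultimately show "\<forall>y\<in>(\<lambda>t. if t \<in> T then \<sigma> n t else 0) ` space (lebesgue_on S).
         (\<lambda>t. if t \<in> T then \<sigma> n t else 0) -` {y} \<inter> space (lebesgue_on S) \<in> sets (lebesgue_on S)"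
      using S \<open>T \<subseteq> S\<close> by (auto simp: sets_restrict_space_iff)
  qed
  moreover have "AE t in lebesgue_on S. (\<lambda>n. if t \<in> T then \<sigma> n t else 0) \<longlonglongrightarrow> (if t \<in> T then f t else 0)"
    using lim unfolding AE_lebesgue_on_iff_negligible[OF S] AE_lebesgue_on_iff_negligible[OF T]
    by (rule negligible_subset) auto
  ultimately show ?thesis unfolding strongly_measurable_on_def
    by (intro exI[of _ "\<lambda>n t. if t \<in> T then \<sigma> n t else 0"]) blast
qed

text \<open>Strong measurability of \<open>B\<close> concerns only \<open>t \<mapsto> B t x\<close> with \<open>x\<close> fixed. For a simple function \<open>\<sigma>\<close> the
  function \<open>t \<mapsto> B t (\<sigma> t)\<close> is assembled from finitely many of these, and a general \<open>f\<close> is a limit.\<close>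
lemma strongly_measurable_on_blinfun:
  fixes B :: "real \<Rightarrow> 'd::real_normed_vector \<Rightarrow>\<^sub>L 'x::real_normed_vector"
  assumes B: "op_strongly_measurable_on S B" and f: "strongly_measurable_on S f" and S: "S \<in> sets lebesgue"
  shows "strongly_measurable_on S (\<lambda>t. B t (f t))"
proof -
  obtain \<sigma> where \<sigma>: "\<And>n. simple_function (lebesgue_on S) (\<sigma> n)"
    and lim: "AE t in lebesgue_on S. (\<lambda>n. \<sigma> n t) \<longlonglongrightarrow> f t"
    using f unfolding strongly_measurable_on_def by blast
  show ?thesis
  proof (rule strongly_measurable_on_LIMSEQ[OF _ S])
    fix n
    define Y where "Y = \<sigma> n ` S"
    have "finite Y" using simple_functionD(1)[OF \<sigma>[of n]] by (simp add: Y_def)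
    have E: "\<sigma> n -` {y} \<inter> S \<in> sets lebesgue" for y
      using simple_functionD(2)[OF \<sigma>[of n], of "{y}"] S by (simp add: sets_restrict_space_iff)
    have 1: "strongly_measurable_on S (\<lambda>t. if t \<in> \<sigma> n -` {y} \<inter> S then B t y else 0)" for y
      by (intro strongly_measurable_on_zero_extend S E strongly_measurable_on_subset[OF _ _ S E])
        (use B in \<open>auto simp: op_strongly_measurable_on_def\<close>)
    have "strongly_measurable_on S (\<lambda>t. \<Sum>y\<in>Y. if t \<in> \<sigma> n -` {y} \<inter> S then B t y else 0)"
      using \<open>finite Y\<close>
    proof (induction Y)
      case (insert y F)
      show ?case
        unfolding sum.insert[OF insert.hyps]
        by (rule strongly_measurable_on_comp2[OF 1 insert.IH, of "(+)"])
          (simp add: case_prod_beta')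
    qed (simp add: strongly_measurable_on_const)
    moreover have "(\<Sum>y\<in>Y. if t \<in> \<sigma> n -` {y} \<inter> S then B t y else 0) = B t (\<sigma> n t)" if "t \<in> S" for t
    proof -
      have "(\<Sum>y\<in>Y. if t \<in> \<sigma> n -` {y} \<inter> S then B t y else 0) = (\<Sum>y\<in>Y. if \<sigma> n t = y then B t y else 0)"
        using that by (intro sum.cong) auto
      also have "\<dots> = B t (\<sigma> n t)" using \<open>finite Y\<close> that by (simp add: Y_def)
      finally show ?thesis .
    qed
    ultimately show "strongly_measurable_on S (\<lambda>t. B t (\<sigma> n t))"
      using strongly_measurable_on_AE_cong[of S _ "\<lambda>t. B t (\<sigma> n t)"] AE_I2[of "lebesgue_on S"] by simp
  next
    show "AE t in lebesgue_on S. (\<lambda>n. B t (\<sigma> n t)) \<longlonglongrightarrow> B t (f t)"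
      using lim by eventually_elim (intro tendsto_intros)
  qed
qed

lemma strongly_measurable_on_add:
  assumes "strongly_measurable_on S f" "strongly_measurable_on S g"
  shows "strongly_measurable_on S (\<lambda>t. f t + g t)"
  by (rule strongly_measurable_on_comp2[OF assms, of "(+)"]) (simp add: case_prod_beta')

lemma strongly_measurable_on_scaleR:
  assumes "strongly_measurable_on S f" "strongly_measurable_on S g"
  shows "strongly_measurable_on S (\<lambda>t. f t *\<^sub>R g t)"
  by (rule strongly_measurable_on_comp2[OF assms, of "(*\<^sub>R)"]) (simp add: case_prod_beta')

section \<open>The spaces of p-integrable functions\<close>

text \<open>Only a seminorm for \<open>p \<ge> 1\<close>: functions that agree almost everywhere are not identified. This keeps
  the elements of \<open>Lp_space\<close> honest functions, to which operators can be applied pointwise.\<close>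
definition Lp_norm :: "real \<Rightarrow> real \<Rightarrow> real \<Rightarrow> (real \<Rightarrow> 'b::real_normed_vector) \<Rightarrow> real" where
  "Lp_norm p a b f = (LINT t|lebesgue_on {a..b}. norm (f t) powr p) powr (1 / p)"

lemma Lp_norm_nonneg [simp]: "0 \<le> Lp_norm p a b f"
  by (simp add: Lp_norm_def)

lemma Lp_space_measurable: "f \<in> Lp_space p a b \<Longrightarrow> strongly_measurable_on {a..b} f"
  by (simp add: Lp_space_def)

lemma Lp_space_integrable: "f \<in> Lp_space p a b \<Longrightarrow> integrable (lebesgue_on {a..b}) (\<lambda>t. norm (f t) powr p)"
  by (simp add: Lp_space_def)

lemma strongly_measurable_on_norm_borel:
  assumes "strongly_measurable_on {a..b::real} f"
  shows "(\<lambda>t. norm (f t)) \<in> borel_measurable (lebesgue_on {a..b})"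
proof -
  have "f \<in> borel_measurable (lebesgue_on {a..b})"
    by (rule strongly_measurable_on_imp_borel[OF assms]) simp
  then show ?thesis by simp
qed

lemma Lp_norm_powr:
  assumes "p > 0"
  shows "Lp_norm p a b f powr p = (LINT t|lebesgue_on {a..b}. norm (f t) powr p)"
proof -
  have "0 \<le> (LINT t|lebesgue_on {a..b}. norm (f t) powr p)"
    by (rule Bochner_Integration.integral_nonneg) simp
  then show ?thesis using assms by (simp add: Lp_norm_def powr_powr)
qed

lemma Lp_norm_leI:
  assumes "p > 0" "C \<ge> 0" "(LINT t|lebesgue_on {a..b}. norm (f t) powr p) \<le> C powr p"
  shows "Lp_norm p a b f \<le> C"
proof -
  have "Lp_norm p a b f powr p \<le> C powr p" using assms by (simp add: Lp_norm_powr)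
  then show ?thesis using powr_less_mono2[OF assms(1,2), of "Lp_norm p a b f"] by linarith
qed

lemma integrable_nonneg_bound:
  fixes g h :: "'a \<Rightarrow> real"
  assumes "integrable M h" "g \<in> borel_measurable M" "\<And>t. 0 \<le> g t" "\<And>t. g t \<le> h t"
  shows "integrable M g"
proof (rule Bochner_Integration.integrable_bound[OF assms(1,2)])
  have "norm (g t) \<le> norm (h t)" for t using assms(3,4)[of t] by simp
  then show "AE t in M. norm (g t) \<le> norm (h t)" by simp
qed

text \<open>The two functions may have values in different spaces, so that this yields bounds for images
  under operators and for cut-offs alike.\<close>
lemma Lp_dominated:
  assumes g: "strongly_measurable_on {a..b} g" and f: "f \<in> Lp_space p a b" and p: "p > 0" and K: "K \<ge> 0"
    and le: "AE t in lebesgue_on {a..b}. norm (g t) \<le> K * norm (f t)"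
  shows "g \<in> Lp_space p a b" "Lp_norm p a b g \<le> K * Lp_norm p a b f"
proof -
  have [measurable]: "(\<lambda>t. norm (g t)) \<in> borel_measurable (lebesgue_on {a..b})"
    by (rule strongly_measurable_on_norm_borel[OF g])
  have int: "integrable (lebesgue_on {a..b}) (\<lambda>t. K powr p * norm (f t) powr p)"
    using Lp_space_integrable[OF f] by simp
  have le': "AE t in lebesgue_on {a..b}. norm (g t) powr p \<le> K powr p * norm (f t) powr p"
    using le
  proof eventually_elim
    case (elim t)
    then have "norm (g t) powr p \<le> (K * norm (f t)) powr p" using p by (intro powr_mono2) auto
    then show ?case using K by (simp add: powr_mult)
  qed
  have int': "integrable (lebesgue_on {a..b}) (\<lambda>t. norm (g t) powr p)"
    by (rule Bochner_Integration.integrable_bound[OF int]) (use le' in \<open>auto elim: eventually_mono\<close>)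
  show "g \<in> Lp_space p a b" using int' g by (simp add: Lp_space_def)
  have "(LINT t|lebesgue_on {a..b}. norm (g t) powr p) \<le> (LINT t|lebesgue_on {a..b}. K powr p * norm (f t) powr p)"
    by (rule integral_mono_AE[OF int' int le'])
  also have "\<dots> = (K * Lp_norm p a b f) powr p"
    using p K by (simp add: powr_mult Lp_norm_powr)
  finally show "Lp_norm p a b g \<le> K * Lp_norm p a b f"
    using p K by (intro Lp_norm_leI) auto
qed

lemma Lp_AE_cong:
  assumes f: "f \<in> Lp_space p a b" and p: "p > 0" and eq: "AE t in lebesgue_on {a..b}. f t = g t"
  shows "g \<in> Lp_space p a b" "Lp_norm p a b g = Lp_norm p a b f"
proof -
  have g: "strongly_measurable_on {a..b} g"
    using strongly_measurable_on_AE_cong[OF Lp_space_measurable[OF f] eq] .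
  have 1: "AE t in lebesgue_on {a..b}. norm (g t) \<le> 1 * norm (f t)"
    using eq by eventually_elim simp
  have 2: "AE t in lebesgue_on {a..b}. norm (f t) \<le> 1 * norm (g t)"
    using eq by eventually_elim simp
  show *: "g \<in> Lp_space p a b" using Lp_dominated(1)[OF g f p _ 1] by simp
  show "Lp_norm p a b g = Lp_norm p a b f"
    using Lp_dominated(2)[OF g f p _ 1] Lp_dominated(2)[OF Lp_space_measurable[OF f] * p _ 2] by simp
qed

lemma powr_convex_nonneg:
  fixes p l u v :: real
  assumes "p \<ge> 1" "0 \<le> l" "l \<le> 1" "0 \<le> u" "0 \<le> v"
  shows "(l * u + (1 - l) * v) powr p \<le> l * u powr p + (1 - l) * v powr p"
proof -
  have small: "(k * w) powr p \<le> k * w powr p" if "0 \<le> k" "k \<le> 1" "0 \<le> w" for k w :: real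
  proof -
    have "k powr p \<le> k powr 1" using that assms(1) powr_mono'[of 1 p k] by simp
    then have "k powr p \<le> k" using that by simp
    then show ?thesis using that by (simp add: powr_mult mult_right_mono)
  qed
  consider "u = 0" | "v = 0" | "0 < u" "0 < v" using assms by linarith
  then show ?thesis
  proof cases
    case 1
    then show ?thesis using small[of "1 - l" v] assms by simp
  next
    case 2
    then show ?thesis using small[of l u] assms by simp
  next
    case 3
    then show ?thesis
      using convex_onD[OF powr_convex[OF assms(1)], of "1 - l" u v] assms by (simp add: algebra_simps)
  qed
qed

text \<open>Convexity of the power, applied to \<open>(x + y) / (\<alpha> + \<beta>)\<close> as a convex combination of \<open>x / \<alpha>\<close> and
  \<open>y / \<beta>\<close>. With \<open>\<alpha>\<close> and \<open>\<beta>\<close> close to the norms of two functions, integration gives Minkowski's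
  inequality.\<close>
lemma powr_add_le:
  fixes p x y \<alpha> \<beta> :: real
  assumes "p \<ge> 1" "0 \<le> x" "0 \<le> y" "0 < \<alpha>" "0 < \<beta>"
  shows "(x + y) powr p \<le> (\<alpha> + \<beta>) powr p * (\<alpha> / (\<alpha> + \<beta>) * (x powr p / \<alpha> powr p) + \<beta> / (\<alpha> + \<beta>) * (y powr p / \<beta> powr p))"
proof -
  have l: "1 - \<alpha> / (\<alpha> + \<beta>) = \<beta> / (\<alpha> + \<beta>)" using assms by (simp add: field_simps)
  have "x + y = (\<alpha> + \<beta>) * (\<alpha> / (\<alpha> + \<beta>) * (x / \<alpha>) + \<beta> / (\<alpha> + \<beta>) * (y / \<beta>))"
  proof -
    have "\<alpha> / (\<alpha> + \<beta>) * (x / \<alpha>) = x / (\<alpha> + \<beta>)" "\<beta> / (\<alpha> + \<beta>) * (y / \<beta>) = y / (\<alpha> + \<beta>)"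
      using assms by simp_all
    then show ?thesis using assms by (simp add: add_divide_distrib[symmetric])
  qed
  then have "(x + y) powr p = (\<alpha> + \<beta>) powr p * (\<alpha> / (\<alpha> + \<beta>) * (x / \<alpha>) + \<beta> / (\<alpha> + \<beta>) * (y / \<beta>)) powr p"
    using assms by (metis powr_mult)
  moreover have "(\<alpha> / (\<alpha> + \<beta>) * (x / \<alpha>) + \<beta> / (\<alpha> + \<beta>) * (y / \<beta>)) powr p
     \<le> \<alpha> / (\<alpha> + \<beta>) * (x / \<alpha>) powr p + \<beta> / (\<alpha> + \<beta>) * (y / \<beta>) powr p"
    using powr_convex_nonneg[of p "\<alpha> / (\<alpha> + \<beta>)" "x / \<alpha>" "y / \<beta>"] assms unfolding l by simp
  ultimately show ?thesis using assms by (simp add: powr_divide mult_left_mono)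
qed

text \<open>Minkowski's inequality. It is derived for all bounds \<open>\<alpha>\<close> and \<open>\<beta>\<close> that strictly exceed the two norms,
  because the norms themselves may vanish and are divided by.\<close>
lemma Lp_add:
  assumes f: "f \<in> Lp_space p a b" and g: "g \<in> Lp_space p a b" and p: "p \<ge> 1"
  shows "(\<lambda>t. f t + g t) \<in> Lp_space p a b"
    and "Lp_norm p a b (\<lambda>t. f t + g t) \<le> Lp_norm p a b f + Lp_norm p a b g"
proof -
  have sm: "strongly_measurable_on {a..b} (\<lambda>t. f t + g t)"
    by (intro strongly_measurable_on_add Lp_space_measurable[OF f] Lp_space_measurable[OF g])
  have [measurable]: "(\<lambda>t. norm (f t + g t)) \<in> borel_measurable (lebesgue_on {a..b})"
    by (rule strongly_measurable_on_norm_borel[OF sm])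
  have main: "integrable (lebesgue_on {a..b}) (\<lambda>t. norm (f t + g t) powr p) \<and>
    (LINT t|lebesgue_on {a..b}. norm (f t + g t) powr p) \<le> (\<alpha> + \<beta>) powr p"
    if \<alpha>: "Lp_norm p a b f < \<alpha>" and \<beta>: "Lp_norm p a b g < \<beta>" for \<alpha> \<beta>
  proof -
    have pos: "0 < \<alpha>" "0 < \<beta>" using \<alpha> \<beta> Lp_norm_nonneg[of p a b f] Lp_norm_nonneg[of p a b g] by linarith+
    let ?h = "\<lambda>t. (\<alpha> + \<beta>) powr p * (\<alpha> / (\<alpha> + \<beta>) * (norm (f t) powr p / \<alpha> powr p)
       + \<beta> / (\<alpha> + \<beta>) * (norm (g t) powr p / \<beta> powr p))"
    have int: "integrable (lebesgue_on {a..b}) ?h"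
      using Lp_space_integrable[OF f] Lp_space_integrable[OF g] by simp
    have le: "norm (f t + g t) powr p \<le> ?h t" for t
    proof -
      have "norm (f t + g t) powr p \<le> (norm (f t) + norm (g t)) powr p"
        using p by (intro powr_mono2 norm_triangle_ineq) auto
      also have "\<dots> \<le> ?h t" using p pos by (intro powr_add_le) auto
      finally show ?thesis .
    qed
    have int': "integrable (lebesgue_on {a..b}) (\<lambda>t. norm (f t + g t) powr p)"
      by (rule integrable_nonneg_bound[OF int _ _ le]) auto
    have "(LINT t|lebesgue_on {a..b}. norm (f t + g t) powr p) \<le> (LINT t|lebesgue_on {a..b}. ?h t)"
      by (rule integral_mono[OF int' int le])
    also have "\<dots> = (\<alpha> + \<beta>) powr p * (\<alpha> / (\<alpha> + \<beta>) * (Lp_norm p a b f powr p / \<alpha> powr p)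
       + \<beta> / (\<alpha> + \<beta>) * (Lp_norm p a b g powr p / \<beta> powr p))"
      using Lp_space_integrable[OF f] Lp_space_integrable[OF g] p by (simp add: Lp_norm_powr)
    also have "\<dots> \<le> (\<alpha> + \<beta>) powr p * (\<alpha> / (\<alpha> + \<beta>) * 1 + \<beta> / (\<alpha> + \<beta>) * 1)"
      using \<alpha> \<beta> pos p
      by (intro mult_left_mono add_mono) (auto simp: powr_mono2)
    also have "\<dots> = (\<alpha> + \<beta>) powr p" using pos by (simp add: add_divide_distrib[symmetric])
    finally show ?thesis using int' by blast
  qed
  show "(\<lambda>t. f t + g t) \<in> Lp_space p a b"
    using main[of "Lp_norm p a b f + 1" "Lp_norm p a b g + 1"] sm by (simp add: Lp_space_def)
  show "Lp_norm p a b (\<lambda>t. f t + g t) \<le> Lp_norm p a b f + Lp_norm p a b g"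
  proof (rule field_le_epsilon)
    fix e :: real assume "0 < e"
    then have "(LINT t|lebesgue_on {a..b}. norm (f t + g t) powr p)
      \<le> ((Lp_norm p a b f + e / 2) + (Lp_norm p a b g + e / 2)) powr p"
      by (intro conjunct2[OF main]) auto
    then have "Lp_norm p a b (\<lambda>t. f t + g t) \<le> (Lp_norm p a b f + e / 2) + (Lp_norm p a b g + e / 2)"
      using p \<open>0 < e\<close> by (intro Lp_norm_leI) (auto intro!: add_nonneg_nonneg)
    then show "Lp_norm p a b (\<lambda>t. f t + g t) \<le> Lp_norm p a b f + Lp_norm p a b g + e" by simp
  qed
qed

lemma Lp_zero [simp]: "(\<lambda>_. 0) \<in> Lp_space p a b" "Lp_norm p a b (\<lambda>_. 0) = 0"
  by (auto simp: Lp_space_def Lp_norm_def strongly_measurable_on_const)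

lemma Lp_blinfun:
  fixes f :: "real \<Rightarrow> 'd::real_normed_vector" and B :: "real \<Rightarrow> 'd \<Rightarrow>\<^sub>L 'x::real_normed_vector"
  assumes B: "op_strongly_measurable_on {a..b} B" and f: "f \<in> Lp_space p a b" and p: "p > 0" and K: "K \<ge> 0"
    and le: "\<And>t. t \<in> {a..b} \<Longrightarrow> norm (B t) \<le> K"
  shows "(\<lambda>t. B t (f t)) \<in> Lp_space p a b" "Lp_norm p a b (\<lambda>t. B t (f t)) \<le> K * Lp_norm p a b f"
proof -
  have "norm (B t (f t)) \<le> K * norm (f t)" if "t \<in> {a..b}" for t
    using norm_blinfun[of "B t" "f t"] mult_right_mono[OF le[OF that], of "norm (f t)"] by simp
  then have 1: "AE t in lebesgue_on {a..b}. norm (B t (f t)) \<le> K * norm (f t)"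
    by (intro AE_I2) simp
  have 2: "strongly_measurable_on {a..b} (\<lambda>t. B t (f t))"
    by (intro strongly_measurable_on_blinfun B Lp_space_measurable[OF f]) simp
  show "(\<lambda>t. B t (f t)) \<in> Lp_space p a b" "Lp_norm p a b (\<lambda>t. B t (f t)) \<le> K * Lp_norm p a b f"
    using Lp_dominated[OF 2 f p K 1] by auto
qed

lemma op_strongly_measurable_on_const: "op_strongly_measurable_on S (\<lambda>_. T)"
  by (simp add: op_strongly_measurable_on_def strongly_measurable_on_const)

lemma Lp_blinfun_const:
  assumes "f \<in> Lp_space p a b" and "p > 0"
  shows "(\<lambda>t. blinfun_apply T (f t)) \<in> Lp_space p a b" "Lp_norm p a b (\<lambda>t. blinfun_apply T (f t)) \<le> norm T * Lp_norm p a b f"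
  by (rule Lp_blinfun(1)[OF op_strongly_measurable_on_const assms, where K = "norm T"]; simp)
    (rule Lp_blinfun(2)[OF op_strongly_measurable_on_const assms, where K = "norm T"]; simp)

lemma Lp_scaleR:
  assumes f: "f \<in> Lp_space p a b" and p: "p > 0"
  shows "(\<lambda>t. c *\<^sub>R f t) \<in> Lp_space p a b" "Lp_norm p a b (\<lambda>t. c *\<^sub>R f t) = \<bar>c\<bar> * Lp_norm p a b f"
proof -
  have 2: "strongly_measurable_on {a..b} (\<lambda>t. c *\<^sub>R f t)"
    by (intro strongly_measurable_on_scaleR strongly_measurable_on_const Lp_space_measurable[OF f])
  show "(\<lambda>t. c *\<^sub>R f t) \<in> Lp_space p a b"
    by (rule Lp_dominated(1)[OF 2 f p, of "\<bar>c\<bar>"]) auto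
  show "Lp_norm p a b (\<lambda>t. c *\<^sub>R f t) = \<bar>c\<bar> * Lp_norm p a b f"
    using p by (simp add: Lp_norm_def powr_mult powr_powr)
qed

lemma Lp_minus:
  assumes f: "f \<in> Lp_space p a b" and p: "p > 0"
  shows "(\<lambda>t. - f t) \<in> Lp_space p a b" "Lp_norm p a b (\<lambda>t. - f t) = Lp_norm p a b f"
  using Lp_scaleR[OF f p, of "-1"] by simp_all

lemma Lp_diff:
  assumes f: "f \<in> Lp_space p a b" and g: "g \<in> Lp_space p a b" and p: "p \<ge> 1"
  shows "(\<lambda>t. f t - g t) \<in> Lp_space p a b"
    and "Lp_norm p a b (\<lambda>t. f t - g t) \<le> Lp_norm p a b f + Lp_norm p a b g"
  using Lp_add[OF f Lp_minus(1)[OF g] p] Lp_minus(2)[OF g] p by simp_all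

lemma Lp_norm_diff_commute: "Lp_norm p a b (\<lambda>t. f t - g t) = Lp_norm p a b (\<lambda>t. g t - f t)"
  by (simp add: Lp_norm_def norm_minus_commute)

lemma Lp_sum:
  assumes p: "p \<ge> 1" and "finite I" and "\<And>i. i \<in> I \<Longrightarrow> f i \<in> Lp_space p a b"
  shows "(\<lambda>t. \<Sum>i\<in>I. f i t) \<in> Lp_space p a b \<and>
    Lp_norm p a b (\<lambda>t. \<Sum>i\<in>I. f i t) \<le> (\<Sum>i\<in>I. Lp_norm p a b (f i))"
  using assms(2,3)
proof (induction I)
  case (insert i I)
  then show ?case using Lp_add[of "f i" p a b "\<lambda>t. \<Sum>i\<in>I. f i t"] p by fastforce
qed simp

lemma Lp_norm_eq_0_iff:
  assumes f: "f \<in> Lp_space p a b" and p: "p > 0"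
  shows "Lp_norm p a b f = 0 \<longleftrightarrow> (AE t in lebesgue_on {a..b}. f t = 0)"
  unfolding Lp_norm_def using integral_nonneg_eq_0_iff_AE[OF Lp_space_integrable[OF f]] by simp

lemma Lp_bounded:
  assumes f: "strongly_measurable_on {a..b} f" and "p > 0" and "a \<le> b" and "K \<ge> 0"
    and le: "AE t in lebesgue_on {a..b}. norm (f t) \<le> K"
  shows "f \<in> Lp_space p a b" "Lp_norm p a b f \<le> K * (b - a) powr (1 / p)"
proof -
  have int: "integrable (lebesgue_on {a..b}) (\<lambda>t. 1::real)"
    by (simp add: integrable_restrict_space)
  then have 1: "(\<lambda>t. 1::real) \<in> Lp_space p a b"
    by (simp add: Lp_space_def strongly_measurable_on_const)
  have "Lp_norm p a b (\<lambda>t. 1::real) = (b - a) powr (1 / p)"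
    using \<open>a \<le> b\<close> by (simp add: Lp_norm_def measure_restrict_space)
  then show "f \<in> Lp_space p a b" "Lp_norm p a b f \<le> K * (b - a) powr (1 / p)"
    using Lp_dominated[OF f 1 \<open>p > 0\<close> \<open>K \<ge> 0\<close>] le by simp_all
qed

text \<open>The values at rational points are dense in the range. The endpoints are added to them because
  the interval may consist of a single irrational point.\<close>
lemma continuous_imp_strongly_measurable_on:
  fixes f :: "real \<Rightarrow> 'b::real_normed_vector"
  assumes "continuous_on {a..b} f"
  shows "strongly_measurable_on {a..b} f"
proof -
  have "f \<in> borel_measurable (lebesgue_on {a..b})"
    using continuous_imp_measurable_on_sets_lebesgue[OF assms] by simp
  moreover have "countable (f ` ({a..b} \<inter> \<rat>) \<union> {f a, f b})" using countable_rat by blast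
  moreover have "AE t in lebesgue_on {a..b}. f t \<in> closure (f ` ({a..b} \<inter> \<rat>) \<union> {f a, f b})"
  proof (rule AE_I2)
    fix t assume "t \<in> space (lebesgue_on {a..b})"
    then have t: "t \<in> {a..b}" by simp
    show "f t \<in> closure (f ` ({a..b} \<inter> \<rat>) \<union> {f a, f b})"
    proof (cases "a < t \<and> t < b")
      case True
      show ?thesis unfolding closure_approachable
      proof (intro allI impI)
        fix e :: real assume "0 < e"
        then obtain d where d: "d > 0" "\<And>x. x \<in> {a..b} \<Longrightarrow> dist x t < d \<Longrightarrow> dist (f x) (f t) < e"
          using assms t unfolding continuous_on_iff by metis
        obtain r where "r \<in> \<rat>" "t < r" "r < min b (t + d)" using Rats_dense_in_real[of t "min b (t + d)"] d True by auto
        then have "r \<in> {a..b} \<inter> \<rat>" "dist r t < d" using True by (auto simp: dist_real_def)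
        then show "\<exists>y\<in>f ` ({a..b} \<inter> \<rat>) \<union> {f a, f b}. dist y (f t) < e"
          using d(2)[of r] by (intro bexI[of _ "f r"]) auto
      qed
    next
      case False
      then have "t = a \<or> t = b" using t by auto
      then have "f t \<in> f ` ({a..b} \<inter> \<rat>) \<union> {f a, f b}" by auto
      then show ?thesis by (rule closure_subset[THEN subsetD])
    qed
  qed
  ultimately show ?thesis by (subst strongly_measurable_on_iff) (simp, blast)
qed

lemma continuous_imp_Lp:
  fixes f :: "real \<Rightarrow> 'b::real_normed_vector"
  assumes "continuous_on {a..b} f" "p > 0" "a \<le> b"
  shows "f \<in> Lp_space p a b"
proof -
  have "compact (f ` {a..b})" using assms(1) by (intro compact_continuous_image) auto
  then obtain K where "\<And>t. t \<in> {a..b} \<Longrightarrow> norm (f t) \<le> K" by (metis bounded_iff compact_imp_bounded imageI)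
  moreover from this have "K \<ge> 0" using norm_ge_zero[of "f a"] \<open>a \<le> b\<close> by (smt (verit) atLeastAtMost_iff)
  ultimately show ?thesis
    using Lp_bounded(1)[OF continuous_imp_strongly_measurable_on[OF assms(1)], of p K] assms
      AE_I2[of "lebesgue_on {a..b}"] by simp
qed

lemma Lp_mono_interval:
  assumes f: "f \<in> Lp_space p a b" and "a \<le> c" "d \<le> b"
  shows "f \<in> Lp_space p c d" "p > 0 \<Longrightarrow> Lp_norm p c d f \<le> Lp_norm p a b f"
proof -
  have sub: "{c..d} \<subseteq> {a..b}" using assms by auto
  have int: "integrable lebesgue (\<lambda>t. indicator {a..b} t *\<^sub>R norm (f t) powr p)"
    using Lp_space_integrable[OF f] by (simp add: integrable_restrict_space)
  then have int2: "integrable lebesgue (\<lambda>t. indicator {c..d} t *\<^sub>R (indicator {a..b} t *\<^sub>R norm (f t) powr p))"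
    by (rule integrable_mult_indicator[rotated]) simp
  have eq: "(\<lambda>t. indicator {c..d} t *\<^sub>R (indicator {a..b} t *\<^sub>R norm (f t) powr p)) = (\<lambda>t. indicator {c..d} t *\<^sub>R norm (f t) powr p)"
    using sub by (auto simp: fun_eq_iff indicator_def)
  have int3: "integrable lebesgue (\<lambda>t. indicator {c..d} t *\<^sub>R norm (f t) powr p)"
    using int2 unfolding eq .
  then have "integrable (lebesgue_on {c..d}) (\<lambda>t. norm (f t) powr p)"
    by (simp add: integrable_restrict_space)
  then show "f \<in> Lp_space p c d"
    using strongly_measurable_on_subset[OF Lp_space_measurable[OF f] sub] by (simp add: Lp_space_def)
  have "(LINT t|lebesgue_on {c..d}. norm (f t) powr p) \<le> (LINT t|lebesgue_on {a..b}. norm (f t) powr p)"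
    using integral_mono[OF int3 int] sub by (auto simp: integral_restrict_space indicator_def)
  then show "Lp_norm p c d f \<le> Lp_norm p a b f" if "p > 0"
    unfolding Lp_norm_def using that by (intro powr_mono2) (auto intro!: integral_nonneg)
qed

lemma Lp_zero_extend:
  assumes f: "f \<in> Lp_space p c d" and "a \<le> c" "d \<le> b"
  shows "(\<lambda>t. if t \<in> {c..d} then f t else 0) \<in> Lp_space p a b"
    "Lp_norm p a b (\<lambda>t. if t \<in> {c..d} then f t else 0) = Lp_norm p c d f"
proof -
  have sub: "{c..d} \<subseteq> {a..b}" using assms by auto
  have eq: "(\<lambda>t. indicator {a..b} t *\<^sub>R norm (if t \<in> {c..d} then f t else 0) powr p)
    = (\<lambda>t. indicator {c..d} t *\<^sub>R norm (f t) powr p)"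
    using sub by (auto simp: fun_eq_iff indicator_def)
  show "(\<lambda>t. if t \<in> {c..d} then f t else 0) \<in> Lp_space p a b"
    using Lp_space_integrable[OF f] strongly_measurable_on_zero_extend[OF Lp_space_measurable[OF f] _ _ sub]
    by (simp add: Lp_space_def integrable_restrict_space eq del: real_scaleR_def atLeastAtMost_iff)
  show "Lp_norm p a b (\<lambda>t. if t \<in> {c..d} then f t else 0) = Lp_norm p c d f"
    by (simp add: Lp_norm_def integral_restrict_space eq del: real_scaleR_def atLeastAtMost_iff)
qed

lemma Lp_concat:
  assumes f: "f \<in> Lp_space p a m" and g: "g \<in> Lp_space p m b" and p: "p \<ge> 1" and "a \<le> m" "m \<le> b"
  shows "(\<lambda>t. if t \<le> m then f t else g t) \<in> Lp_space p a b"
proof -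
  have 1: "(\<lambda>t. (if t \<in> {a..m} then f t else 0) + (if t \<in> {m..b} then g t else 0)) \<in> Lp_space p a b"
    using assms(4,5) by (intro Lp_add Lp_zero_extend(1) f g p) auto
  have "AE t in lebesgue_on {a..b}.
    (if t \<in> {a..m} then f t else 0) + (if t \<in> {m..b} then g t else 0) = (if t \<le> m then f t else g t)"
    using AE_lebesgue_on_neq[where a = a and b = b and m = m] AE_lebesgue_on_mem[of "{a..b}"]
    by eventually_elim auto
  from Lp_AE_cong(1)[OF 1 _ this] p show ?thesis by simp
qed

text \<open>Hoelder's inequality against the constant one: Young's inequality with a free parameter \<open>l\<close> is
  integrated, and then \<open>l\<close> is chosen optimally. If the norm vanishes, \<open>l\<close> is sent to zero.\<close>
lemma Lp_norm_1_le:
  assumes f: "f \<in> Lp_space p a b" and p: "p > 1" and "a < b"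
  shows "integrable (lebesgue_on {a..b}) (\<lambda>t. norm (f t))"
    "(LINT t|lebesgue_on {a..b}. norm (f t)) \<le> (b - a) powr (1 - 1 / p) * Lp_norm p a b f"
proof -
  have [measurable]: "(\<lambda>t. norm (f t)) \<in> borel_measurable (lebesgue_on {a..b})"
    by (rule strongly_measurable_on_norm_borel[OF Lp_space_measurable[OF f]])
  have young: "x \<le> l * (1 / p) * (x powr p / l powr p) + l * (1 - 1 / p)" if "0 \<le> x" "0 < l" for x l :: real
  proof -
    have "(x / l) * 1 \<le> (x / l) powr p / p + 1 powr (1 / (1 - 1 / p)) / (1 / (1 - 1 / p))"
      using p that by (intro Youngs_inequality) (auto simp: field_simps)
    then have "x / l \<le> (x powr p / l powr p) / p + (1 - 1 / p)" using that by (simp add: powr_divide)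
    then have "l * (x / l) \<le> l * ((x powr p / l powr p) / p + (1 - 1 / p))"
      using that by (intro mult_left_mono) auto
    then show ?thesis using that by (simp add: field_simps)
  qed
  have main: "integrable (lebesgue_on {a..b}) (\<lambda>t. norm (f t)) \<and>
      (LINT t|lebesgue_on {a..b}. norm (f t)) \<le> l * (1 / p) * (Lp_norm p a b f powr p / l powr p) + l * (1 - 1 / p) * (b - a)"
    if "l > 0" for l
  proof -
    let ?h = "\<lambda>t. l * (1 / p) * (norm (f t) powr p / l powr p) + l * (1 - 1 / p)"
    have int: "integrable (lebesgue_on {a..b}) ?h"
      using Lp_space_integrable[OF f] by (auto simp: integrable_restrict_space)
    have int': "integrable (lebesgue_on {a..b}) (\<lambda>t. norm (f t))"
      by (rule integrable_nonneg_bound[OF int _ _ young[OF _ that]]) auto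
    have "(LINT t|lebesgue_on {a..b}. norm (f t)) \<le> (LINT t|lebesgue_on {a..b}. ?h t)"
      by (rule integral_mono[OF int' int]) (intro young that norm_ge_zero)
    also have "\<dots> = l * (1 / p) * (Lp_norm p a b f powr p / l powr p) + l * (1 - 1 / p) * (b - a)"
      using Lp_space_integrable[OF f] p \<open>a < b\<close>
      by (subst Bochner_Integration.integral_add)
        (auto simp: Lp_norm_powr measure_restrict_space integrable_restrict_space)
    finally show ?thesis using int' by blast
  qed
  show "integrable (lebesgue_on {a..b}) (\<lambda>t. norm (f t))" using main[of 1] by simp
  show "(LINT t|lebesgue_on {a..b}. norm (f t)) \<le> (b - a) powr (1 - 1 / p) * Lp_norm p a b f"
  proof (cases "Lp_norm p a b f = 0")
    case True
    have "(LINT t|lebesgue_on {a..b}. norm (f t)) \<le> 0"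
    proof (rule field_le_epsilon)
      fix e :: real assume "0 < e"
      have "(LINT t|lebesgue_on {a..b}. norm (f t)) \<le> e / (b - a) * (1 - 1 / p) * (b - a)"
        using main[of "e / (b - a)"] True \<open>0 < e\<close> \<open>a < b\<close> p by simp
      also have "\<dots> = e * (1 - 1 / p)" using \<open>a < b\<close> by simp
      also have "\<dots> \<le> 0 + e" using p \<open>0 < e\<close> by (simp add: field_simps)
      finally show "(LINT t|lebesgue_on {a..b}. norm (f t)) \<le> 0 + e" .
    qed
    then show ?thesis using True by simp
  next
    case False
    then have N: "Lp_norm p a b f > 0" using Lp_norm_nonneg[of p a b f] by linarith
    define N where "N = Lp_norm p a b f"
    define l where "l = N / (b - a) powr (1 / p)"
    have l: "l > 0" using N \<open>a < b\<close> by (simp add: l_def N_def)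
    have "N powr p / l powr p = b - a"
      using N \<open>a < b\<close> p unfolding l_def N_def by (simp add: powr_divide powr_powr)
    then have "(LINT t|lebesgue_on {a..b}. norm (f t)) \<le> l * (1 / p) * (b - a) + l * (1 - 1 / p) * (b - a)"
      using main[OF l] by (simp add: N_def)
    also have "\<dots> = l * (b - a)" by (simp add: algebra_simps)
    also have "\<dots> = (b - a) powr (1 - 1 / p) * N" using \<open>a < b\<close> by (simp add: l_def powr_diff)
    finally show ?thesis by (simp add: N_def)
  qed
qed

text \<open>Fatou's lemma for the powers of the norms. Bounded sequences that converge almost everywhere thus
  have their limit in \<open>L\<^sup>p\<close>, which spares a separate integrability argument for sums of series.\<close>
lemma Lp_Fatou:
  assumes f: "\<And>n. f n \<in> Lp_space p a b" and p: "p > 0" and C: "\<And>n. Lp_norm p a b (f n) \<le> C"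
    and lim: "AE t in lebesgue_on {a..b}. (\<lambda>n. f n t) \<longlonglongrightarrow> g t"
  shows "g \<in> Lp_space p a b" "Lp_norm p a b g \<le> C"
proof -
  have C0: "0 \<le> C" using C[of 0] Lp_norm_nonneg[of p a b "f 0"] by linarith
  have g: "strongly_measurable_on {a..b} g"
    by (rule strongly_measurable_on_LIMSEQ[OF Lp_space_measurable[OF f] _ lim]) simp
  have [measurable]: "(\<lambda>t. norm (g t)) \<in> borel_measurable (lebesgue_on {a..b})"
    by (rule strongly_measurable_on_norm_borel[OF g])
  have [measurable]: "(\<lambda>t. norm (f n t)) \<in> borel_measurable (lebesgue_on {a..b})" for n
    by (rule strongly_measurable_on_norm_borel[OF Lp_space_measurable[OF f]])
  have bd: "(\<integral>\<^sup>+t. ennreal (norm (f n t) powr p) \<partial>lebesgue_on {a..b}) \<le> ennreal (C powr p)" for n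
  proof -
    have "(\<integral>\<^sup>+t. ennreal (norm (f n t) powr p) \<partial>lebesgue_on {a..b}) = ennreal (Lp_norm p a b (f n) powr p)"
      using nn_integral_eq_integral[OF Lp_space_integrable[OF f[of n]]] p by (simp add: Lp_norm_powr)
    also have "\<dots> \<le> ennreal (C powr p)" using C[of n] p by (intro ennreal_leI powr_mono2) auto
    finally show ?thesis .
  qed
  have "(\<integral>\<^sup>+t. ennreal (norm (g t) powr p) \<partial>lebesgue_on {a..b})
      = (\<integral>\<^sup>+t. liminf (\<lambda>n. ennreal (norm (f n t) powr p)) \<partial>lebesgue_on {a..b})"
  proof (rule nn_integral_cong_AE)
    show "AE t in lebesgue_on {a..b}. ennreal (norm (g t) powr p) = liminf (\<lambda>n. ennreal (norm (f n t) powr p))"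
      using lim
    proof eventually_elim
      case (elim t)
      have "(\<lambda>n. norm (f n t) powr p) \<longlonglongrightarrow> norm (g t) powr p"
        using elim p by (intro tendsto_powr' tendsto_norm tendsto_const) auto
      then have "(\<lambda>n. ennreal (norm (f n t) powr p)) \<longlonglongrightarrow> ennreal (norm (g t) powr p)"
        by (rule tendsto_ennrealI)
      then show ?case by (rule lim_imp_Liminf[symmetric, rotated]) simp
    qed
  qed
  also have "\<dots> \<le> liminf (\<lambda>n. \<integral>\<^sup>+t. ennreal (norm (f n t) powr p) \<partial>lebesgue_on {a..b})"
    by (rule nn_integral_liminf) simp
  also have "\<dots> \<le> liminf (\<lambda>n::nat. ennreal (C powr p))"
    by (intro Liminf_mono always_eventually allI bd)
  also have "\<dots> = ennreal (C powr p)" by (rule Liminf_const) simp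
  finally have le: "(\<integral>\<^sup>+t. ennreal (norm (g t) powr p) \<partial>lebesgue_on {a..b}) \<le> ennreal (C powr p)" .
  have int: "integrable (lebesgue_on {a..b}) (\<lambda>t. norm (g t) powr p)"
    by (rule integrableI_nonneg) (use le in \<open>auto simp: le_less_trans[OF le]\<close>)
  then show "g \<in> Lp_space p a b" using g by (simp add: Lp_space_def)
  have "ennreal (LINT t|lebesgue_on {a..b}. norm (g t) powr p) \<le> ennreal (C powr p)"
    using le nn_integral_eq_integral[OF int] by simp
  then show "Lp_norm p a b g \<le> C" using p C0 by (intro Lp_norm_leI) auto
qed

text \<open>Completeness of \<open>L\<^sup>p\<close>. The series converges absolutely almost everywhere because its norms are
  summable in \<open>L\<^sup>1\<close>, and Fatou's lemma, applied to the partial sums of a remainder, bounds the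
  remainder.\<close>
lemma Lp_Riesz_Fischer:
  fixes f :: "nat \<Rightarrow> real \<Rightarrow> 'b::banach"
  assumes f: "\<And>n. f n \<in> Lp_space p a b" and p: "p > 1" and "a < b"
    and sum: "summable (\<lambda>n. Lp_norm p a b (f n))"
  obtains g where "g \<in> Lp_space p a b" "AE t in lebesgue_on {a..b}. (\<lambda>n. f n t) sums g t"
    "\<And>n. Lp_norm p a b (\<lambda>t. g t - (\<Sum>k<n. f k t)) \<le> (\<Sum>k. Lp_norm p a b (f (k + n)))"
    "(\<lambda>n. Lp_norm p a b (\<lambda>t. g t - (\<Sum>k<n. f k t))) \<longlonglongrightarrow> 0"
proof -
  let ?M = "lebesgue_on {a..b}" and ?c = "(b - a) powr (1 - 1 / p)"
  have [measurable]: "(\<lambda>t. norm (f n t)) \<in> borel_measurable ?M" for n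
    by (rule strongly_measurable_on_norm_borel[OF Lp_space_measurable[OF f]])
  have "(\<integral>\<^sup>+t. (\<Sum>n. ennreal (norm (f n t))) \<partial>?M) = (\<Sum>n. \<integral>\<^sup>+t. ennreal (norm (f n t)) \<partial>?M)"
    by (rule nn_integral_suminf) simp
  also have "\<dots> = (\<Sum>n. ennreal (LINT t|?M. norm (f n t)))"
    using nn_integral_eq_integral[OF Lp_norm_1_le(1)[OF f p \<open>a < b\<close>]] by simp
  also have "\<dots> \<le> (\<Sum>n. ennreal (?c * Lp_norm p a b (f n)))"
    using Lp_norm_1_le(2)[OF f p \<open>a < b\<close>] by (intro suminf_le ennreal_leI) auto
  also have "\<dots> = ennreal (\<Sum>n. ?c * Lp_norm p a b (f n))"
    using sum by (intro suminf_ennreal2 summable_mult) auto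
  finally have fin: "(\<integral>\<^sup>+t. (\<Sum>n. ennreal (norm (f n t))) \<partial>?M) < \<infinity>"
    by (simp add: le_less_trans)
  have "AE t in ?M. (\<Sum>n. ennreal (norm (f n t))) \<noteq> \<infinity>"
    by (rule nn_integral_PInf_AE) (use fin in auto)
  then have ae: "AE t in ?M. summable (\<lambda>n. norm (f n t))"
    by eventually_elim (auto intro!: summable_suminf_not_top)
  define g where "g t = (\<Sum>n. f n t)" for t
  have sums: "AE t in ?M. (\<lambda>n. f n t) sums g t"
    using ae by eventually_elim (auto simp: g_def intro: summable_norm_cancel summable_sums)
  have part: "(\<lambda>t. \<Sum>k<n. f k t) \<in> Lp_space p a b" for n
    using Lp_sum[of p "{..<n}" f a b] f p by simp
  have tail: "(\<lambda>t. g t - (\<Sum>k<n. f k t)) \<in> Lp_space p a b \<and>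
    Lp_norm p a b (\<lambda>t. g t - (\<Sum>k<n. f k t)) \<le> (\<Sum>k. Lp_norm p a b (f (k + n)))" for n
  proof -
    have s: "summable (\<lambda>k. Lp_norm p a b (f (k + n)))"
      using sum summable_iff_shift[of "\<lambda>k. Lp_norm p a b (f k)" n] by simp
    have 1: "(\<lambda>t. \<Sum>k<m. f (k + n) t) \<in> Lp_space p a b" for m
      using Lp_sum[of p "{..<m}" "\<lambda>k. f (k + n)" a b] f p by simp
    have 2: "Lp_norm p a b (\<lambda>t. \<Sum>k<m. f (k + n) t) \<le> (\<Sum>k. Lp_norm p a b (f (k + n)))" for m
      using Lp_sum[of p "{..<m}" "\<lambda>k. f (k + n)" a b] f p sum_le_suminf[OF s, of "{..<m}"] by fastforce
    have 3: "AE t in ?M. (\<lambda>m. \<Sum>k<m. f (k + n) t) \<longlonglongrightarrow> g t - (\<Sum>k<n. f k t)"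
      using sums
    proof eventually_elim
      case (elim t)
      have "(\<lambda>k. f (k + n) t) sums (g t - (\<Sum>k<n. f k t))"
        by (rule sums_split_initial_segment[OF elim])
      then show ?case by (simp add: sums_def)
    qed
    show ?thesis using Lp_Fatou[OF 1 _ 2 3] p by simp
  qed
  have "g \<in> Lp_space p a b" using tail[of 0] by simp
  moreover have "(\<lambda>n. Lp_norm p a b (\<lambda>t. g t - (\<Sum>k<n. f k t))) \<longlonglongrightarrow> 0"
  proof (rule tendsto_sandwich[OF _ _ tendsto_const])
    show "(\<lambda>n. \<Sum>k. Lp_norm p a b (f (k + n))) \<longlonglongrightarrow> 0"
      using suminf_exist_split2[OF sum] by simp
  qed (use tail in auto)
  ultimately show thesis using that sums tail by blast
qed

section \<open>Dense subspaces and integration\<close>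

lemma Lp_dominated_convergence:
  assumes f: "\<And>n. f n \<in> Lp_space p a b" and g: "g \<in> Lp_space p a b"
    and h: "(h :: real \<Rightarrow> real) \<in> Lp_space p a b" and p: "p \<ge> 1"
    and le: "\<And>n. AE t in lebesgue_on {a..b}. norm (g t - f n t) \<le> norm (h t)"
    and lim: "AE t in lebesgue_on {a..b}. (\<lambda>n. f n t) \<longlonglongrightarrow> g t"
  shows "(\<lambda>n. Lp_norm p a b (\<lambda>t. g t - f n t)) \<longlonglongrightarrow> 0"
proof -
  let ?M = "lebesgue_on {a..b}"
  have [measurable]: "(\<lambda>t. norm (g t - f n t)) \<in> borel_measurable ?M" for n
    by (rule strongly_measurable_on_norm_borel[OF Lp_space_measurable[OF Lp_diff(1)[OF g f p]]])
  have "(\<lambda>n. LINT t|?M. norm (g t - f n t) powr p) \<longlonglongrightarrow> (LINT t|?M. 0)"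
  proof (rule integral_dominated_convergence[where w = "\<lambda>t. norm (h t) powr p"])
    show "AE t in ?M. (\<lambda>n. norm (g t - f n t) powr p) \<longlonglongrightarrow> 0"
      using lim
    proof eventually_elim
      case (elim t)
      then have "(\<lambda>n. norm (g t - f n t)) \<longlonglongrightarrow> norm (g t - g t)" by (intro tendsto_intros)
      then have "(\<lambda>n. norm (g t - f n t) powr p) \<longlonglongrightarrow> norm (g t - g t) powr p"
        using p by (intro tendsto_powr' tendsto_const) auto
      then show ?case using p by simp
    qed
    show "AE t in ?M. norm (norm (g t - f n t) powr p) \<le> norm (h t) powr p" for n
      using le[of n] by eventually_elim (use p in \<open>auto intro: powr_mono2\<close>)
  qed (use Lp_space_integrable[OF h] in auto)
  then have "(\<lambda>n. (LINT t|?M. norm (g t - f n t) powr p) powr (1 / p)) \<longlonglongrightarrow> (LINT t|?M. 0) powr (1 / p)"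
    using p by (intro tendsto_powr' tendsto_const)
      (auto intro!: always_eventually Bochner_Integration.integral_nonneg)
  then show ?thesis by (simp add: Lp_norm_def)
qed

lemma Lp_cutoff:
  assumes f: "f \<in> Lp_space p a b" and "p > 0" and c: "strongly_measurable_on {a..b} c" and "\<And>t. \<bar>c t\<bar> \<le> 1"
  shows "(\<lambda>t. c t *\<^sub>R f t) \<in> Lp_space p a b" "Lp_norm p a b (\<lambda>t. c t *\<^sub>R f t) \<le> Lp_norm p a b f"
proof -
  have 1: "strongly_measurable_on {a..b} (\<lambda>t. c t *\<^sub>R f t)"
    by (intro strongly_measurable_on_scaleR c Lp_space_measurable[OF f])
  have 2: "AE t in lebesgue_on {a..b}. norm (c t *\<^sub>R f t) \<le> 1 * norm (f t)"
    using mult_right_mono[OF assms(4) norm_ge_zero] by (auto intro!: AE_I2)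
  show "(\<lambda>t. c t *\<^sub>R f t) \<in> Lp_space p a b" "Lp_norm p a b (\<lambda>t. c t *\<^sub>R f t) \<le> Lp_norm p a b f"
    using Lp_dominated[OF 1 f assms(2) _ 2] by simp_all
qed

text \<open>The functions in the \<open>L\<^sup>p\<close>-closure of \<open>{T \<circ> \<phi>}\<close>, where \<open>\<phi>\<close> is continuous with values in the domain of \<open>T\<close>.
  For the embedding of \<open>D\<close> these are the functions approximable by continuous \<open>D\<close>-valued ones, and
  for the identity those approximable by continuous ones.\<close>
definition Lp_approx :: "('d::banach \<Rightarrow>\<^sub>L 'x::banach) \<Rightarrow> real \<Rightarrow> real \<Rightarrow> real \<Rightarrow> (real \<Rightarrow> 'x) \<Rightarrow> bool" where
  "Lp_approx T p a b g \<longleftrightarrow> g \<in> Lp_space p a b \<and>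
     (\<forall>e>0. \<exists>\<phi>. continuous_on {a..b} \<phi> \<and> Lp_norm p a b (\<lambda>t. g t - T (\<phi> t)) < e)"

lemma Lp_approx_closed:
  assumes p: "p \<ge> 1" and ab: "a \<le> b" and g: "g \<in> Lp_space p a b"
    and ex: "\<And>e. e > 0 \<Longrightarrow> \<exists>h. Lp_approx T p a b h \<and> Lp_norm p a b (\<lambda>t. g t - h t) < e"
  shows "Lp_approx T p a b g"
  unfolding Lp_approx_def
proof (intro conjI allI impI g)
  fix e :: real assume "e > 0"
  then obtain h where h: "Lp_approx T p a b h" "Lp_norm p a b (\<lambda>t. g t - h t) < e / 2"
    using ex[of "e / 2"] by auto
  then obtain \<phi> where \<phi>: "continuous_on {a..b} \<phi>" "Lp_norm p a b (\<lambda>t. h t - T (\<phi> t)) < e / 2"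
    using \<open>e > 0\<close> unfolding Lp_approx_def by (meson half_gt_zero)
  have hL: "h \<in> Lp_space p a b" using h(1) by (simp add: Lp_approx_def)
  have "(\<lambda>t. T (\<phi> t)) \<in> Lp_space p a b"
    using \<phi>(1) p ab by (intro Lp_blinfun_const(1) continuous_imp_Lp) auto
  from Lp_add(2)[OF Lp_diff(1)[OF g hL p] Lp_diff(1)[OF hL this p] p]
  have "Lp_norm p a b (\<lambda>t. g t - T (\<phi> t)) < e" using h(2) \<phi>(2) by simp
  then show "\<exists>\<phi>. continuous_on {a..b} \<phi> \<and> Lp_norm p a b (\<lambda>t. g t - T (\<phi> t)) < e" using \<phi>(1) by blast
qed

lemma Lp_approx_add:
  assumes p: "p \<ge> 1" and ab: "a \<le> b" and f: "Lp_approx T p a b f" and g: "Lp_approx T p a b g"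
  shows "Lp_approx T p a b (\<lambda>t. f t + g t)"
  unfolding Lp_approx_def
proof (intro conjI allI impI)
  have fL: "f \<in> Lp_space p a b" and gL: "g \<in> Lp_space p a b" using f g by (simp_all add: Lp_approx_def)
  then show "(\<lambda>t. f t + g t) \<in> Lp_space p a b" using p by (intro Lp_add)
  fix e :: real assume "e > 0"
  then have "e / 2 > 0" by simp
  then obtain \<phi> \<psi> where \<phi>: "continuous_on {a..b} \<phi>" "Lp_norm p a b (\<lambda>t. f t - T (\<phi> t)) < e / 2"
    and \<psi>: "continuous_on {a..b} \<psi>" "Lp_norm p a b (\<lambda>t. g t - T (\<psi> t)) < e / 2"
    using f g unfolding Lp_approx_def by blast
  have "(\<lambda>t. T (\<phi> t)) \<in> Lp_space p a b" "(\<lambda>t. T (\<psi> t)) \<in> Lp_space p a b"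
    using \<phi>(1) \<psi>(1) p ab by (auto intro!: Lp_blinfun_const(1) continuous_imp_Lp)
  from Lp_add(2)[OF Lp_diff(1)[OF fL this(1) p] Lp_diff(1)[OF gL this(2) p] p]
  have "Lp_norm p a b (\<lambda>t. (f t + g t) - T (\<phi> t + \<psi> t)) < e" using \<phi>(2) \<psi>(2)
    by (simp add: blinfun.add_right algebra_simps)
  then show "\<exists>\<phi>. continuous_on {a..b} \<phi> \<and> Lp_norm p a b (\<lambda>t. f t + g t - T (\<phi> t)) < e"
    using \<phi>(1) \<psi>(1) by (intro exI[of _ "\<lambda>t. \<phi> t + \<psi> t"]) (auto intro: continuous_intros)
qed

text \<open>An indicator function is a limit almost everywhere of continuous functions, which may be clipped
  to \<open>[0,1]\<close>; dominated convergence then applies. The value \<open>y\<close> is first replaced by a nearby value of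
  \<open>T\<close>.\<close>
lemma Lp_approx_indicator:
  fixes T :: "'d::banach \<Rightarrow>\<^sub>L 'x::banach"
  assumes p: "p \<ge> 1" and ab: "a \<le> b" and E: "E \<in> sets lebesgue" and T: "closure (range (blinfun_apply T)) = UNIV"
  shows "Lp_approx T p a b (\<lambda>t. indicator E t *\<^sub>R y)"
proof -
  have "(indicator E :: real \<Rightarrow> real) measurable_on UNIV"
    by (rule lebesgue_measurable_imp_measurable_on_nnreal_UNIV) (use E in auto)
  then obtain N \<rho> where N: "negligible N" and \<rho>: "\<And>n. continuous_on UNIV (\<rho> n :: real \<Rightarrow> real)"
    and lim: "\<And>t. t \<notin> N \<Longrightarrow> (\<lambda>n. \<rho> n t) \<longlonglongrightarrow> indicator E t"
    unfolding measurable_on_def by auto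
  define \<phi> where "\<phi> n t = max 0 (min 1 (\<rho> n t))" for n t
  have \<phi>: "continuous_on UNIV (\<phi> n)" for n
    unfolding \<phi>_def by (intro continuous_intros \<rho>)
  have \<phi>01: "0 \<le> \<phi> n t" "\<phi> n t \<le> 1" for n t by (auto simp: \<phi>_def)
  have \<phi>lim: "(\<lambda>n. \<phi> n t) \<longlonglongrightarrow> indicator E t" if "t \<notin> N" for t
  proof -
    have "(\<lambda>n. \<phi> n t) \<longlonglongrightarrow> max 0 (min 1 (indicator E t))"
      unfolding \<phi>_def by (intro tendsto_intros lim that)
    then show ?thesis by (simp add: indicator_def split: if_splits)
  qed
  have smE: "strongly_measurable_on {a..b} (indicator E :: real \<Rightarrow> real)"
    by (rule strongly_measurable_on_real) (use E in \<open>auto intro: measurable_restrict_space1\<close>)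
  have gL: "(\<lambda>t. indicator E t *\<^sub>R z) \<in> Lp_space p a b" for z :: 'x
    by (rule Lp_cutoff(1)[OF continuous_imp_Lp _ smE]) (use p ab in \<open>auto simp: indicator_def\<close>)
  have step: "Lp_approx T p a b (\<lambda>t. indicator E t *\<^sub>R T d)" for d
    unfolding Lp_approx_def
  proof (intro conjI allI impI gL)
    fix e :: real assume "e > 0"
    have cL: "(\<lambda>t. \<phi> n t *\<^sub>R T d) \<in> Lp_space p a b" for n
      using p ab by (intro continuous_imp_Lp continuous_intros continuous_on_subset[OF \<phi>]) auto
    have hL: "(\<lambda>t. norm (T d)) \<in> Lp_space p a b" using p ab by (intro continuous_imp_Lp) auto
    have "(\<lambda>n. Lp_norm p a b (\<lambda>t. indicator E t *\<^sub>R T d - \<phi> n t *\<^sub>R T d)) \<longlonglongrightarrow> 0"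
    proof (rule Lp_dominated_convergence[OF cL gL hL p])
      show "AE t in lebesgue_on {a..b}. norm (indicator E t *\<^sub>R T d - \<phi> n t *\<^sub>R T d) \<le> norm (norm (T d))" for n
      proof (rule AE_I2)
        fix t
        have "\<bar>indicator E t - \<phi> n t\<bar> \<le> 1" using \<phi>01[of n t] by (auto simp: indicator_def)
        then have "\<bar>indicator E t - \<phi> n t\<bar> * norm (T d) \<le> 1 * norm (T d)" by (intro mult_right_mono) auto
        then show "norm (indicator E t *\<^sub>R T d - \<phi> n t *\<^sub>R T d) \<le> norm (norm (T d))"
          by (simp add: scaleR_diff_left[symmetric])
      qed
      show "AE t in lebesgue_on {a..b}. (\<lambda>n. \<phi> n t *\<^sub>R T d) \<longlonglongrightarrow> indicator E t *\<^sub>R T d"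
      proof (subst AE_lebesgue_on_iff_negligible, simp, rule negligible_subset[OF N], safe)
        fix t assume *: "\<not> (\<lambda>n. \<phi> n t *\<^sub>R T d) \<longlonglongrightarrow> indicator E t *\<^sub>R T d"
        show "t \<in> N"
        proof (rule ccontr)
          assume "t \<notin> N"
          then have "(\<lambda>n. \<phi> n t *\<^sub>R T d) \<longlonglongrightarrow> indicator E t *\<^sub>R T d"
            by (intro tendsto_intros \<phi>lim)
          then show False using * by simp
        qed
      qed
    qed
    then obtain n where "Lp_norm p a b (\<lambda>t. indicator E t *\<^sub>R T d - \<phi> n t *\<^sub>R T d) < e"
      using order_tendstoD(2)[OF _ \<open>e > 0\<close>] by (fastforce simp: eventually_sequentially)
    then show "\<exists>\<phi>. continuous_on {a..b} \<phi> \<and> Lp_norm p a b (\<lambda>t. indicator E t *\<^sub>R T d - T (\<phi> t)) < e"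
      by (intro exI[of _ "\<lambda>t. \<phi> n t *\<^sub>R d"])
        (auto simp: blinfun.scaleR_right intro!: continuous_intros continuous_on_subset[OF \<phi>])
  qed
  show ?thesis
  proof (rule Lp_approx_closed[OF p ab gL])
    fix e :: real assume "e > 0"
    define c where "c = (b - a) powr (1 / p) + 1"
    have c: "c > 0" by (simp add: c_def add_nonneg_pos)
    have "y \<in> closure (range (blinfun_apply T))" using T by simp
    then obtain d where d: "dist (T d) y < e / c"
      unfolding closure_approachable using c \<open>e > 0\<close> by (metis divide_pos_pos imageE)
    have "Lp_norm p a b (\<lambda>t. indicator E t *\<^sub>R y - indicator E t *\<^sub>R T d) \<le> norm (y - T d) * (b - a) powr (1 / p)"
      using p ab Lp_space_measurable[OF Lp_diff(1)[OF gL gL p], of y "T d"]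
      by (intro Lp_bounded(2)) (auto simp: indicator_def)
    also have "\<dots> \<le> norm (y - T d) * c" by (simp add: c_def mult_left_mono)
    also have "\<dots> < e" using d c by (simp add: dist_norm norm_minus_commute field_simps)
    finally show "\<exists>h. Lp_approx T p a b h \<and> Lp_norm p a b (\<lambda>t. indicator E t *\<^sub>R y - h t) < e"
      using step by blast
  qed
qed

lemma Lp_approx_simple:
  assumes p: "p \<ge> 1" and ab: "a \<le> b" and T: "closure (range (blinfun_apply T)) = UNIV"
    and \<sigma>: "simple_function (lebesgue_on {a..b}) \<sigma>"
  shows "Lp_approx T p a b (\<sigma> :: real \<Rightarrow> 'x::banach)"
proof -
  define Y where "Y = \<sigma> ` {a..b}"
  have "finite Y" using simple_functionD(1)[OF \<sigma>] by (simp add: Y_def)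
  define E where "E y = \<sigma> -` {y} \<inter> {a..b}" for y
  have E: "E y \<in> sets lebesgue" for y
    using simple_functionD(2)[OF \<sigma>, of "{y}"] by (simp add: sets_restrict_space_iff E_def)
  have "Lp_approx T p a b (\<lambda>t. \<Sum>y\<in>Y. indicator (E y) t *\<^sub>R y)"
    using \<open>finite Y\<close>
  proof (induction Y)
    case empty
    then show ?case using Lp_approx_indicator[OF p ab E T, of undefined 0] by simp
  next
    case (insert y F)
    show ?case unfolding sum.insert[OF insert.hyps]
      by (rule Lp_approx_add[OF p ab Lp_approx_indicator[OF p ab E T] insert.IH])
  qed
  moreover have "(\<Sum>y\<in>Y. indicator (E y) t *\<^sub>R y) = \<sigma> t" if "t \<in> {a..b}" for t
  proof -
    have "(\<Sum>y\<in>Y. indicator (E y) t *\<^sub>R y) = (\<Sum>y\<in>Y. if \<sigma> t = y then y else 0)"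
      using that by (intro sum.cong) (auto simp: E_def indicator_def)
    also have "\<dots> = \<sigma> t" using \<open>finite Y\<close> that by (simp add: Y_def)
    finally show ?thesis .
  qed
  then have eq: "AE t in lebesgue_on {a..b}. (\<Sum>y\<in>Y. indicator (E y) t *\<^sub>R y) = \<sigma> t"
    by (intro AE_I2) simp
  ultimately have L: "\<sigma> \<in> Lp_space p a b"
    using Lp_AE_cong(1)[OF _ _ eq] p by (simp add: Lp_approx_def)
  show ?thesis
  proof (rule Lp_approx_closed[OF p ab L])
    fix e :: real assume "e > 0"
    have "AE t in lebesgue_on {a..b}. 0 = \<sigma> t - (\<Sum>y\<in>Y. indicator (E y) t *\<^sub>R y)"
      using eq by eventually_elim simp
    then have "Lp_norm p a b (\<lambda>t. \<sigma> t - (\<Sum>y\<in>Y. indicator (E y) t *\<^sub>R y)) = Lp_norm p a b (\<lambda>_. 0 :: 'x)"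
      by (rule Lp_AE_cong(2)[rotated 2]) (use p in auto)
    then have "Lp_norm p a b (\<lambda>t. \<sigma> t - (\<Sum>y\<in>Y. indicator (E y) t *\<^sub>R y)) = 0" by simp
    then show "\<exists>h. Lp_approx T p a b h \<and> Lp_norm p a b (\<lambda>t. \<sigma> t - h t) < e"
      using \<open>Lp_approx T p a b (\<lambda>t. \<Sum>y\<in>Y. indicator (E y) t *\<^sub>R y)\<close> \<open>e > 0\<close>
      by (intro exI[of _ "\<lambda>t. \<Sum>y\<in>Y. indicator (E y) t *\<^sub>R y"]) simp
  qed
qed

text \<open>Discarding the values of the approximating simple functions that exceed twice the norm of \<open>g\<close>
  makes the convergence dominated.\<close>
lemma Lp_dense:
  fixes T :: "'d::banach \<Rightarrow>\<^sub>L 'x::banach"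
  assumes p: "p \<ge> 1" and ab: "a \<le> b" and T: "closure (range (blinfun_apply T)) = UNIV"
    and g: "g \<in> Lp_space p a b" and "e > 0"
  obtains \<phi> where "continuous_on {a..b} \<phi>" "Lp_norm p a b (\<lambda>t. g t - T (\<phi> t)) < e"
proof -
  let ?M = "lebesgue_on {a..b}"
  obtain \<sigma> where \<sigma>: "\<And>n. simple_function ?M (\<sigma> n)"
    and lim: "AE t in ?M. (\<lambda>n. \<sigma> n t) \<longlonglongrightarrow> g t"
    using Lp_space_measurable[OF g] unfolding strongly_measurable_on_def by blast
  have [measurable]: "(\<lambda>t. norm (g t)) \<in> borel_measurable ?M"
    by (rule strongly_measurable_on_norm_borel[OF Lp_space_measurable[OF g]])
  define \<rho> where "\<rho> n t = (if norm (\<sigma> n t) \<le> 2 * norm (g t) then \<sigma> n t else 0)" for n t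
  have simp\<rho>: "simple_function ?M (\<rho> n)" for n
  proof -
    have [measurable]: "\<sigma> n \<in> borel_measurable ?M" using \<sigma> by (rule borel_measurable_simple_function)
    have "simple_function ?M (\<lambda>t. if t \<in> {t \<in> space ?M. norm (\<sigma> n t) \<le> 2 * norm (g t)} then \<sigma> n t else 0)"
    proof (rule simple_function_If_set[OF \<sigma>])
      have "{t \<in> space ?M. norm (\<sigma> n t) \<le> 2 * norm (g t)} \<in> sets ?M" by measurable
      then show "{t \<in> space ?M. norm (\<sigma> n t) \<le> 2 * norm (g t)} \<inter> space ?M \<in> sets ?M" by blast
    qed simp
    then show ?thesis by (rule simple_function_cong[THEN iffD1, rotated]) (auto simp: \<rho>_def)
  qed
  have app: "Lp_approx T p a b (\<rho> n)" for n
    by (rule Lp_approx_simple[OF p ab T simp\<rho>])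
  then have \<rho>L: "\<rho> n \<in> Lp_space p a b" for n by (simp add: Lp_approx_def)
  have gn: "(\<lambda>t. norm (g t)) \<in> Lp_space p a b"
    using g by (auto simp: Lp_space_def intro: strongly_measurable_on_comp)
  have hL: "(\<lambda>t. 3 *\<^sub>R norm (g t)) \<in> Lp_space p a b"
    by (rule Lp_scaleR(1)[OF gn]) (use p in auto)
  have "(\<lambda>n. Lp_norm p a b (\<lambda>t. g t - \<rho> n t)) \<longlonglongrightarrow> 0"
  proof (rule Lp_dominated_convergence[OF \<rho>L g hL p])
    show "AE t in ?M. norm (g t - \<rho> n t) \<le> norm (3 *\<^sub>R norm (g t))" for n
    proof (rule AE_I2)
      fix t
      show "norm (g t - \<rho> n t) \<le> norm (3 *\<^sub>R norm (g t))"
        using norm_triangle_ineq4[of "g t" "\<rho> n t"] by (auto simp: \<rho>_def)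
    qed
    show "AE t in ?M. (\<lambda>n. \<rho> n t) \<longlonglongrightarrow> g t"
      using lim
    proof eventually_elim
      case (elim t)
      show ?case
      proof (cases "g t = 0")
        case True
        then have "\<rho> n t = 0" for n by (simp add: \<rho>_def)
        then show ?thesis using True by simp
      next
        case False
        have "(\<lambda>n. norm (\<sigma> n t)) \<longlonglongrightarrow> norm (g t)" using elim by (rule tendsto_norm)
        then have "\<forall>\<^sub>F n in sequentially. norm (\<sigma> n t) < 2 * norm (g t)"
          using False by (intro order_tendstoD(2)) auto
        then have "\<forall>\<^sub>F n in sequentially. \<sigma> n t = \<rho> n t" by eventually_elim (simp add: \<rho>_def)
        then show ?thesis using elim by (rule Lim_transform_eventually[rotated])
      qed
    qed
  qed
  then have "Lp_approx T p a b g"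
  proof (intro Lp_approx_closed[OF p ab g])
    fix e :: real assume "e > 0"
      and "(\<lambda>n. Lp_norm p a b (\<lambda>t. g t - \<rho> n t)) \<longlonglongrightarrow> 0"
    then have "\<forall>\<^sub>F n in sequentially. Lp_norm p a b (\<lambda>t. g t - \<rho> n t) < e" by (intro order_tendstoD(2))
    then show "\<exists>h. Lp_approx T p a b h \<and> Lp_norm p a b (\<lambda>t. g t - h t) < e"
      using app by (auto simp: eventually_sequentially)
  qed
  then show thesis using that \<open>e > 0\<close> by (auto simp: Lp_approx_def)
qed

text \<open>The Riemann sums of \<open>v\<close> and \<open>w n\<close> differ at most by the Riemann sum of the real function \<open>h n\<close>, which a
  fine enough gauge brings close to \<open>e n\<close>. This is how integrals of functions with values in a Banach
  space that need not be separable are obtained.\<close>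
lemma has_integral_L1_limit:
  fixes v :: "real \<Rightarrow> 'a::banach" and e :: "nat \<Rightarrow> real"
  assumes w: "\<And>n. (w n has_integral I n) {a..b}" and h: "\<And>n. (h n has_integral e n) {a..b}"
    and le: "\<And>n t. t \<in> {a..b} \<Longrightarrow> norm (v t - w n t) \<le> h n t"
    and e: "e \<longlonglongrightarrow> 0" and I: "I \<longlonglongrightarrow> L"
  shows "(v has_integral L) {a..b}"
  unfolding has_integral_real
proof (intro allI impI)
  fix \<epsilon> :: real assume "\<epsilon> > 0"
  then have \<epsilon>4: "\<epsilon> / 4 > 0" by simp
  have "\<forall>\<^sub>F n in sequentially. e n < \<epsilon> / 4 \<and> dist (I n) L < \<epsilon> / 4"
    using order_tendstoD(2)[OF e \<epsilon>4] tendstoD[OF I \<epsilon>4] by eventually_elim simp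
  then obtain n where n: "e n < \<epsilon> / 4" "dist (I n) L < \<epsilon> / 4" by (auto simp: eventually_sequentially)
  obtain \<gamma>1 where \<gamma>1: "gauge \<gamma>1" "\<And>\<D>. \<D> tagged_division_of {a..b} \<Longrightarrow> \<gamma>1 fine \<D> \<Longrightarrow>
      norm ((\<Sum>(x,k)\<in>\<D>. measure lborel k *\<^sub>R w n x) - I n) < \<epsilon> / 4"
    using w[of n] \<epsilon>4 unfolding has_integral_real by meson
  obtain \<gamma>2 where \<gamma>2: "gauge \<gamma>2" "\<And>\<D>. \<D> tagged_division_of {a..b} \<Longrightarrow> \<gamma>2 fine \<D> \<Longrightarrow>
      norm ((\<Sum>(x,k)\<in>\<D>. measure lborel k *\<^sub>R h n x) - e n) < \<epsilon> / 4"
    using h[of n] \<epsilon>4 unfolding has_integral_real by meson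
  show "\<exists>\<gamma>. gauge \<gamma> \<and> (\<forall>\<D>. \<D> tagged_division_of {a..b} \<and> \<gamma> fine \<D> \<longrightarrow>
      norm ((\<Sum>(x,k)\<in>\<D>. measure lborel k *\<^sub>R v x) - L) < \<epsilon>)"
  proof (intro exI[of _ "\<lambda>x. \<gamma>1 x \<inter> \<gamma>2 x"] conjI gauge_Int \<gamma>1(1) \<gamma>2(1) allI impI)
    fix \<D> assume D: "\<D> tagged_division_of {a..b} \<and> (\<lambda>x. \<gamma>1 x \<inter> \<gamma>2 x) fine \<D>"
    then have 1: "norm ((\<Sum>(x,k)\<in>\<D>. measure lborel k *\<^sub>R w n x) - I n) < \<epsilon> / 4"
      and 2: "norm ((\<Sum>(x,k)\<in>\<D>. measure lborel k *\<^sub>R h n x) - e n) < \<epsilon> / 4"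
      using \<gamma>1(2) \<gamma>2(2) by (auto simp: fine_Int)
    have "norm ((\<Sum>(x,k)\<in>\<D>. measure lborel k *\<^sub>R v x) - (\<Sum>(x,k)\<in>\<D>. measure lborel k *\<^sub>R w n x))
        = norm (\<Sum>(x,k)\<in>\<D>. measure lborel k *\<^sub>R (v x - w n x))"
      by (simp add: sum_subtractf[symmetric] split_def scaleR_diff_right)
    also have "\<dots> \<le> (\<Sum>(x,k)\<in>\<D>. measure lborel k *\<^sub>R h n x)"
    proof (rule sum_norm_le, safe)
      fix x k assume xk: "(x, k) \<in> \<D>"
      then have "x \<in> {a..b}" using D by (meson tagged_division_ofD(2,3) subsetD)
      then show "norm (measure lborel k *\<^sub>R (v x - w n x)) \<le> measure lborel k *\<^sub>R h n x"
        using le by (simp add: mult_left_mono)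
    qed
    also have "\<dots> < \<epsilon> / 4 + \<epsilon> / 4" using 2 n(1) unfolding real_norm_def by linarith
    finally have 3: "norm ((\<Sum>(x,k)\<in>\<D>. measure lborel k *\<^sub>R v x) - (\<Sum>(x,k)\<in>\<D>. measure lborel k *\<^sub>R w n x)) < \<epsilon> / 2" by simp
    have "norm ((\<Sum>(x,k)\<in>\<D>. measure lborel k *\<^sub>R v x) - L)
      \<le> norm ((\<Sum>(x,k)\<in>\<D>. measure lborel k *\<^sub>R v x) - (\<Sum>(x,k)\<in>\<D>. measure lborel k *\<^sub>R w n x))
        + norm ((\<Sum>(x,k)\<in>\<D>. measure lborel k *\<^sub>R w n x) - I n) + norm (I n - L)"
      by norm
    then show "norm ((\<Sum>(x,k)\<in>\<D>. measure lborel k *\<^sub>R v x) - L) < \<epsilon>"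
      using 1 3 n(2) by (simp add: dist_norm)
  qed
qed

lemma Lp_norm_has_integral:
  assumes f: "f \<in> Lp_space p a b" and p: "p > 1" and "a < b"
  shows "((\<lambda>t. norm (f t)) has_integral (LINT t|lebesgue_on {a..b}. norm (f t))) {a..b}"
  by (rule has_integral_integral_lebesgue_on[OF Lp_norm_1_le(1)[OF assms]]) simp

lemma Lp_limit_has_integral:
  fixes g :: "real \<Rightarrow> 'x::banach"
  assumes p: "p > 1" and "a < b" and f: "\<And>n. f n \<in> Lp_space p a b" and g: "g \<in> Lp_space p a b"
    and int: "\<And>n. (f n has_integral I n) {a..b}" and I: "I \<longlonglongrightarrow> L"
    and lim: "(\<lambda>n. Lp_norm p a b (\<lambda>t. g t - f n t)) \<longlonglongrightarrow> 0"
  shows "(g has_integral L) {a..b}"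
proof (rule has_integral_L1_limit[OF int _ _ _ I, where h = "\<lambda>n t. norm (g t - f n t)"])
  have d: "(\<lambda>t. g t - f n t) \<in> Lp_space p a b" for n using p by (intro Lp_diff g f) auto
  show "((\<lambda>t. norm (g t - f n t)) has_integral (LINT t|lebesgue_on {a..b}. norm (g t - f n t))) {a..b}" for n
    by (rule Lp_norm_has_integral[OF d p \<open>a < b\<close>])
  show "(\<lambda>n. LINT t|lebesgue_on {a..b}. norm (g t - f n t)) \<longlonglongrightarrow> 0"
  proof (rule tendsto_sandwich[OF _ _ tendsto_const])
    show "(\<lambda>n. (b - a) powr (1 - 1 / p) * Lp_norm p a b (\<lambda>t. g t - f n t)) \<longlonglongrightarrow> 0"
      using tendsto_mult_left[OF lim, of "(b - a) powr (1 - 1 / p)"] by simp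
    show "\<forall>\<^sub>F n in sequentially. (LINT t|lebesgue_on {a..b}. norm (g t - f n t))
        \<le> (b - a) powr (1 - 1 / p) * Lp_norm p a b (\<lambda>t. g t - f n t)"
      using Lp_norm_1_le(2)[OF d p \<open>a < b\<close>] by simp
  qed (auto intro!: always_eventually Bochner_Integration.integral_nonneg)
qed auto

lemma Lp_integral_norm_le_aux:
  fixes f :: "real \<Rightarrow> 'x::banach"
  assumes f: "f \<in> Lp_space p a b" and p: "p > 1" and "a < b" and int: "f integrable_on {a..b}"
  shows "norm (integral {a..b} f) \<le> (b - a) powr (1 - 1 / p) * Lp_norm p a b f"
proof -
  note hi = Lp_norm_has_integral[OF f p \<open>a < b\<close>]
  have "norm (integral {a..b} f) \<le> integral {a..b} (\<lambda>t. norm (f t))"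
    using hi by (intro Henstock_Kurzweil_Integration.integral_norm_bound_integral int) auto
  also have "\<dots> \<le> (b - a) powr (1 - 1 / p) * Lp_norm p a b f"
    using integral_unique[OF hi] Lp_norm_1_le(2)[OF f p \<open>a < b\<close>] by simp
  finally show ?thesis .
qed

lemma Lp_continuous_sequence:
  fixes g :: "real \<Rightarrow> 'x::banach"
  assumes g: "g \<in> Lp_space p a b" and p: "p > 1" and "a < b"
  obtains \<phi> where "\<And>n. continuous_on {a..b} (\<phi> n)" "\<And>n. \<phi> n \<in> Lp_space p a b"
    "\<And>n. Lp_norm p a b (\<lambda>t. g t - \<phi> n t) < inverse (Suc n)"
    "(\<lambda>n. Lp_norm p a b (\<lambda>t. g t - \<phi> n t)) \<longlonglongrightarrow> 0"
proof -
  have rng: "closure (range (blinfun_apply (id_blinfun :: 'x \<Rightarrow>\<^sub>L 'x))) = UNIV" by simp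
  have "\<exists>\<phi>. continuous_on {a..b} \<phi> \<and> Lp_norm p a b (\<lambda>t. g t - \<phi> t) < inverse (Suc n)" for n
  proof -
    have pos: "0 < inverse (real (Suc n))" by simp
    obtain \<phi> where "continuous_on {a..b} \<phi>" "Lp_norm p a b (\<lambda>t. g t - blinfun_apply id_blinfun (\<phi> t)) < inverse (real (Suc n))"
      using Lp_dense[OF _ _ rng g pos] p \<open>a < b\<close> by auto
    then show ?thesis by auto
  qed
  then obtain \<phi> where \<phi>: "\<And>n. continuous_on {a..b} (\<phi> n)"
    and lt: "\<And>n. Lp_norm p a b (\<lambda>t. g t - \<phi> n t) < inverse (Suc n)" by metis
  have "\<phi> n \<in> Lp_space p a b" for n using \<phi> p \<open>a < b\<close> by (intro continuous_imp_Lp) auto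
  moreover have "(\<lambda>n. Lp_norm p a b (\<lambda>t. g t - \<phi> n t)) \<longlonglongrightarrow> 0"
    by (rule tendsto_sandwich[OF _ _ tendsto_const LIMSEQ_inverse_real_of_nat])
      (auto intro!: always_eventually less_imp_le[OF lt] simp del: of_nat_Suc)
  ultimately show thesis using that[OF \<phi> _ lt] by blast
qed

text \<open>The integrals of continuous approximations form a Cauchy sequence.\<close>
lemma Lp_integrable_on:
  fixes g :: "real \<Rightarrow> 'x::banach"
  assumes g: "g \<in> Lp_space p a b" and p: "p > 1" and "a < b"
  shows "g integrable_on {a..b}"
proof -
  obtain \<phi> where \<phi>: "\<And>n. continuous_on {a..b} (\<phi> n)" and \<phi>L: "\<And>n. \<phi> n \<in> Lp_space p a b"
    and lt: "\<And>n. Lp_norm p a b (\<lambda>t. g t - \<phi> n t) < inverse (Suc n)"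
    and lim: "(\<lambda>n. Lp_norm p a b (\<lambda>t. g t - \<phi> n t)) \<longlonglongrightarrow> 0"
    using Lp_continuous_sequence[OF assms] by blast
  have int: "\<phi> n integrable_on {a..b}" for n using \<phi> by (rule integrable_continuous_real)
  define c where "c = (b - a) powr (1 - 1 / p)"
  have c: "c > 0" using \<open>a < b\<close> by (simp add: c_def)
  have diff: "norm (integral {a..b} (\<phi> n) - integral {a..b} (\<phi> m)) \<le> c * (inverse (Suc n) + inverse (Suc m))" for n m
  proof -
    have "norm (integral {a..b} (\<phi> n) - integral {a..b} (\<phi> m)) = norm (integral {a..b} (\<lambda>t. \<phi> n t - \<phi> m t))"
      by (simp add: Henstock_Kurzweil_Integration.integral_diff int)
    also have "\<dots> \<le> c * Lp_norm p a b (\<lambda>t. \<phi> n t - \<phi> m t)"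
      unfolding c_def using p \<open>a < b\<close>
      by (intro Lp_integral_norm_le_aux Lp_diff integrable_diff int \<phi>L) auto
    also have "Lp_norm p a b (\<lambda>t. \<phi> n t - \<phi> m t) = Lp_norm p a b (\<lambda>t. (g t - \<phi> m t) - (g t - \<phi> n t))"
      by simp
    also have "\<dots> \<le> Lp_norm p a b (\<lambda>t. g t - \<phi> m t) + Lp_norm p a b (\<lambda>t. g t - \<phi> n t)"
      using p by (intro Lp_diff(2) Lp_diff(1) g \<phi>L) auto
    also have "\<dots> \<le> inverse (Suc n) + inverse (Suc m)" using lt[of n] lt[of m] by simp
    finally show ?thesis using c by (simp add: mult_left_mono)
  qed
  have "Cauchy (\<lambda>n. integral {a..b} (\<phi> n))"
  proof (rule metric_CauchyI)
    fix e :: real assume "e > 0"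
    then obtain N where N: "inverse (Suc N) < e / (2 * c)" using c reals_Archimedean[of "e / (2 * c)"] by auto
    have "dist (integral {a..b} (\<phi> m)) (integral {a..b} (\<phi> n)) < e" if "m \<ge> N" "n \<ge> N" for m n
    proof -
      have "inverse (Suc m) \<le> inverse (Suc N)" "inverse (Suc n) \<le> inverse (Suc N)"
        using that by (auto intro!: le_imp_inverse_le)
      then have "c * (inverse (Suc m) + inverse (Suc n)) \<le> c * (2 * inverse (Suc N))"
        using c by (intro mult_left_mono) linarith+
      also have "\<dots> < c * (2 * (e / (2 * c)))" using N c by (intro mult_strict_left_mono) auto
      also have "\<dots> = e" using c by simp
      finally show ?thesis using diff[of m n] by (simp add: dist_norm)
    qed
    then show "\<exists>M. \<forall>m\<ge>M. \<forall>n\<ge>M. dist (integral {a..b} (\<phi> m)) (integral {a..b} (\<phi> n)) < e" by blast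
  qed
  then obtain L where "(\<lambda>n. integral {a..b} (\<phi> n)) \<longlonglongrightarrow> L" by (auto simp: Cauchy_convergent_iff convergent_def)
  then have "(g has_integral L) {a..b}"
    using Lp_limit_has_integral[OF p \<open>a < b\<close> \<phi>L g integrable_integral[OF int] _ lim] by blast
  then show ?thesis by blast
qed

lemma Lp_integrable_on_sub:
  fixes g :: "real \<Rightarrow> 'x::banach"
  assumes g: "g \<in> Lp_space p a b" and p: "p > 1" and "a \<le> c" "d \<le> b"
  shows "g integrable_on {c..d}"
proof (cases "c < d")
  case True
  then show ?thesis using Lp_integrable_on[OF Lp_mono_interval(1)[OF g, of c d] p] assms by simp
next
  case False
  then show ?thesis by (intro integrable_negligible) (cases "c = d"; simp)
qed

text \<open>The primitive of a function is uniformly bounded by the \<open>L\<^sup>p\<close>-norm, with a factor that is small on short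
  intervals.\<close>
lemma Lp_integral_norm_le:
  fixes f :: "real \<Rightarrow> 'x::banach"
  assumes f: "f \<in> Lp_space p a b" and p: "p > 1" and t: "t \<in> {a..b}" and "a < b"
  shows "norm (integral {a..t} f) \<le> (b - a) powr (1 - 1 / p) * Lp_norm p a b f"
proof (cases "a < t")
  case True
  then have ft: "f \<in> Lp_space p a t" and le: "Lp_norm p a t f \<le> Lp_norm p a b f"
    using Lp_mono_interval[OF f, of a t] t p by auto
  have "norm (integral {a..t} f) \<le> (t - a) powr (1 - 1 / p) * Lp_norm p a t f"
    by (rule Lp_integral_norm_le_aux[OF ft p True Lp_integrable_on[OF ft p True]])
  also have "\<dots> \<le> (b - a) powr (1 - 1 / p) * Lp_norm p a b f"
    using le t p True by (intro mult_mono powr_mono2) auto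
  finally show ?thesis .
next
  case False
  then show ?thesis using t by simp
qed

lemma integral_AE_cong:
  fixes f g :: "real \<Rightarrow> 'x::banach"
  assumes "AE t in lebesgue_on {a..b}. f t = g t"
  shows "integral {a..b} f = integral {a..b} g"
proof -
  have "negligible {t \<in> {a..b}. f t \<noteq> g t}"
    using assms by (subst (asm) AE_lebesgue_on_iff_negligible) auto
  then show ?thesis by (rule integral_spike) auto
qed

section \<open>Solutions as functions with values in the smaller space\<close>

definition bounded_op_fun :: "real \<Rightarrow> real \<Rightarrow> (real \<Rightarrow> 'd::real_normed_vector \<Rightarrow>\<^sub>L 'x::real_normed_vector) \<Rightarrow> bool" where
  "bounded_op_fun a b B \<longleftrightarrow> op_strongly_measurable_on {a..b} B \<and> bounded (B ` {a..b})"

lemma bounded_op_fun_mono: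
  assumes "bounded_op_fun a b B" "a \<le> c" "d \<le> b"
  shows "bounded_op_fun c d B"
proof -
  have "{c..d} \<subseteq> {a..b}" using assms by auto
  then show ?thesis using assms(1) unfolding bounded_op_fun_def op_strongly_measurable_on_def
    by (auto intro: strongly_measurable_on_subset bounded_subset image_mono)
qed

lemma bounded_op_fun_const: "bounded_op_fun a b (\<lambda>_. T)"
  by (auto simp: bounded_op_fun_def op_strongly_measurable_on_const intro: bounded_subset[of "{T}"])

lemma bounded_op_fun_bound:
  assumes "bounded_op_fun a b B"
  obtains K where "K \<ge> 0" "\<And>t. t \<in> {a..b} \<Longrightarrow> norm (B t) \<le> K"
proof -
  have "\<exists>K. \<forall>t\<in>{a..b}. norm (B t) \<le> K"
    using assms by (simp add: bounded_op_fun_def bounded_iff)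
  then obtain K where K: "\<And>t. t \<in> {a..b} \<Longrightarrow> norm (B t) \<le> K" by blast
  show thesis
    by (rule that[of "max 0 K"]) (use K in \<open>auto simp: le_max_iff_disj\<close>)
qed

lemma bounded_op_fun_add:
  assumes "bounded_op_fun a b B" "bounded_op_fun a b C"
  shows "bounded_op_fun a b (\<lambda>t. B t + C t)"
proof -
  obtain K where K: "\<And>t. t \<in> {a..b} \<Longrightarrow> norm (B t) \<le> K" using bounded_op_fun_bound[OF assms(1)] by blast
  obtain L where L: "\<And>t. t \<in> {a..b} \<Longrightarrow> norm (C t) \<le> L" using bounded_op_fun_bound[OF assms(2)] by blast
  have "norm (B t + C t) \<le> K + L" if "t \<in> {a..b}" for t
    using norm_triangle_mono K L that by blast
  then have "\<exists>M. \<forall>t\<in>{a..b}. norm (B t + C t) \<le> M" by blast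
  then show ?thesis using assms
    by (simp add: bounded_op_fun_def bounded_iff op_strongly_measurable_on_def blinfun.add_left
        strongly_measurable_on_add)
qed

lemma bounded_op_fun_Lp:
  assumes B: "bounded_op_fun a b B"
  obtains K where "K \<ge> 0" "\<And>q c d f. q > 0 \<Longrightarrow> a \<le> c \<Longrightarrow> d \<le> b \<Longrightarrow> f \<in> Lp_space q c d \<Longrightarrow>
    (\<lambda>t. B t (f t)) \<in> Lp_space q c d \<and> Lp_norm q c d (\<lambda>t. B t (f t)) \<le> K * Lp_norm q c d f"
proof -
  obtain K where K: "K \<ge> 0" "\<And>t. t \<in> {a..b} \<Longrightarrow> norm (B t) \<le> K"
    using bounded_op_fun_bound[OF B] by blast
  show thesis
  proof (rule that[OF K(1)])
    fix q c d and f :: "real \<Rightarrow> 'a" assume *: "q > 0" "a \<le> c" "d \<le> b" "f \<in> Lp_space q c d"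
    have "op_strongly_measurable_on {c..d} B"
      using bounded_op_fun_mono[OF B *(2,3)] by (simp add: bounded_op_fun_def)
    then show "(\<lambda>t. B t (f t)) \<in> Lp_space q c d \<and> Lp_norm q c d (\<lambda>t. B t (f t)) \<le> K * Lp_norm q c d f"
      using Lp_blinfun[OF _ *(4,1) K(1), of B] K(2) *(2,3) by auto
  qed
qed

lemma bounded_op_fun_in_Lp:
  assumes "bounded_op_fun a b B" "q > 0" "f \<in> Lp_space q a b"
  shows "(\<lambda>t. B t (f t)) \<in> Lp_space q a b"
proof -
  obtain K where "\<And>q c d f. q > 0 \<Longrightarrow> a \<le> c \<Longrightarrow> d \<le> b \<Longrightarrow> f \<in> Lp_space q c d \<Longrightarrow>
    (\<lambda>t. B t (f t)) \<in> Lp_space q c d \<and> Lp_norm q c d (\<lambda>t. B t (f t)) \<le> K * Lp_norm q c d f"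
    using bounded_op_fun_Lp[OF assms(1)] by metis
  from this[OF assms(2) order_refl order_refl assms(3)] show ?thesis by simp
qed

text \<open>The derivative that the equation \<open>u' + B u = f\<close> prescribes for \<open>u\<close>, when \<open>D\<close> is \<open>u\<close> regarded as a function
  with values in the smaller space.\<close>
definition resid :: "(real \<Rightarrow> 'd::real_normed_vector \<Rightarrow>\<^sub>L 'x::real_normed_vector) \<Rightarrow> (real \<Rightarrow> 'x) \<Rightarrow> (real \<Rightarrow> 'd) \<Rightarrow> real \<Rightarrow> 'x" where
  "resid B f D = (\<lambda>s. f s - B s (D s))"

text \<open>The initial value problem \<open>u' + B u = f\<close>, \<open>u a = x\<close> in integrated form, with the \<open>D\<close>-valued version of
  \<open>u\<close> as the only unknown. In this form a solution is a member of a single \<open>L\<^sup>q\<close>-space, null sets do not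
  matter, and sums, restrictions and concatenations of solutions are immediate; the continuous
  representative \<open>u\<close> is recovered as the right-hand side.\<close>
definition integral_solution :: "('d::banach \<Rightarrow>\<^sub>L 'x::banach) \<Rightarrow> real \<Rightarrow> real \<Rightarrow>
     (real \<Rightarrow> 'd \<Rightarrow>\<^sub>L 'x) \<Rightarrow> (real \<Rightarrow> 'x) \<Rightarrow> 'x \<Rightarrow> (real \<Rightarrow> 'd) \<Rightarrow> bool" where
  "integral_solution j a b B f x D \<longleftrightarrow>
     (AE t in lebesgue_on {a..b}. j (D t) = x + integral {a..t} (resid B f D))"

lemma resid_Lp:
  assumes "bounded_op_fun a b B" "q > 1" "f \<in> Lp_space q a b" "D \<in> Lp_space q a b"
  shows "resid B f D \<in> Lp_space q a b"
  unfolding resid_def using assms by (intro Lp_diff(1) bounded_op_fun_in_Lp) auto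

lemma resid_integrable:
  fixes B :: "real \<Rightarrow> 'd::banach \<Rightarrow>\<^sub>L 'x::banach"
  assumes "bounded_op_fun a b B" "q > 1" "f \<in> Lp_space q a b" "D \<in> Lp_space q a b" "a \<le> c" "d \<le> b"
  shows "resid B f D integrable_on {c..d}"
  by (rule Lp_integrable_on_sub[OF resid_Lp[OF assms(1-4)] assms(2,5,6)])

lemma integral_solution_add:
  assumes B: "bounded_op_fun a b B" and q: "q > 1"
    and L: "f \<in> Lp_space q a b" "D \<in> Lp_space q a b" "g \<in> Lp_space q a b" "E \<in> Lp_space q a b"
    and s: "integral_solution j a b B f x D" "integral_solution j a b B g y E"
  shows "integral_solution j a b B (\<lambda>t. f t + g t) (x + y) (\<lambda>t. D t + E t)"
  unfolding integral_solution_def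
  using s[unfolded integral_solution_def] AE_lebesgue_on_mem
proof eventually_elim
  case (elim t)
  have "resid B (\<lambda>t. f t + g t) (\<lambda>t. D t + E t) = (\<lambda>s. resid B f D s + resid B g E s)"
    by (simp add: resid_def blinfun.add_right algebra_simps)
  moreover have "integral {a..t} (\<lambda>s. resid B f D s + resid B g E s)
     = integral {a..t} (resid B f D) + integral {a..t} (resid B g E)"
    using elim(3) by (intro Henstock_Kurzweil_Integration.integral_add resid_integrable[OF B q] L) auto
  ultimately show ?case using elim by (simp add: blinfun.add_right)
qed

lemma integral_solution_scaleR:
  assumes s: "integral_solution j a b B f x D"
  shows "integral_solution j a b B (\<lambda>t. c *\<^sub>R f t) (c *\<^sub>R x) (\<lambda>t. c *\<^sub>R D t)"
  unfolding integral_solution_def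
  using s[unfolded integral_solution_def]
proof eventually_elim
  case (elim t)
  have "resid B (\<lambda>t. c *\<^sub>R f t) (\<lambda>t. c *\<^sub>R D t) = (\<lambda>s. c *\<^sub>R resid B f D s)"
    by (simp add: resid_def blinfun.scaleR_right scaleR_diff_right)
  then show ?case using elim by (simp add: blinfun.scaleR_right scaleR_add_right)
qed

lemma integral_solution_diff:
  assumes B: "bounded_op_fun a b B" and q: "q > 1"
    and L: "f \<in> Lp_space q a b" "D \<in> Lp_space q a b" "g \<in> Lp_space q a b" "E \<in> Lp_space q a b"
    and s: "integral_solution j a b B f x D" "integral_solution j a b B g y E"
  shows "integral_solution j a b B (\<lambda>t. f t - g t) (x - y) (\<lambda>t. D t - E t)"
  using integral_solution_add[OF B q L(1,2) Lp_minus(1)[OF L(3)] Lp_minus(1)[OF L(4)] s(1)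
      integral_solution_scaleR[OF s(2), of "-1", simplified]] q by simp

lemma integral_solution_zero: "integral_solution j a b B (\<lambda>_. 0) 0 (\<lambda>_. 0)"
  by (simp add: integral_solution_def resid_def blinfun.zero_right)

lemma integral_solution_sum:
  assumes B: "bounded_op_fun a b B" and q: "q > 1" and "finite I"
    and "\<And>i. i \<in> I \<Longrightarrow> f i \<in> Lp_space q a b" "\<And>i. i \<in> I \<Longrightarrow> D i \<in> Lp_space q a b"
      "\<And>i. i \<in> I \<Longrightarrow> integral_solution j a b B (f i) 0 (D i)"
  shows "integral_solution j a b B (\<lambda>t. \<Sum>i\<in>I. f i t) 0 (\<lambda>t. \<Sum>i\<in>I. D i t)"
  using assms(3-)
proof (induction I)
  case empty
  then show ?case by (simp add: integral_solution_zero)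
next
  case (insert i I)
  have "(\<lambda>t. \<Sum>i\<in>I. f i t) \<in> Lp_space q a b" "(\<lambda>t. \<Sum>i\<in>I. D i t) \<in> Lp_space q a b"
    using Lp_sum[of q I f a b] Lp_sum[of q I D a b] insert q by auto
  from integral_solution_add[OF B q _ _ this, of "f i" "D i" j 0 0] insert
  show ?case by simp
qed

lemma integral_AE_cong_sub:
  fixes f g :: "real \<Rightarrow> 'x::banach"
  assumes "AE t in lebesgue_on {a..b}. f t = g t" "a \<le> c" "d \<le> b"
  shows "integral {c..d} f = integral {c..d} g"
  by (rule integral_AE_cong, rule AE_lebesgue_on_subset[OF assms(1)]) (use assms(2,3) in auto)

lemma integral_solution_AE_cong:
  assumes s: "integral_solution j a b B f x D"
    and "AE t in lebesgue_on {a..b}. D t = D' t"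
    and "AE t in lebesgue_on {a..b}. resid B f D t = resid C g D' t"
  shows "integral_solution j a b C g x D'"
  unfolding integral_solution_def
  using s[unfolded integral_solution_def] assms(2) AE_lebesgue_on_mem
proof eventually_elim
  case (elim t)
  then show ?case using integral_AE_cong_sub[OF assms(3), of a t] by simp
qed

lemma integral_solution_restrict:
  assumes s: "integral_solution j a b B f x D" and "d \<le> b"
  shows "integral_solution j a d B f x D"
  using s unfolding integral_solution_def by (rule AE_lebesgue_on_subset) (use assms(2) in auto)

lemma integral_solution_tail:
  assumes B: "bounded_op_fun a b B" and q: "q > 1" and L: "f \<in> Lp_space q a b" "D \<in> Lp_space q a b"
    and s: "integral_solution j a b B f x D" and "a \<le> c" "c \<le> b"
  shows "integral_solution j c b B f (x + integral {a..c} (resid B f D)) D"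
proof -
  have "AE t in lebesgue_on {c..b}. j (D t) = x + integral {a..t} (resid B f D)"
    using s unfolding integral_solution_def by (rule AE_lebesgue_on_subset) (use assms(6) in auto)
  then show ?thesis unfolding integral_solution_def using AE_lebesgue_on_mem
  proof eventually_elim
    case (elim t)
    have "integral {a..c} (resid B f D) + integral {c..t} (resid B f D) = integral {a..t} (resid B f D)"
      using elim(2) assms(6) by (intro Henstock_Kurzweil_Integration.integral_combine resid_integrable[OF B q L]) auto
    then show ?case using elim(1) by (simp add: add.assoc)
  qed
qed

lemma integral_solution_concat:
  assumes B: "bounded_op_fun a b B" and q: "q > 1" and "a \<le> m" "m \<le> b"
    and L: "f \<in> Lp_space q a b" "D \<in> Lp_space q a m" "E \<in> Lp_space q m b"
    and s: "integral_solution j a m B f x D"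
    and s': "integral_solution j m b B f (x + integral {a..m} (resid B f D)) E"
  shows "(\<lambda>t. if t \<le> m then D t else E t) \<in> Lp_space q a b"
    "integral_solution j a b B f x (\<lambda>t. if t \<le> m then D t else E t)"
proof -
  define F where "F t = (if t \<le> m then D t else E t)" for t
  show FL: "(\<lambda>t. if t \<le> m then D t else E t) \<in> Lp_space q a b"
    using q by (intro Lp_concat L assms(3,4)) auto
  have 1: "integral {a..t} (resid B f F) = integral {a..t} (resid B f D)" if "t \<le> m" for t
    by (intro integral_cong) (use that in \<open>auto simp: resid_def F_def\<close>)
  have 2: "integral {m..t} (resid B f F) = integral {m..t} (resid B f E)" for t
    by (rule integral_spike[OF negligible_sing[of m]]) (auto simp: resid_def F_def)
  have A: "AE t in lebesgue_on {a..m}. j (F t) = x + integral {a..t} (resid B f F)"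
    using s[unfolded integral_solution_def] AE_lebesgue_on_mem
    by eventually_elim (simp add: 1 F_def)
  have C: "AE t in lebesgue_on {m..b}. j (E t) = x + integral {a..t} (resid B f F)"
    using s'[unfolded integral_solution_def] AE_lebesgue_on_mem
  proof eventually_elim
    case (elim t)
    have "F \<in> Lp_space q a b" using FL by (simp add: F_def[abs_def])
    then have "integral {a..m} (resid B f F) + integral {m..t} (resid B f F) = integral {a..t} (resid B f F)"
      using elim(2) assms(3) by (intro Henstock_Kurzweil_Integration.integral_combine resid_integrable[OF B q L(1)]) auto
    then show ?case using elim by (simp add: 1 2 add.assoc)
  qed
  have "AE t in lebesgue_on {m..b}. t \<noteq> m"
    by (rule AE_lebesgue_on_neq)
  with C have "AE t in lebesgue_on {m..b}. j (F t) = x + integral {a..t} (resid B f F)"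
    using AE_lebesgue_on_mem by eventually_elim (auto simp: F_def)
  moreover have "{a..b} \<subseteq> {a..m} \<union> {m..b}" by force
  ultimately have "AE t in lebesgue_on {a..b}. j (F t) = x + integral {a..t} (resid B f F)"
    using AE_lebesgue_on_Un[OF A] by simp
  then show "integral_solution j a b B f x (\<lambda>t. if t \<le> m then D t else E t)"
    by (simp add: integral_solution_def F_def[abs_def])
qed

text \<open>Nothing happens before the right-hand side sets in.\<close>
lemma integral_solution_zero_extend:
  assumes B: "bounded_op_fun a b B" and q: "q > 1" and "a \<le> m" "m \<le> b"
    and L: "f \<in> Lp_space q m b" "E \<in> Lp_space q m b" and s: "integral_solution j m b B f 0 E"
  shows "integral_solution j a b B (\<lambda>t. if t \<in> {m..b} then f t else 0) 0 (\<lambda>t. if t \<in> {m..b} then E t else 0)"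
proof -
  let ?f = "\<lambda>t. if t \<in> {m..b} then f t else 0"
  have L': "?f \<in> Lp_space q a b" by (rule Lp_zero_extend(1)[OF L(1)]) (use assms(3) in auto)
  have ne: "AE t in lebesgue_on {a..b}. t \<noteq> m"
    by (rule AE_lebesgue_on_neq)
  have z: "AE t in lebesgue_on {a..m}. resid B (\<lambda>_. 0) (\<lambda>_. 0) t = resid B ?f (\<lambda>_. 0) t"
    by (subst AE_lebesgue_on_iff_negligible, simp, rule negligible_subset[OF negligible_sing[of m]])
      (auto simp: resid_def blinfun.zero_right split: if_splits)
  have s1: "integral_solution j a m B ?f 0 (\<lambda>_. 0)"
    by (rule integral_solution_AE_cong[OF integral_solution_zero _ z]) simp
  have "integral {a..m} (resid B ?f (\<lambda>_. 0)) = integral {a..m} (resid B (\<lambda>_. 0) (\<lambda>_. 0))"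
    using integral_AE_cong[OF z] by simp
  also have "\<dots> = 0" by (simp add: resid_def blinfun.zero_right)
  finally have i: "integral {a..m} (resid B ?f (\<lambda>_. 0)) = 0" .
  have "integral_solution j m b B ?f 0 E"
    by (rule integral_solution_AE_cong[OF s]) (auto intro!: AE_I2 simp: resid_def)
  then have s2: "integral_solution j m b B ?f (0 + integral {a..m} (resid B ?f (\<lambda>_. 0))) E" using i by simp
  from integral_solution_concat(2)[OF B q assms(3,4) L' Lp_zero(1) L(2) s1 s2]
  show ?thesis
    by (rule integral_solution_AE_cong)
      (use ne AE_lebesgue_on_mem[of "{a..b}"] in \<open>eventually_elim; auto simp: resid_def\<close>)+
qed

lemma to_D_j: "inj (blinfun_apply j) \<Longrightarrow> to_D j (j d) = d"
  by (simp add: to_D_def)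

lemma j_to_D: "in_D j y \<Longrightarrow> j (to_D j y) = y"
  by (simp add: to_D_def in_D_def f_inv_into_f)

lemma MR_solution_imp_integral_solution:
  assumes u: "MR_solution j q a b B f x u" and ab: "a < b"
  shows "(\<lambda>t. to_D j (u t)) \<in> Lp_space q a b"
    and "\<And>t. t \<in> {a..b} \<Longrightarrow> u t = x + integral {a..t} (resid B f (\<lambda>t. to_D j (u t)))"
    and "integral_solution j a b B f x (\<lambda>t. to_D j (u t))"
proof -
  obtain v where v: "has_weak_derivative_on a b u v"
    and eq: "AE t in lebesgue_on {a..b}. v t + B t (to_D j (u t)) = f t"
    and D: "AE t in lebesgue_on {a..b}. in_D j (u t)" "(\<lambda>t. to_D j (u t)) \<in> Lp_space q a b"
    and x: "u a = x"
    using u by (auto simp: MR_solution_def MR_space_def)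
  show "(\<lambda>t. to_D j (u t)) \<in> Lp_space q a b" by fact
  have eq': "AE t in lebesgue_on {a..b}. v t = resid B f (\<lambda>t. to_D j (u t)) t"
    using eq by eventually_elim (auto simp: resid_def algebra_simps)
  show *: "u t = x + integral {a..t} (resid B f (\<lambda>t. to_D j (u t)))" if "t \<in> {a..b}" for t
  proof -
    have "integral {a..t} v = u t - x" using v that x by (auto simp: has_weak_derivative_on_def)
    moreover have "integral {a..t} v = integral {a..t} (resid B f (\<lambda>t. to_D j (u t)))"
      by (rule integral_AE_cong_sub[OF eq']) (use that in auto)
    ultimately show ?thesis by simp
  qed
  show "integral_solution j a b B f x (\<lambda>t. to_D j (u t))"
    unfolding integral_solution_def using D(1) AE_lebesgue_on_mem
    by eventually_elim (use * in \<open>auto simp: j_to_D\<close>)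
qed

lemma integral_solution_imp_MR_solution:
  assumes j: "inj (blinfun_apply j)" and B: "bounded_op_fun a b B" and q: "q > 1" and ab: "a < b"
    and L: "f \<in> Lp_space q a b" "D \<in> Lp_space q a b"
    and s: "integral_solution j a b B f x D"
  shows "MR_solution j q a b B f x (\<lambda>t. x + integral {a..t} (resid B f D))"
    and "AE t in lebesgue_on {a..b}. to_D j (x + integral {a..t} (resid B f D)) = D t"
proof -
  define u where "u t = x + integral {a..t} (resid B f D)" for t
  have ua: "u a = x" by (simp add: u_def)
  have eq: "AE t in lebesgue_on {a..b}. j (D t) = u t"
    using s by (simp add: integral_solution_def u_def)
  then have eq2: "AE t in lebesgue_on {a..b}. D t = to_D j (u t)"
    by eventually_elim (metis to_D_j[OF j])
  then show "AE t in lebesgue_on {a..b}. to_D j (x + integral {a..t} (resid B f D)) = D t"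
    unfolding u_def by eventually_elim simp
  have uL: "u \<in> Lp_space q a b"
    using Lp_AE_cong(1)[OF Lp_blinfun_const(1)[OF L(2)] _ eq] q by simp
  have rL: "resid B f D \<in> Lp_space q a b" by (rule resid_Lp[OF B q L])
  have wd: "has_weak_derivative_on a b u (resid B f D)"
    unfolding has_weak_derivative_on_def ua
  proof
    fix t assume "t \<in> {a..b}"
    then have "resid B f D integrable_on {a..t}" by (intro resid_integrable[OF B q L]) auto
    then show "(resid B f D has_integral u t - x) {a..t}" by (simp add: u_def integrable_integral)
  qed
  have inD: "AE t in lebesgue_on {a..b}. in_D j (u t)"
    using eq by eventually_elim (metis in_D_def rangeI)
  have DL: "(\<lambda>t. to_D j (u t)) \<in> Lp_space q a b"
    using Lp_AE_cong(1)[OF L(2) _ eq2] q by simp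
  have "AE t in lebesgue_on {a..b}. resid B f D t + B t (to_D j (u t)) = f t"
    using eq2 by eventually_elim (simp add: resid_def)
  then show "MR_solution j q a b B f x (\<lambda>t. x + integral {a..t} (resid B f D))"
    using uL rL wd inD DL ua unfolding MR_solution_def MR_space_def W1p_space_def u_def by blast
qed

text \<open>Maximal regularity on a single interval. By linearity it suffices to demand uniqueness for the
  right-hand side zero.\<close>
definition well_posed :: "('d::banach \<Rightarrow>\<^sub>L 'x::banach) \<Rightarrow> real \<Rightarrow> real \<Rightarrow> real \<Rightarrow> (real \<Rightarrow> 'd \<Rightarrow>\<^sub>L 'x) \<Rightarrow> bool" where
  "well_posed j q a b B \<longleftrightarrow>
     (\<forall>f\<in>Lp_space q a b. \<exists>D\<in>Lp_space q a b. integral_solution j a b B f 0 D) \<and>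
     (\<forall>D\<in>Lp_space q a b. integral_solution j a b B (\<lambda>_. 0) 0 D \<longrightarrow> (AE t in lebesgue_on {a..b}. D t = 0))"

lemma well_posed_unique:
  assumes w: "well_posed j q a b B" and B: "bounded_op_fun a b B" and q: "q > 1"
    and L: "f \<in> Lp_space q a b" "D \<in> Lp_space q a b" "E \<in> Lp_space q a b"
    and s: "integral_solution j a b B f x D" "integral_solution j a b B f x E"
  shows "AE t in lebesgue_on {a..b}. D t = E t"
proof -
  have "integral_solution j a b B (\<lambda>_. 0) 0 (\<lambda>t. D t - E t)"
    using integral_solution_diff[OF B q L(1,2) L(1,3) s] by simp
  moreover have "(\<lambda>t. D t - E t) \<in> Lp_space q a b" using q by (intro Lp_diff L) auto
  ultimately have "AE t in lebesgue_on {a..b}. D t - E t = 0" using w by (auto simp: well_posed_def)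
  then show ?thesis by eventually_elim simp
qed

text \<open>The derivative of a solution is determined by its \<open>D\<close>-valued version, and this version determines
  the solution up to a null set, hence, by continuity of the primitive, everywhere.\<close>
lemma unique_solvable_iff_well_posed:
  fixes j :: "'d::banach \<Rightarrow>\<^sub>L 'x::banach"
  assumes j: "inj (blinfun_apply j)" and B: "bounded_op_fun a b B" and q: "q > 1" and ab: "a < b"
  shows "(\<forall>f \<in> Lp_space q a b. \<exists>u. unique_MR_solution j q a b B f 0 u) \<longleftrightarrow> well_posed j q a b B"
proof
  assume *: "\<forall>f \<in> Lp_space q a b. \<exists>u. unique_MR_solution j q a b B f 0 u"
  show "well_posed j q a b B"
    unfolding well_posed_def
  proof (intro conjI ballI impI)
    fix f :: "real \<Rightarrow> 'x" assume "f \<in> Lp_space q a b"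
    then obtain u where "MR_solution j q a b B f 0 u" using * by (auto simp: unique_MR_solution_def)
    then show "\<exists>D\<in>Lp_space q a b. integral_solution j a b B f 0 D"
      using MR_solution_imp_integral_solution[OF _ ab] by blast
  next
    fix D :: "real \<Rightarrow> 'd" assume D: "D \<in> Lp_space q a b" "integral_solution j a b B (\<lambda>_. 0) 0 D"
    let ?u = "\<lambda>D t. 0 + integral {a..t} (resid B (\<lambda>_. 0) D)"
    have "MR_solution j q a b B (\<lambda>_. 0) 0 (?u D)" "MR_solution j q a b B (\<lambda>_. 0) 0 (?u (\<lambda>_. 0))"
      using integral_solution_imp_MR_solution(1)[OF j B q ab Lp_zero(1)] D Lp_zero(1) integral_solution_zero
      by blast+
    moreover obtain u where "unique_MR_solution j q a b B (\<lambda>_. 0) 0 u" using * Lp_zero(1) by blast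
    ultimately have "?u D t = ?u (\<lambda>_. 0) t" if "t \<in> {a..b}" for t
      using that unfolding unique_MR_solution_def by metis
    then have z: "integral {a..t} (resid B (\<lambda>_. 0) D) = 0" if "t \<in> {a..b}" for t
      using that by (simp add: resid_def blinfun.zero_right)
    show "AE t in lebesgue_on {a..b}. D t = 0"
      using D(2)[unfolded integral_solution_def] AE_lebesgue_on_mem
    proof eventually_elim
      case (elim t)
      then have "j (D t) = j 0" using z by (simp add: blinfun.zero_right)
      then show ?case using j by (simp only: inj_eq)
    qed
  qed
next
  assume w: "well_posed j q a b B"
  show "\<forall>f \<in> Lp_space q a b. \<exists>u. unique_MR_solution j q a b B f 0 u"
  proof
    fix f :: "real \<Rightarrow> 'x" assume f: "f \<in> Lp_space q a b"
    then obtain D where D: "D \<in> Lp_space q a b" "integral_solution j a b B f 0 D"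
      using w by (auto simp: well_posed_def)
    have "w t = 0 + integral {a..t} (resid B f D)" if w': "MR_solution j q a b B f 0 w" and t: "t \<in> {a..b}" for w t
    proof -
      note E = MR_solution_imp_integral_solution[OF w' ab]
      have "AE t in lebesgue_on {a..b}. to_D j (w t) = D t"
        by (rule well_posed_unique[OF w B q f E(1) D(1) E(3) D(2)])
      then have "AE t in lebesgue_on {a..b}. resid B f (\<lambda>t. to_D j (w t)) t = resid B f D t"
        by eventually_elim (simp add: resid_def)
      then have "integral {a..t} (resid B f (\<lambda>t. to_D j (w t))) = integral {a..t} (resid B f D)"
        by (rule integral_AE_cong_sub) (use t in auto)
      then show ?thesis using E(2)[OF t] by simp
    qed
    then show "\<exists>u. unique_MR_solution j q a b B f 0 u"
      using integral_solution_imp_MR_solution(1)[OF j B q ab f D]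
      by (intro exI[of _ "\<lambda>t. 0 + integral {a..t} (resid B f D)"]) (auto simp: unique_MR_solution_def)
  qed
qed

lemma MR_family_iff_well_posed:
  fixes j :: "'d::banach \<Rightarrow>\<^sub>L 'x::banach"
  assumes j: "inj (blinfun_apply j)" and B: "bounded_op_fun 0 \<tau> B" and q: "q > 1"
  shows "MR_family j q \<tau> B \<longleftrightarrow> (\<forall>a b. 0 \<le> a \<and> a < b \<and> b \<le> \<tau> \<longrightarrow> well_posed j q a b B)"
  unfolding MR_family_def
  using unique_solvable_iff_well_posed[OF j bounded_op_fun_mono[OF B] q] by blast

section \<open>A priori estimates\<close>

lemma geometric_halves:
  fixes a :: real
  shows "summable (\<lambda>n. a / 2 ^ n)" "(\<Sum>n. a / 2 ^ n) = 2 * a"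
proof -
  have "(\<lambda>n. a * (1 / 2) ^ n) sums (a * (1 / (1 - 1 / 2)))"
    by (intro sums_mult geometric_sums) simp
  then have "(\<lambda>n. a / 2 ^ n) sums (2 * a)" by (simp add: power_divide mult.commute)
  then show "summable (\<lambda>n. a / 2 ^ n)" "(\<Sum>n. a / 2 ^ n) = 2 * a" by (auto simp: sums_iff)
qed

text \<open>Baire's theorem for a countable cover of \<open>L\<^sup>q\<close>: some \<open>E n\<close> is dense in a ball. Otherwise there are
  balls whose radii \<open>R n\<close> are at least halved in each step, each missing another \<open>E n\<close>, and whose centres \<open>h n\<close> converge to a
  function \<open>H\<close> that lies in no \<open>E n\<close>. The centres keep the distance \<open>2 * R\<close> from the set that is avoided,
  so that the limit, at distance at most \<open>R\<close> from the centre, still avoids it.\<close>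
lemma Lp_Baire:
  fixes E :: "nat \<Rightarrow> (real \<Rightarrow> 'b::banach) set"
  assumes q: "q > 1" and ab: "a < b" and cover: "Lp_space q a b \<subseteq> (\<Union>n. E n)"
  shows "\<exists>n f0 r. f0 \<in> Lp_space q a b \<and> r > 0 \<and>
    (\<forall>f\<in>Lp_space q a b. Lp_norm q a b (\<lambda>t. f t - f0 t) < r \<longrightarrow>
      (\<forall>e>0. \<exists>g\<in>Lp_space q a b \<inter> E n. Lp_norm q a b (\<lambda>t. f t - g t) < e))"
proof (rule ccontr)
  assume neg: "\<not> ?thesis"
  have step: "\<exists>f\<in>Lp_space q a b. Lp_norm q a b (\<lambda>t. f t - f0 t) < r \<and>
      (\<exists>e>0. \<forall>g\<in>Lp_space q a b \<inter> E n. e \<le> Lp_norm q a b (\<lambda>t. f t - g t))"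
    if f0: "f0 \<in> Lp_space q a b" "r > 0" for n f0 r
  proof (rule ccontr)
    assume c: "\<not> (\<exists>f\<in>Lp_space q a b. Lp_norm q a b (\<lambda>t. f t - f0 t) < r \<and>
      (\<exists>e>0. \<forall>g\<in>Lp_space q a b \<inter> E n. e \<le> Lp_norm q a b (\<lambda>t. f t - g t)))"
    have "\<forall>f\<in>Lp_space q a b. Lp_norm q a b (\<lambda>t. f t - f0 t) < r \<longrightarrow>
      (\<forall>e>0. \<exists>g\<in>Lp_space q a b \<inter> E n. Lp_norm q a b (\<lambda>t. f t - g t) < e)"
      using c by (meson not_less)
    then show False using neg f0 by blast
  qed
  define Q where "Q n = (\<lambda>(f0, r) (f, s). Lp_norm q a b (\<lambda>t. f t - f0 t) \<le> r / 2 \<and> s \<le> r / 2 \<and>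
      (\<forall>g\<in>Lp_space q a b \<inter> E n. 2 * s \<le> Lp_norm q a b (\<lambda>t. f t - g t)))" for n
  have "\<exists>F. \<forall>n. (fst (F n) \<in> Lp_space q a b \<and> snd (F n) > 0) \<and> Q n (F n) (F (Suc n))"
  proof (rule dependent_nat_choice)
    show "\<exists>x. fst x \<in> Lp_space q a b \<and> snd x > (0::real)"
      by (rule exI[of _ "(\<lambda>_. 0, 1)"]) simp
    fix x :: "(real \<Rightarrow> 'b) \<times> real" and n assume x: "fst x \<in> Lp_space q a b \<and> snd x > 0"
    then have x': "fst x \<in> Lp_space q a b" "snd x / 2 > 0" by auto
    obtain f e where f: "f \<in> Lp_space q a b" "Lp_norm q a b (\<lambda>t. f t - fst x t) < snd x / 2" and "e > 0"
      and e: "\<And>g. g\<in>Lp_space q a b \<inter> E n \<Longrightarrow> e \<le> Lp_norm q a b (\<lambda>t. f t - g t)"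
      using step[OF x', of n] by blast
    show "\<exists>y. (fst y \<in> Lp_space q a b \<and> snd y > 0) \<and> Q n x y"
    proof (rule exI[of _ "(f, min (e / 2) (snd x / 2))"], intro conjI)
      show "Q n x (f, min (e / 2) (snd x / 2))"
      proof -
        have m: "2 * min (e / 2) (snd x / 2) \<le> e" "min (e / 2) (snd x / 2) \<le> snd x / 2" by simp_all
        have "\<forall>g\<in>Lp_space q a b \<inter> E n. 2 * min (e / 2) (snd x / 2) \<le> Lp_norm q a b (\<lambda>t. f t - g t)"
          using order_trans[OF m(1) e] by blast
        then show ?thesis using less_imp_le[OF f(2)] m(2) unfolding Q_def split_def fst_conv snd_conv by blast
      qed
    qed (use f \<open>e > 0\<close> x in auto)
  qed
  then obtain F where F: "\<And>n. fst (F n) \<in> Lp_space q a b" "\<And>n. snd (F n) > 0" "\<And>n. Q n (F n) (F (Suc n))" by blast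
  define h where "h n = fst (F n)" for n
  define R where "R n = snd (F n)" for n
  have h: "h n \<in> Lp_space q a b" and R: "R n > 0" for n using F by (auto simp: h_def R_def)
  have Qn: "Lp_norm q a b (\<lambda>t. h (Suc n) t - h n t) \<le> R n / 2" "R (Suc n) \<le> R n / 2"
    "\<And>g. g \<in> Lp_space q a b \<Longrightarrow> g \<in> E n \<Longrightarrow> 2 * R (Suc n) \<le> Lp_norm q a b (\<lambda>t. h (Suc n) t - g t)" for n
    using F(3)[of n] by (auto simp: Q_def h_def R_def split_def)
  have Rk: "R (k + n) \<le> R n / 2 ^ k" for k n
  proof (induction k)
    case (Suc k)
    show ?case using Qn(2)[of "k + n"] Suc by simp
  qed simp
  define d where "d n t = h (Suc n) t - h n t" for n t
  have dL: "d n \<in> Lp_space q a b" for n unfolding d_def using q by (intro Lp_diff h) auto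
  have dle: "Lp_norm q a b (d (k + n)) \<le> R n / 2 / 2 ^ k" for k n
    using Qn(1)[of "k + n"] Rk[of k n] by (simp add: d_def[abs_def])
  have sumd: "summable (\<lambda>k. Lp_norm q a b (d (k + n)))" for n
    by (rule summable_comparison_test'[OF geometric_halves(1)[of "R n / 2"], of 0]) (use dle[of _ n] in auto)
  have tail: "(\<Sum>k. Lp_norm q a b (d (k + n))) \<le> R n" for n
    using suminf_le[OF dle sumd geometric_halves(1)[of "R n / 2"]] geometric_halves(2)[of "R n / 2"] by simp
  obtain G where G: "G \<in> Lp_space q a b"
    and Gn: "\<And>n. Lp_norm q a b (\<lambda>t. G t - (\<Sum>k<n. d k t)) \<le> (\<Sum>k. Lp_norm q a b (d (k + n)))"
    using Lp_Riesz_Fischer[where f = d, OF dL q ab sumd[of 0, simplified]] by blast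
  define H where "H t = G t + h 0 t" for t
  have HL: "H \<in> Lp_space q a b" unfolding H_def using q by (intro Lp_add G h) auto
  have tele: "(\<Sum>k<n. d k t) = h n t - h 0 t" for n t
    unfolding d_def by (induction n) auto
  have near: "Lp_norm q a b (\<lambda>t. h n t - H t) \<le> R n" for n
  proof -
    have "Lp_norm q a b (\<lambda>t. h n t - H t) = Lp_norm q a b (\<lambda>t. G t - (\<Sum>k<n. d k t))"
      unfolding tele H_def by (subst Lp_norm_diff_commute) (simp add: algebra_simps)
    then show ?thesis using Gn[of n] tail[of n] by simp
  qed
  obtain n where "H \<in> E n" using cover HL by blast
  then show False using Qn(3)[OF HL, of n] near[of "Suc n"] R[of "Suc n"] by simp
qed

text \<open>Zabreiko's lemma: a countably subadditive seminorm on a Banach space is continuous. By Baire's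
  theorem some set \<open>{\<psi> \<le> n}\<close> is dense in a ball, by convexity and symmetry in a ball around zero, and by
  scaling with \<open>n\<close> and the radius shrunk by the same factor. Hence every \<open>f\<close> in that ball is the sum of
  a series whose \<open>k\<close>-th term has \<open>\<psi>\<close>-value at most \<open>n / 2 ^ k\<close>, and countable subadditivity gives
  \<open>\<psi> f \<le> 2 * n\<close>.\<close>
lemma Zabreiko_Lp:
  fixes \<psi> :: "(real \<Rightarrow> 'b::banach) \<Rightarrow> real"
  assumes q: "q > 1" and ab: "a < b"
    and add: "\<And>f g. f \<in> Lp_space q a b \<Longrightarrow> g \<in> Lp_space q a b \<Longrightarrow> \<psi> (\<lambda>t. f t + g t) \<le> \<psi> f + \<psi> g"
    and scale: "\<And>c f. f \<in> Lp_space q a b \<Longrightarrow> \<psi> (\<lambda>t. c *\<^sub>R f t) = \<bar>c\<bar> * \<psi> f"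
    and countable: "\<And>f F. f \<in> Lp_space q a b \<Longrightarrow> (\<And>n. F n \<in> Lp_space q a b) \<Longrightarrow>
       summable (\<lambda>n. Lp_norm q a b (F n)) \<Longrightarrow> summable (\<lambda>n. \<psi> (F n)) \<Longrightarrow>
       (\<lambda>n. Lp_norm q a b (\<lambda>t. f t - (\<Sum>k<n. F k t))) \<longlonglongrightarrow> 0 \<Longrightarrow> \<psi> f \<le> (\<Sum>n. \<psi> (F n))"
  obtains M where "M \<ge> 0" "\<And>f. f \<in> Lp_space q a b \<Longrightarrow> \<psi> f \<le> M * Lp_norm q a b f"
proof -
  let ?L = "Lp_space q a b" and ?N = "Lp_norm q a b"
  have q1: "q \<ge> 1" "q > 0" using q by auto
  have nonneg: "0 \<le> \<psi> f" if "f \<in> ?L" for f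
  proof -
    have "\<psi> (\<lambda>t. f t + (-1) *\<^sub>R f t) \<le> \<psi> f + \<psi> (\<lambda>t. (-1) *\<^sub>R f t)"
      by (intro add that Lp_scaleR q1)
    moreover have "\<psi> (\<lambda>t. f t + (-1) *\<^sub>R f t) = 0"
      using scale[OF that, of 0] by simp
    ultimately show ?thesis using scale[OF that, of "-1"] by simp
  qed
  define E where "E n = {f. \<psi> f \<le> real n}" for n
  have cover: "?L \<subseteq> (\<Union>n. E n)" unfolding E_def using real_arch_simple by auto
  obtain n f0 r where f0: "f0 \<in> ?L" and r: "r > 0"
    and dense0: "\<forall>f\<in>?L. ?N (\<lambda>t. f t - f0 t) < r \<longrightarrow> (\<forall>e>0. \<exists>g\<in>?L \<inter> E n. ?N (\<lambda>t. f t - g t) < e)"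
    using Lp_Baire[OF q ab cover] by (elim exE conjE)
  \<comment> \<open>\<open>f\<close> is half the difference of \<open>f0 + f\<close> and \<open>f0 - f\<close>, both of which lie in the ball around \<open>f0\<close>.\<close>
  have dense1: "\<exists>g\<in>?L. \<psi> g \<le> real n \<and> ?N (\<lambda>t. f t - g t) < e" if f: "f \<in> ?L" "?N f < r" and e: "e > 0" for f e
  proof -
    have "?N (\<lambda>t. (f0 t + f t) - f0 t) < r" "?N (\<lambda>t. (f0 t - f t) - f0 t) < r"
      using f(2) Lp_minus(2)[OF f(1) q1(2)] by simp_all
    note near = this
    have L: "(\<lambda>t. f0 t + f t) \<in> ?L" "(\<lambda>t. f0 t - f t) \<in> ?L"
      using f0 f(1) q1 by (auto intro: Lp_add Lp_diff)
    obtain g1 where "g1 \<in> ?L \<inter> E n" and g1': "?N (\<lambda>t. (f0 t + f t) - g1 t) < e"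
      using dense0[rule_format, OF L(1) near(1) e] by (rule bexE)
    then have g1: "g1 \<in> ?L" "\<psi> g1 \<le> n" by (simp_all add: E_def)
    obtain g2 where "g2 \<in> ?L \<inter> E n" and g2': "?N (\<lambda>t. (f0 t - f t) - g2 t) < e"
      using dense0[rule_format, OF L(2) near(2) e] by (rule bexE)
    then have g2: "g2 \<in> ?L" "\<psi> g2 \<le> n" by (simp_all add: E_def)
    define g where "g t = (1 / 2) *\<^sub>R (g1 t + (-1) *\<^sub>R g2 t)" for t
    have g2m: "(\<lambda>t. (-1) *\<^sub>R g2 t) \<in> ?L" by (rule Lp_scaleR(1)[OF g2(1) q1(2)])
    have gs: "(\<lambda>t. g1 t + (-1) *\<^sub>R g2 t) \<in> ?L" by (rule Lp_add(1)[OF g1(1) g2m q1(1)])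
    have "g \<in> ?L" unfolding g_def by (rule Lp_scaleR(1)[OF gs q1(2)])
    moreover have "\<psi> g \<le> n"
    proof -
      have "\<psi> g = 1 / 2 * \<psi> (\<lambda>t. g1 t + (-1) *\<^sub>R g2 t)" unfolding g_def by (subst scale[OF gs]) simp
      also have "\<dots> \<le> 1 / 2 * (\<psi> g1 + \<psi> g2)" using add[OF g1(1) g2m] scale[OF g2(1), of "-1"] by simp
      finally show ?thesis using g1(2) g2(2) by simp
    qed
    moreover have "?N (\<lambda>t. f t - g t) < e"
    proof -
      let ?u = "\<lambda>t. (f0 t + f t) - g1 t" and ?v = "\<lambda>t. (f0 t - f t) - g2 t"
      have L: "?u \<in> ?L" "?v \<in> ?L" using f0 f(1) g1(1) g2(1) q1 by (auto intro!: Lp_add Lp_diff)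
      have "f t - g t = (1 / 2) *\<^sub>R (?u t - ?v t)" for t
      proof -
        have "?u t - ?v t = 2 *\<^sub>R f t - (g1 t - g2 t)" by (simp add: scaleR_2)
        then show ?thesis by (simp only: g_def) (simp add: scaleR_diff_right)
      qed
      then have "?N (\<lambda>t. f t - g t) = 1 / 2 * ?N (\<lambda>t. ?u t - ?v t)"
        using Lp_scaleR(2)[OF Lp_diff(1)[OF L q1(1)] q1(2), of "1/2"] by simp
      also have "\<dots> \<le> 1 / 2 * (?N ?u + ?N ?v)" using Lp_diff(2)[OF L q1(1)] by simp
      finally show ?thesis using g1' g2' by simp
    qed
    ultimately show ?thesis by blast
  qed
  have dense2: "\<exists>g\<in>?L. \<psi> g \<le> s * n \<and> ?N (\<lambda>t. f t - g t) < e"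
    if f: "f \<in> ?L" "?N f < s * r" and e: "e > 0" and s: "s > 0" for f e s
  proof -
    have "(\<lambda>t. (1 / s) *\<^sub>R f t) \<in> ?L" by (rule Lp_scaleR(1)[OF f(1) q1(2)])
    moreover have "?N (\<lambda>t. (1 / s) *\<^sub>R f t) < r"
      unfolding Lp_scaleR(2)[OF f(1) q1(2)] using f(2) s by (simp add: field_simps)
    ultimately obtain g where g: "g \<in> ?L" "\<psi> g \<le> n" "?N (\<lambda>t. (1 / s) *\<^sub>R f t - g t) < e / s"
      using dense1[of "\<lambda>t. (1 / s) *\<^sub>R f t" "e / s"] e s by auto
    have sg: "(\<lambda>t. s *\<^sub>R g t) \<in> ?L" by (rule Lp_scaleR(1)[OF g(1) q1(2)])
    have "?N (\<lambda>t. f t - s *\<^sub>R g t) = ?N (\<lambda>t. s *\<^sub>R ((1 / s) *\<^sub>R f t - g t))"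
      using s by (simp add: scaleR_diff_right)
    also have "\<dots> = s * ?N (\<lambda>t. (1 / s) *\<^sub>R f t - g t)"
      using Lp_scaleR(2)[OF Lp_diff(1)[OF \<open>(\<lambda>t. (1 / s) *\<^sub>R f t) \<in> ?L\<close> g(1) q1(1)] q1(2), of s] s by simp
    also have "\<dots> < e" using g(3) s by (simp add: field_simps)
    finally show ?thesis using sg scale[OF g(1), of s] g(2) s by (intro bexI[OF _ sg]) auto
  qed
  have unit: "\<psi> f \<le> 2 * real n" if f: "f \<in> ?L" "?N f < r" for f
  proof -
    define Q where "Q k h h' \<longleftrightarrow> \<psi> (\<lambda>t. h t - h' t) \<le> real n / 2 ^ k" for k :: nat and h h' :: "real \<Rightarrow> 'b"
    have "\<exists>H. \<forall>k. (H k \<in> ?L \<and> ?N (H k) < r / 2 ^ k \<and> (k = 0 \<longrightarrow> H k = f)) \<and> Q k (H k) (H (Suc k))"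
    proof (rule dependent_nat_choice)
      show "\<exists>x. x \<in> ?L \<and> ?N x < r / 2 ^ 0 \<and> (0 = 0 \<longrightarrow> x = f)" using f by auto
      fix h k assume "h \<in> ?L \<and> ?N h < r / 2 ^ k \<and> (k = 0 \<longrightarrow> h = f)"
      then obtain g where g: "g \<in> ?L" "\<psi> g \<le> (1 / 2 ^ k) * n" "?N (\<lambda>t. h t - g t) < r / 2 ^ Suc k"
        using dense2[of h "1 / 2 ^ k" "r / 2 ^ Suc k"] r by auto
      have "(\<lambda>t. h t - g t) \<in> ?L" using \<open>h \<in> ?L \<and> _\<close> g(1) q1 by (auto intro: Lp_diff)
      then show "\<exists>y. (y \<in> ?L \<and> ?N y < r / 2 ^ Suc k \<and> (Suc k = 0 \<longrightarrow> y = f)) \<and> Q k h y"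
        using g by (intro exI[of _ "\<lambda>t. h t - g t"]) (simp add: Q_def)
    qed
    then obtain H where H: "\<And>k. H k \<in> ?L" "\<And>k. ?N (H k) < r / 2 ^ k" "H 0 = f"
      and HQ: "\<And>k. \<psi> (\<lambda>t. H k t - H (Suc k) t) \<le> real n / 2 ^ k"
      unfolding Q_def by blast
    define F where "F k t = H k t - H (Suc k) t" for k t
    have FL: "F k \<in> ?L" for k unfolding F_def by (intro Lp_diff H q1)
    have FN: "?N (F k) \<le> 2 * r / 2 ^ k" for k
    proof -
      have "?N (F k) \<le> ?N (H k) + ?N (H (Suc k))" unfolding F_def[abs_def] by (intro Lp_diff H q1)
      also have "\<dots> \<le> r / 2 ^ k + r / 2 ^ Suc k" using H(2)[of k] H(2)[of "Suc k"] by simp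
      also have "\<dots> \<le> 2 * r / 2 ^ k" using r by (simp add: field_simps)
      finally show ?thesis .
    qed
    have F\<psi>: "\<psi> (F k) \<le> real n / 2 ^ k" for k using HQ by (simp add: F_def[abs_def])
    have sN: "summable (\<lambda>k. ?N (F k))"
      by (rule summable_comparison_test'[OF geometric_halves(1)[of "2 * r"], of 0]) (use FN in auto)
    have s\<psi>: "summable (\<lambda>k. \<psi> (F k))"
      by (rule summable_comparison_test'[OF geometric_halves(1)[of "real n"], of 0]) (use F\<psi> nonneg[OF FL] in auto)
    have tele: "f t - (\<Sum>k<m. F k t) = H m t" for m t
      unfolding F_def H(3)[symmetric] by (induction m) (auto simp: algebra_simps)
    have "(\<lambda>m. ?N (\<lambda>t. f t - (\<Sum>k<m. F k t))) \<longlonglongrightarrow> 0"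
      unfolding tele
    proof (rule tendsto_sandwich[OF _ _ tendsto_const])
      show "(\<lambda>m. r / 2 ^ m) \<longlonglongrightarrow> 0" using geometric_halves(1) by (rule summable_LIMSEQ_zero)
    qed (use H(2) in \<open>auto intro!: always_eventually less_imp_le\<close>)
    then have "\<psi> f \<le> (\<Sum>k. \<psi> (F k))" by (intro countable f(1) FL sN s\<psi>)
    also have "\<dots> \<le> (\<Sum>k. real n / 2 ^ k)" by (intro suminf_le F\<psi> s\<psi> geometric_halves)
    finally show ?thesis using geometric_halves(2) by simp
  qed
  show thesis
  proof (rule that)
    show "0 \<le> 2 * real n / r" using r by simp
    fix f :: "real \<Rightarrow> 'b" assume f: "f \<in> ?L"
    \<comment> \<open>The norm of \<open>f\<close> may vanish; it is therefore approached by \<open>N\<close> from above.\<close>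
    have *: "\<psi> f \<le> 2 * real n / r * N" if "N > ?N f" for N
    proof -
      have N: "N > 0" using that Lp_norm_nonneg[of q a b f] by linarith
      have "?N (\<lambda>t. (r / N) *\<^sub>R f t) < r"
        unfolding Lp_scaleR(2)[OF f q1(2)] using r N that by (simp add: field_simps)
      then have "\<psi> (\<lambda>t. (r / N) *\<^sub>R f t) \<le> 2 * real n" by (intro unit Lp_scaleR f q1)
      then show ?thesis using scale[OF f, of "r / N"] r N by (simp add: field_simps)
    qed
    show "\<psi> f \<le> 2 * real n / r * ?N f"
    proof (rule field_le_epsilon)
      fix e :: real assume "e > 0"
      define d where "d = e / (2 * real n / r + 1)"
      have c: "2 * real n / r + 1 > 0" using r by (simp add: add_nonneg_pos)
      have d: "d > 0" using \<open>e > 0\<close> c by (simp add: d_def)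
      have "\<psi> f \<le> 2 * real n / r * (?N f + d)" using d by (intro *) simp
      also have "\<dots> = 2 * real n / r * ?N f + 2 * real n / r * d" by (rule distrib_left)
      also have "2 * real n / r * d \<le> (2 * real n / r + 1) * d" using d by (simp add: distrib_right)
      also have "\<dots> = e" using c by (simp add: d_def)
      finally show "\<psi> f \<le> 2 * real n / r * ?N f + e" by simp
    qed
  qed
qed

lemma Lp_limit_integral:
  fixes v :: "real \<Rightarrow> 'x::banach"
  assumes q: "q > 1" and ab: "a < b" and V: "\<And>n. V n \<in> Lp_space q a b" and v: "v \<in> Lp_space q a b"
    and lim: "(\<lambda>n. Lp_norm q a b (\<lambda>t. v t - V n t)) \<longlonglongrightarrow> 0" and t: "t \<in> {a..b}"
  shows "(\<lambda>n. integral {a..t} (V n)) \<longlonglongrightarrow> integral {a..t} v"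
proof (rule LIM_zero_cancel, rule Lim_null_comparison)
  let ?c = "(b - a) powr (1 - 1 / q)"
  have q1: "q \<ge> 1" using q by simp
  show "\<forall>\<^sub>F n in sequentially. norm (integral {a..t} (V n) - integral {a..t} v) \<le> ?c * Lp_norm q a b (\<lambda>t. v t - V n t)"
  proof (intro always_eventually allI)
    fix n
    have "integral {a..t} (V n) - integral {a..t} v = integral {a..t} (\<lambda>s. V n s - v s)"
      using t by (intro Henstock_Kurzweil_Integration.integral_diff[symmetric] Lp_integrable_on_sub[OF V q] Lp_integrable_on_sub[OF v q]) auto
    then have "norm (integral {a..t} (V n) - integral {a..t} v) \<le> ?c * Lp_norm q a b (\<lambda>s. V n s - v s)"
      using Lp_integral_norm_le[OF Lp_diff(1)[OF V v q1] q t ab] by simp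
    then show "norm (integral {a..t} (V n) - integral {a..t} v) \<le> ?c * Lp_norm q a b (\<lambda>t. v t - V n t)"
      by (subst Lp_norm_diff_commute)
  qed
  show "(\<lambda>n. ?c * Lp_norm q a b (\<lambda>t. v t - V n t)) \<longlonglongrightarrow> 0"
    using tendsto_mult_left[OF lim, of ?c] by simp
qed

text \<open>The graph of the solution operator is closed: the integrated equation passes to limits in \<open>L\<^sup>q\<close>
  because primitives converge uniformly.\<close>
lemma integral_solution_series:
  assumes B: "bounded_op_fun a b B" and q: "q > 1" and ab: "a < b"
    and L: "f \<in> Lp_space q a b" "D \<in> Lp_space q a b"
    and Ln: "\<And>n. F n \<in> Lp_space q a b" "\<And>n. E n \<in> Lp_space q a b"
    and s: "\<And>n. integral_solution j a b B (F n) 0 (E n)"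
    and limF: "(\<lambda>n. Lp_norm q a b (\<lambda>t. f t - (\<Sum>k<n. F k t))) \<longlonglongrightarrow> 0"
    and limD: "(\<lambda>n. Lp_norm q a b (\<lambda>t. D t - (\<Sum>k<n. E k t))) \<longlonglongrightarrow> 0"
    and sums: "AE t in lebesgue_on {a..b}. (\<lambda>n. E n t) sums D t"
  shows "integral_solution j a b B f 0 D"
proof -
  have q1: "q \<ge> 1" "q > 0" using q by auto
  define SF where "SF n = (\<lambda>t. \<Sum>k<n. F k t)" for n
  define SE where "SE n = (\<lambda>t. \<Sum>k<n. E k t)" for n
  have SL: "SF n \<in> Lp_space q a b" "SE n \<in> Lp_space q a b" for n
    using Lp_sum[of q "{..<n}" F a b] Lp_sum[of q "{..<n}" E a b] Ln q1 by (auto simp: SF_def SE_def)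
  have sn: "integral_solution j a b B (SF n) 0 (SE n)" for n
    unfolding SF_def SE_def using integral_solution_sum[OF B q, of "{..<n}" F E j] Ln s by simp
  obtain K where K: "K \<ge> 0" "\<And>g. g \<in> Lp_space q a b \<Longrightarrow> Lp_norm q a b (\<lambda>t. B t (g t)) \<le> K * Lp_norm q a b g"
    using bounded_op_fun_Lp[OF B] q1 by (metis order_refl)
  have V: "resid B (SF n) (SE n) \<in> Lp_space q a b" "resid B f D \<in> Lp_space q a b" for n
    by (intro resid_Lp B q SL L)+
  have "(\<lambda>n. Lp_norm q a b (\<lambda>t. resid B f D t - resid B (SF n) (SE n) t)) \<longlonglongrightarrow> 0"
  proof (rule tendsto_sandwich[OF _ _ tendsto_const])
    show "\<forall>\<^sub>F n in sequentially. Lp_norm q a b (\<lambda>t. resid B f D t - resid B (SF n) (SE n) t)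
       \<le> Lp_norm q a b (\<lambda>t. f t - SF n t) + K * Lp_norm q a b (\<lambda>t. D t - SE n t)"
    proof (intro always_eventually allI)
      fix n
      have L1: "(\<lambda>t. f t - SF n t) \<in> Lp_space q a b" "(\<lambda>t. D t - SE n t) \<in> Lp_space q a b"
        by (intro Lp_diff L SL q1)+
      have "(\<lambda>t. resid B f D t - resid B (SF n) (SE n) t) = (\<lambda>t. (f t - SF n t) - B t (D t - SE n t))"
        by (auto simp: resid_def blinfun.diff_right)
      then have "Lp_norm q a b (\<lambda>t. resid B f D t - resid B (SF n) (SE n) t)
         \<le> Lp_norm q a b (\<lambda>t. f t - SF n t) + Lp_norm q a b (\<lambda>t. B t (D t - SE n t))"
        using Lp_diff(2)[OF L1(1) bounded_op_fun_in_Lp[OF B q1(2) L1(2)] q1(1)] by simp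
      then show "Lp_norm q a b (\<lambda>t. resid B f D t - resid B (SF n) (SE n) t)
         \<le> Lp_norm q a b (\<lambda>t. f t - SF n t) + K * Lp_norm q a b (\<lambda>t. D t - SE n t)"
        using K(2)[OF L1(2)] by simp
    qed
    show "(\<lambda>n. Lp_norm q a b (\<lambda>t. f t - SF n t) + K * Lp_norm q a b (\<lambda>t. D t - SE n t)) \<longlonglongrightarrow> 0"
      using tendsto_add[OF limF tendsto_mult_left[OF limD, of K]] by (simp add: SF_def SE_def)
  qed simp
  note lim = Lp_limit_integral[OF q ab V this]
  have "AE t in lebesgue_on {a..b}. \<forall>n. j (SE n t) = 0 + integral {a..t} (resid B (SF n) (SE n))"
    using sn by (simp add: integral_solution_def AE_all_countable)
  then show ?thesis unfolding integral_solution_def using sums AE_lebesgue_on_mem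
  proof eventually_elim
    case (elim t)
    have "(\<lambda>n. SE n t) \<longlonglongrightarrow> D t" using elim(2) by (simp add: sums_def SE_def)
    then have "(\<lambda>n. j (SE n t)) \<longlonglongrightarrow> j (D t)" by (intro tendsto_intros)
    moreover have "(\<lambda>n. j (SE n t)) \<longlonglongrightarrow> 0 + integral {a..t} (resid B f D)"
      using lim[OF elim(3)] elim(1) by simp
    ultimately show ?case by (rule LIMSEQ_unique)
  qed
qed

text \<open>The a priori estimate of maximal regularity. It follows from mere unique solvability: the norm of
  the solution is a seminorm of the right-hand side, and it is countably subadditive since a series
  of solutions that converges in norm solves the equation for the sum of the right-hand sides.\<close>
lemma well_posed_bounded:
  fixes j :: "'d::banach \<Rightarrow>\<^sub>L 'x::banach"
  assumes w: "well_posed j q a b B" and B: "bounded_op_fun a b B" and q: "q > 1" and ab: "a < b"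
  obtains M where "M \<ge> 0" "\<And>f D. f \<in> Lp_space q a b \<Longrightarrow> D \<in> Lp_space q a b \<Longrightarrow>
    integral_solution j a b B f 0 D \<Longrightarrow> Lp_norm q a b D \<le> M * Lp_norm q a b f"
proof -
  let ?L = "Lp_space q a b" and ?N = "Lp_norm q a b"
  have q1: "q \<ge> 1" "q > 0" using q by auto
  define S where "S f = (SOME D. D \<in> Lp_space q a b \<and> integral_solution j a b B f 0 D)" for f
  have S: "S f \<in> Lp_space q a b" "integral_solution j a b B f 0 (S f)" if "f \<in> Lp_space q a b" for f
    using someI_ex[of "\<lambda>D. D \<in> Lp_space q a b \<and> integral_solution j a b B f 0 D"] w that
    by (auto simp: S_def well_posed_def)
  have eq: "?N D = ?N (S f)" if "f \<in> Lp_space q a b" "D \<in> Lp_space q a b" "integral_solution j a b B f 0 D" for f D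
    by (rule Lp_AE_cong(2)[OF S(1) q1(2) well_posed_unique[OF w B q]]) (use that S in auto)
  have "\<exists>M\<ge>0. \<forall>f\<in>Lp_space q a b. ?N (S f) \<le> M * Lp_norm q a b f"
  proof (rule Zabreiko_Lp[OF q ab, where \<psi> = "\<lambda>f. ?N (S f)"])
    fix f g :: "real \<Rightarrow> 'x" assume L: "f \<in> Lp_space q a b" "g \<in> Lp_space q a b"
    have "?N (\<lambda>t. S f t + S g t) = ?N (S (\<lambda>t. f t + g t))"
      using integral_solution_add[OF B q L(1) S(1)[OF L(1)] L(2) S(1)[OF L(2)] S(2)[OF L(1)] S(2)[OF L(2)]]
      by (intro eq Lp_add L S q1) simp
    then show "?N (S (\<lambda>t. f t + g t)) \<le> ?N (S f) + ?N (S g)"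
      using Lp_add(2)[OF S(1)[OF L(1)] S(1)[OF L(2)] q1(1)] by simp
  next
    fix c and f :: "real \<Rightarrow> 'x" assume L: "f \<in> Lp_space q a b"
    have "?N (\<lambda>t. c *\<^sub>R S f t) = ?N (S (\<lambda>t. c *\<^sub>R f t))"
      using integral_solution_scaleR[OF S(2)[OF L], of c] by (intro eq Lp_scaleR L S q1) simp
    then show "?N (S (\<lambda>t. c *\<^sub>R f t)) = \<bar>c\<bar> * ?N (S f)"
      using Lp_scaleR(2)[OF S(1)[OF L] q1(2)] by simp
  next
    fix f :: "real \<Rightarrow> 'x" and F
    assume L: "f \<in> Lp_space q a b" "\<And>n. F n \<in> Lp_space q a b" and "summable (\<lambda>n. Lp_norm q a b (F n))"
      and sum: "summable (\<lambda>n. ?N (S (F n)))" and lim: "(\<lambda>n. Lp_norm q a b (\<lambda>t. f t - (\<Sum>k<n. F k t))) \<longlonglongrightarrow> 0"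
    obtain D where D: "D \<in> ?L" "AE t in lebesgue_on {a..b}. (\<lambda>n. S (F n) t) sums D t"
        "\<And>n. ?N (\<lambda>t. D t - (\<Sum>k<n. S (F k) t)) \<le> (\<Sum>k. ?N (S (F (k + n))))"
        "(\<lambda>n. ?N (\<lambda>t. D t - (\<Sum>k<n. S (F k) t))) \<longlonglongrightarrow> 0"
      using Lp_Riesz_Fischer[OF S(1)[OF L(2)] q ab sum] by blast
    have "integral_solution j a b B f 0 D"
      by (rule integral_solution_series[OF B q ab L(1) D(1) L(2) S(1)[OF L(2)] S(2)[OF L(2)] lim D(4,2)])
    then have "?N (S f) = ?N D" using eq[OF L(1) D(1)] by simp
    also have "\<dots> \<le> (\<Sum>n. ?N (S (F n)))" using D(3)[of 0] by simp
    finally show "?N (S f) \<le> (\<Sum>n. ?N (S (F n)))" .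
  qed blast
  then show thesis using that eq by metis
qed

text \<open>The constant for the whole interval serves all subintervals: extend the right-hand side by zero.
  By uniqueness on \<open>[0,a]\<close> the solution \<open>E\<close> for the extension vanishes there, so that it restricts to the
  solution on \<open>[a,b]\<close>.\<close>
lemma well_posed_uniformly_bounded:
  fixes j :: "'d::banach \<Rightarrow>\<^sub>L 'x::banach"
  assumes B: "bounded_op_fun 0 \<tau> B" and q: "q > 1" and "0 < \<tau>"
    and w: "\<And>a b. 0 \<le> a \<Longrightarrow> a < b \<Longrightarrow> b \<le> \<tau> \<Longrightarrow> well_posed j q a b B"
  obtains M where "M \<ge> 0" "\<And>a b f D. 0 \<le> a \<Longrightarrow> a < b \<Longrightarrow> b \<le> \<tau> \<Longrightarrow> f \<in> Lp_space q a b \<Longrightarrow>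
    D \<in> Lp_space q a b \<Longrightarrow> integral_solution j a b B f 0 D \<Longrightarrow> Lp_norm q a b D \<le> M * Lp_norm q a b f"
proof -
  have q1: "q \<ge> 1" "q > 0" using q by auto
  obtain M where M: "M \<ge> 0" "\<And>f D. f \<in> Lp_space q 0 \<tau> \<Longrightarrow> D \<in> Lp_space q 0 \<tau> \<Longrightarrow>
    integral_solution j 0 \<tau> B f 0 D \<Longrightarrow> Lp_norm q 0 \<tau> D \<le> M * Lp_norm q 0 \<tau> f"
    using well_posed_bounded[OF w[OF order_refl \<open>0 < \<tau>\<close> order_refl] B q \<open>0 < \<tau>\<close>] by blast
  show thesis
  proof (rule that[OF M(1)])
    fix a b and f :: "real \<Rightarrow> 'x" and D :: "real \<Rightarrow> 'd" assume ab: "0 \<le> a" "a < b" "b \<le> \<tau>"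
      and L: "f \<in> Lp_space q a b" "D \<in> Lp_space q a b" and s: "integral_solution j a b B f 0 D"
    define f' where "f' t = (if t \<in> {a..b} then f t else 0)" for t
    have f': "f' \<in> Lp_space q 0 \<tau>" "Lp_norm q 0 \<tau> f' = Lp_norm q a b f"
      unfolding f'_def[abs_def] using Lp_zero_extend[OF L(1), of 0 \<tau>] ab by auto
    obtain E where E: "E \<in> Lp_space q 0 \<tau>" "integral_solution j 0 \<tau> B f' 0 E"
      using w[of 0 \<tau>] \<open>0 < \<tau>\<close> f'(1) by (auto simp: well_posed_def)
    have i0: "integral {0..a} (resid B f' E) = 0"
    proof (cases "0 < a")
      case True
      have ne: "AE t in lebesgue_on {0..a}. t \<noteq> a"
        by (rule AE_lebesgue_on_neq)
      have "integral_solution j 0 a B f' 0 E" by (rule integral_solution_restrict[OF E(2)]) (use ab in auto)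
      then have "integral_solution j 0 a B (\<lambda>_. 0) 0 E"
        by (rule integral_solution_AE_cong)
          (use ne AE_lebesgue_on_mem[of "{0..a}"] in \<open>eventually_elim; auto simp: resid_def f'_def\<close>)+
      moreover have "E \<in> Lp_space q 0 a" by (rule Lp_mono_interval(1)[OF E(1)]) (use ab in auto)
      ultimately have "AE t in lebesgue_on {0..a}. E t = 0"
        using w[of 0 a] True ab by (auto simp: well_posed_def)
      with ne have "AE t in lebesgue_on {0..a}. resid B f' E t = 0"
        using AE_lebesgue_on_mem by eventually_elim (auto simp: resid_def f'_def blinfun.zero_right)
      then show ?thesis using integral_AE_cong by fastforce
    next
      case False
      then show ?thesis using ab by simp
    qed
    have Ea: "E \<in> Lp_space q a b" by (rule Lp_mono_interval(1)[OF E(1)]) (use ab in auto)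
    have "integral_solution j a \<tau> B f' 0 E"
      using integral_solution_tail[OF B q f'(1) E(1) E(2), of a] ab i0 by simp
    then have "integral_solution j a b B f' 0 E" by (rule integral_solution_restrict) (use ab in auto)
    then have "integral_solution j a b B f 0 E"
      by (rule integral_solution_AE_cong) (auto intro!: AE_I2 simp: resid_def f'_def)
    then have "AE t in lebesgue_on {a..b}. E t = D t"
      using well_posed_unique[OF w[OF ab] bounded_op_fun_mono[OF B ab(1,3)] q L(1) Ea L(2) _ s] by simp
    then have "Lp_norm q a b D = Lp_norm q a b E" by (rule Lp_AE_cong(2)[OF Ea q1(2)])
    also have "\<dots> \<le> Lp_norm q 0 \<tau> E" by (rule Lp_mono_interval(2)[OF E(1)]) (use ab q1 in auto)
    also have "\<dots> \<le> M * Lp_norm q a b f" using M(2)[OF f'(1) E] f'(2) by simp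
    finally show "Lp_norm q a b D \<le> M * Lp_norm q a b f" .
  qed
qed

section \<open>Small perturbations, freezing of coefficients and concatenation\<close>

text \<open>Let \<open>S\<close> be the solution operator for \<open>B\<close>. A solution of the perturbed equation is \<open>S g\<close> with
  \<open>g + Q (S g) = f\<close>, and \<open>f \<mapsto> Q (S f)\<close> has norm at most \<open>\<theta> < 1\<close>; hence \<open>g\<close> is given by a Neumann series, and
  a solution for the right-hand side zero satisfies \<open>\<parallel>Q D\<parallel> \<le> \<theta> * \<parallel>Q D\<parallel>\<close>.\<close>
lemma well_posed_perturb:
  fixes j :: "'d::banach \<Rightarrow>\<^sub>L 'x::banach"
  assumes w: "well_posed j q a b B" and B: "bounded_op_fun a b B" and Q: "bounded_op_fun a b Q"
    and q: "q > 1" and ab: "a < b" and \<theta>: "0 \<le> \<theta>" "\<theta> < 1"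
    and small: "\<And>f D. f \<in> Lp_space q a b \<Longrightarrow> D \<in> Lp_space q a b \<Longrightarrow> integral_solution j a b B f 0 D \<Longrightarrow>
       Lp_norm q a b (\<lambda>t. Q t (D t)) \<le> \<theta> * Lp_norm q a b f"
  shows "well_posed j q a b (\<lambda>t. B t + Q t)"
  unfolding well_posed_def
proof (intro conjI ballI impI)
  let ?N = "Lp_norm q a b"
  have q1: "q \<ge> 1" "q > 0" using q by auto
  fix f :: "real \<Rightarrow> 'x" assume f: "f \<in> Lp_space q a b"
  define S where "S f = (SOME D. D \<in> Lp_space q a b \<and> integral_solution j a b B f 0 D)" for f
  have S: "S f \<in> Lp_space q a b" "integral_solution j a b B f 0 (S f)" if "f \<in> Lp_space q a b" for f
    using someI_ex[of "\<lambda>D. D \<in> Lp_space q a b \<and> integral_solution j a b B f 0 D"] w that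
    by (auto simp: S_def well_posed_def)
  define G where "G = rec_nat f (\<lambda>_ g t. - Q t (S g t))"
  have G: "G 0 = f" "G (Suc k) = (\<lambda>t. - Q t (S (G k) t))" for k by (simp_all add: G_def)
  have GL: "G k \<in> Lp_space q a b" for k
  proof (induction k)
    case (Suc k)
    then show ?case unfolding G(2) by (intro Lp_minus(1) bounded_op_fun_in_Lp[OF Q] S q1)
  qed (simp add: G f)
  have SG: "S (G k) \<in> Lp_space q a b" "integral_solution j a b B (G k) 0 (S (G k))" for k
    using S GL by auto
  have GN: "?N (G k) \<le> \<theta> ^ k * ?N f" for k
  proof (induction k)
    case (Suc k)
    have "?N (G (Suc k)) = ?N (\<lambda>t. Q t (S (G k) t))"
      unfolding G(2) by (intro Lp_minus(2) bounded_op_fun_in_Lp[OF Q] SG q1)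
    also have "\<dots> \<le> \<theta> * ?N (G k)" by (rule small[OF GL SG])
    also have "\<dots> \<le> \<theta> * (\<theta> ^ k * ?N f)" using Suc \<theta> by (intro mult_left_mono)
    finally show ?case by simp
  qed (simp add: G)
  have sum: "summable (\<lambda>k. ?N (G k))"
  proof (rule summable_comparison_test'[of _ 0])
    show "summable (\<lambda>k. \<theta> ^ k * ?N f)" using \<theta> by (intro summable_mult2 summable_geometric) simp
  qed (use GN in auto)
  obtain g where g: "g \<in> Lp_space q a b" and lim: "(\<lambda>n. ?N (\<lambda>t. g t - (\<Sum>k<n. G k t))) \<longlonglongrightarrow> 0"
    using Lp_Riesz_Fischer[where f = G, OF GL q ab sum] by blast
  define D where "D = S g"
  have D: "D \<in> Lp_space q a b" "integral_solution j a b B g 0 D" using S[OF g] by (auto simp: D_def)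
  define e where "e n = ?N (\<lambda>t. g t - (\<Sum>k<n. G k t))" for n
  define h where "h t = f t - g t - Q t (D t)" for t
  have hL: "h \<in> Lp_space q a b"
    unfolding h_def by (intro Lp_diff f g bounded_op_fun_in_Lp[OF Q] D q1)
  have hle: "?N h \<le> e (Suc n) + \<theta> * e n" for n
  proof -
    have L: "(\<lambda>t. \<Sum>k<n. G k t) \<in> Lp_space q a b" "(\<lambda>t. \<Sum>k<n. S (G k) t) \<in> Lp_space q a b" for n
      using Lp_sum[of q "{..<n}" G a b] Lp_sum[of q "{..<n}" "\<lambda>k. S (G k)" a b] GL SG q1 by auto
    have sol: "integral_solution j a b B (\<lambda>t. g t - (\<Sum>k<n. G k t)) 0 (\<lambda>t. D t - (\<Sum>k<n. S (G k) t))"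
      using integral_solution_diff[OF B q g D(1) L D(2) integral_solution_sum[OF B q _ GL SG]] by simp
    have 1: "?N (\<lambda>t. Q t (D t - (\<Sum>k<n. S (G k) t))) \<le> \<theta> * e n"
      unfolding e_def by (intro small sol Lp_diff g D L q1)
    \<comment> \<open>The partial sums obey the fixed point equation, with a delay of one term.\<close>
    have G_sum: "(\<Sum>k<Suc n. G k t) = f t - Q t (\<Sum>k<n. S (G k) t)" for t
      unfolding sum.lessThan_Suc_shift by (simp add: G sum_negf blinfun.sum_right)
    have "h t = - (g t - (\<Sum>k<Suc n. G k t)) - Q t (D t - (\<Sum>k<n. S (G k) t))" for t
      unfolding G_sum by (simp add: h_def blinfun.diff_right)
    then have "?N h = ?N (\<lambda>t. - (g t - (\<Sum>k<Suc n. G k t)) - Q t (D t - (\<Sum>k<n. S (G k) t)))" by presburger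
    also have "\<dots> \<le> ?N (\<lambda>t. - (g t - (\<Sum>k<Suc n. G k t))) + ?N (\<lambda>t. Q t (D t - (\<Sum>k<n. S (G k) t)))"
      by (intro Lp_diff Lp_minus bounded_op_fun_in_Lp[OF Q] g D L q1)
    also have "?N (\<lambda>t. - (g t - (\<Sum>k<Suc n. G k t))) = e (Suc n)"
      unfolding e_def by (intro Lp_minus(2) Lp_diff g L q1)
    finally show ?thesis using 1 by simp
  qed
  have "(\<lambda>n. e (Suc n) + \<theta> * e n) \<longlonglongrightarrow> 0 + \<theta> * 0"
    using lim unfolding e_def[symmetric] by (intro tendsto_intros LIMSEQ_Suc)
  then have "?N h \<le> 0"
    using LIMSEQ_le_const[of "\<lambda>n. e (Suc n) + \<theta> * e n" 0 "?N h"] hle by auto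
  then have "?N h = 0" using Lp_norm_nonneg[of q a b h] by linarith
  then have "AE t in lebesgue_on {a..b}. h t = 0" using Lp_norm_eq_0_iff[OF hL q1(2)] by simp
  then have "AE t in lebesgue_on {a..b}. resid B g D t = resid (\<lambda>t. B t + Q t) f D t"
    by eventually_elim (auto simp: h_def resid_def blinfun.add_left algebra_simps)
  from integral_solution_AE_cong[OF D(2) _ this]
  have "integral_solution j a b (\<lambda>t. B t + Q t) f 0 D" by simp
  then show "\<exists>D\<in>Lp_space q a b. integral_solution j a b (\<lambda>t. B t + Q t) f 0 D" using D(1) by blast
next
  let ?N = "Lp_norm q a b"
  have q1: "q \<ge> 1" "q > 0" using q by auto
  fix D assume D: "D \<in> Lp_space q a b" "integral_solution j a b (\<lambda>t. B t + Q t) (\<lambda>_. 0) 0 D"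
  have QL: "(\<lambda>t. Q t (D t)) \<in> Lp_space q a b" by (rule bounded_op_fun_in_Lp[OF Q q1(2) D(1)])
  have "integral_solution j a b B (\<lambda>t. - Q t (D t)) 0 D"
    by (rule integral_solution_AE_cong[OF D(2)]) (auto simp: resid_def blinfun.add_left)
  then have "?N (\<lambda>t. Q t (D t)) \<le> \<theta> * ?N (\<lambda>t. Q t (D t))"
    using small[OF Lp_minus(1)[OF QL q1(2)] D(1)] Lp_minus(2)[OF QL q1(2)] by simp
  then have "(1 - \<theta>) * ?N (\<lambda>t. Q t (D t)) \<le> 0" by (simp add: algebra_simps)
  then have "?N (\<lambda>t. Q t (D t)) = 0"
    using \<theta> Lp_norm_nonneg[of q a b "\<lambda>t. Q t (D t)"] by (simp add: mult_le_0_iff)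
  then have "AE t in lebesgue_on {a..b}. Q t (D t) = 0" using Lp_norm_eq_0_iff[OF QL q1(2)] by simp
  then have "AE t in lebesgue_on {a..b}. resid (\<lambda>t. B t + Q t) (\<lambda>_. 0) D t = resid B (\<lambda>_. 0) D t"
    by eventually_elim (auto simp: resid_def blinfun.add_left)
  from integral_solution_AE_cong[OF D(2) _ this] have "integral_solution j a b B (\<lambda>_. 0) 0 D" by simp
  then show "AE t in lebesgue_on {a..b}. D t = 0" using w D(1) by (auto simp: well_posed_def)
qed

text \<open>The part of \<open>Q\<close> that is bounded with respect to the norm of the large space gains the factor \<open>b - a\<close>,
  because the solution starts at zero and is the primitive of a function with norm at most
  \<open>1 + K * M\<close> times that of \<open>f\<close>.\<close>
lemma frozen_perturbation_bound:
  fixes j :: "'d::banach \<Rightarrow>\<^sub>L 'x::banach"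
  assumes B: "bounded_op_fun a b B" and Q: "bounded_op_fun a b Q" and q: "q > 1" and ab: "a < b"
    and M: "Lp_norm q a b D \<le> M * Lp_norm q a b f" and K: "Lp_norm q a b (\<lambda>t. B t (D t)) \<le> K * Lp_norm q a b D" "K \<ge> 0"
    and L: "f \<in> Lp_space q a b" "D \<in> Lp_space q a b" and s: "integral_solution j a b B f 0 D"
    and \<epsilon>: "\<epsilon> \<ge> 0" and \<eta>: "\<eta> \<ge> 0"
    and le: "\<And>t x. t \<in> {a..b} \<Longrightarrow> norm (Q t x) \<le> \<epsilon> * norm x + \<eta> * norm (j x)"
  shows "Lp_norm q a b (\<lambda>t. Q t (D t)) \<le> (\<epsilon> * M + \<eta> * (b - a) * (1 + K * M)) * Lp_norm q a b f"
proof -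
  let ?N = "Lp_norm q a b"
  have q1: "q \<ge> 1" "q > 0" using q by auto
  define c where "c = (b - a) powr (1 - 1 / q) * ((1 + K * M) * ?N f)"
  have "?N (resid B f D) \<le> ?N f + ?N (\<lambda>t. B t (D t))"
    unfolding resid_def by (intro Lp_diff L bounded_op_fun_in_Lp[OF B] q1)
  also have "\<dots> \<le> ?N f + K * (M * ?N f)" using K M by (intro add_left_mono order_trans[OF K(1)] mult_left_mono)
  also have "\<dots> = (1 + K * M) * ?N f" by (simp add: algebra_simps)
  finally have res: "?N (resid B f D) \<le> (1 + K * M) * ?N f" .
  have c0: "c \<ge> 0" unfolding c_def
    by (rule mult_nonneg_nonneg[OF powr_ge_zero order_trans[OF Lp_norm_nonneg res]])
  have "AE t in lebesgue_on {a..b}. norm (j (D t)) \<le> c"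
    using s[unfolded integral_solution_def] AE_lebesgue_on_mem
  proof eventually_elim
    case (elim t)
    have "norm (j (D t)) \<le> (b - a) powr (1 - 1 / q) * ?N (resid B f D)"
      using elim Lp_integral_norm_le[OF resid_Lp[OF B q L] q _ ab] by simp
    also have "\<dots> \<le> c" unfolding c_def using res by (intro mult_left_mono) auto
    finally show ?case .
  qed
  then have dom: "AE t in lebesgue_on {a..b}. norm (Q t (D t)) \<le> 1 * norm (\<epsilon> *\<^sub>R norm (D t) + \<eta> * c)"
    using AE_lebesgue_on_mem
  proof eventually_elim
    case (elim t)
    have "norm (Q t (D t)) \<le> \<epsilon> * norm (D t) + \<eta> * norm (j (D t))" using le elim(2) by blast
    also have "\<dots> \<le> \<epsilon> * norm (D t) + \<eta> * c" using elim(1) \<eta> by (intro add_left_mono mult_left_mono)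
    also have "\<dots> \<le> 1 * norm (\<epsilon> *\<^sub>R norm (D t) + \<eta> * c)" by simp
    finally show ?case .
  qed
  have nD: "(\<lambda>t. norm (D t)) \<in> Lp_space q a b" "?N (\<lambda>t. norm (D t)) = ?N D"
    using L(2) by (auto simp: Lp_space_def Lp_norm_def intro: strongly_measurable_on_comp)
  have eL: "(\<lambda>t. \<epsilon> *\<^sub>R norm (D t)) \<in> Lp_space q a b" "?N (\<lambda>t. \<epsilon> *\<^sub>R norm (D t)) = \<epsilon> * ?N D"
    using Lp_scaleR[OF nD(1) q1(2), of \<epsilon>] nD(2) \<epsilon> by simp_all
  have cL: "(\<lambda>t. \<eta> * c) \<in> Lp_space q a b" "?N (\<lambda>t. \<eta> * c) \<le> \<eta> * c * (b - a) powr (1 / q)"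
    by (rule Lp_bounded; use q1 ab c0 \<eta> in \<open>auto intro: strongly_measurable_on_const\<close>)+
  have "?N (\<lambda>t. Q t (D t)) \<le> 1 * ?N (\<lambda>t. \<epsilon> *\<^sub>R norm (D t) + \<eta> * c)"
    by (rule Lp_dominated(2)[OF _ Lp_add(1)[OF eL(1) cL(1) q1(1)] q1(2) _ dom])
      (use Lp_space_measurable[OF bounded_op_fun_in_Lp[OF Q q1(2) L(2)]] in auto)
  also have "\<dots> \<le> \<epsilon> * ?N D + \<eta> * c * (b - a) powr (1 / q)"
    using Lp_add(2)[OF eL(1) cL(1) q1(1)] eL(2) cL(2) by simp
  also have "\<dots> \<le> \<epsilon> * (M * ?N f) + \<eta> * c * (b - a) powr (1 / q)"
    using M \<epsilon> by (intro add_right_mono mult_left_mono)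
  also have "c * (b - a) powr (1 / q) = (b - a) * ((1 + K * M) * ?N f)"
  proof -
    have "(b - a) powr (1 - 1 / q) * (b - a) powr (1 / q) = b - a"
      using ab by (simp add: powr_add[symmetric])
    then show ?thesis by (simp add: c_def mult_ac)
  qed
  then have "\<eta> * c * (b - a) powr (1 / q) = \<eta> * ((b - a) * ((1 + K * M) * ?N f))" by (simp only: mult.assoc)
  then have "\<epsilon> * (M * ?N f) + \<eta> * c * (b - a) powr (1 / q) = (\<epsilon> * M + \<eta> * (b - a) * (1 + K * M)) * ?N f"
    by (simp only:) (simp add: algebra_simps)
  finally show ?thesis .
qed

lemma well_posed_const:
  fixes j :: "'d::banach \<Rightarrow>\<^sub>L 'x::banach"
  assumes "inj (blinfun_apply j)" "MR_operator j T" "q > 1" "a < b"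
  shows "well_posed j q a b (\<lambda>_. T)"
  using assms unique_solvable_iff_well_posed[OF assms(1) bounded_op_fun_const assms(3,4), of T]
  by (auto simp: MR_operator_def maximal_Lp_regularity_def)

text \<open>Freezing the coefficients at \<open>t0\<close>: on short intervals near \<open>t0\<close> the difference \<open>A t - A t0\<close> is a small
  perturbation of \<open>A t0\<close>, whose a priori constant \<open>M\<close> is the same on all these intervals. The constants
  \<open>\<epsilon>\<close> and \<open>l\<close> make each of the two parts of the perturbation at most a quarter.\<close>
lemma well_posed_near_point:
  fixes j :: "'d::banach \<Rightarrow>\<^sub>L 'x::banach"
  assumes j: "inj (blinfun_apply j)" and A: "bounded_op_fun 0 \<tau> A" and q: "q > 1" and "0 < \<tau>"
    and t0: "t0 \<in> {0..\<tau>}" and MR: "MR_operator j (A t0)"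
    and \<omega>: "continuous_on {0..\<tau>} \<omega>" "\<omega> 0 = 0" and \<eta>: "\<eta> \<ge> 0"
    and le: "\<And>x t. t \<in> {0..\<tau>} \<Longrightarrow> norm (A t x - A t0 x) \<le> \<omega> \<bar>t - t0\<bar> * norm x + \<eta> * norm (j x)"
  shows "\<exists>r>0. \<forall>a b. 0 \<le> a \<and> a < b \<and> b \<le> \<tau> \<and> {a..b} \<subseteq> ball t0 r \<longrightarrow> well_posed j q a b A"
proof -
  let ?B = "\<lambda>_::real. A t0"
  have q1: "q \<ge> 1" "q > 0" using q by auto
  have wB: "well_posed j q a b ?B" if "a < b" for a b by (rule well_posed_const[OF j MR q that])
  obtain M where M: "M \<ge> 0" "\<And>a b f D. 0 \<le> a \<Longrightarrow> a < b \<Longrightarrow> b \<le> \<tau> \<Longrightarrow> f \<in> Lp_space q a b \<Longrightarrow>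
    D \<in> Lp_space q a b \<Longrightarrow> integral_solution j a b ?B f 0 D \<Longrightarrow> Lp_norm q a b D \<le> M * Lp_norm q a b f"
    using well_posed_uniformly_bounded[OF bounded_op_fun_const q \<open>0 < \<tau>\<close> wB] by metis
  define K where "K = norm (A t0)"
  have K: "K \<ge> 0" by (simp add: K_def)
  define \<epsilon> where "\<epsilon> = 1 / (4 * (M + 1))"
  have \<epsilon>: "\<epsilon> > 0" "\<epsilon> * M \<le> 1 / 4" using M(1) by (auto simp: \<epsilon>_def field_simps)
  define l where "l = 1 / (4 * (\<eta> + 1) * (1 + K * M))"
  have KM: "1 + K * M > 0" using K M(1) by (simp add: add_pos_nonneg)
  have l: "l > 0" using KM \<eta> by (simp add: l_def)
  have l2: "\<eta> * l * (1 + K * M) \<le> 1 / 4"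
  proof -
    have "\<eta> * l * (1 + K * M) = \<eta> / (4 * (\<eta> + 1))" using KM by (simp add: l_def)
    also have "\<dots> \<le> 1 / 4" using \<eta> by (simp add: field_simps)
    finally show ?thesis .
  qed
  obtain r0 where r0: "r0 > 0" "\<And>x. x \<in> {0..\<tau>} \<Longrightarrow> \<bar>x\<bar> < r0 \<Longrightarrow> \<bar>\<omega> x\<bar> < \<epsilon>"
    using \<omega> \<open>0 < \<tau>\<close> \<epsilon>(1) unfolding continuous_on_iff dist_real_def
    by (metis atLeastAtMost_iff diff_zero less_imp_le order_refl)
  define r where "r = min r0 (l / 2)"
  have "r > 0" using r0 l by (simp add: r_def)
  moreover have "well_posed j q a b A" if ab: "0 \<le> a" "a < b" "b \<le> \<tau>" "{a..b} \<subseteq> ball t0 r" for a b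
  proof -
    have near: "\<bar>t - t0\<bar> < r" if "t \<in> {a..b}" for t
      using ab(4) that by (auto simp: dist_real_def abs_minus_commute)
    have "r \<le> l / 2" by (simp add: r_def)
    then have "b - a \<le> l" using near[of a] near[of b] ab(2) by (auto simp: abs_less_iff)
    have Q: "bounded_op_fun a b (\<lambda>t. A t + - A t0)"
      by (intro bounded_op_fun_add bounded_op_fun_const bounded_op_fun_mono[OF A] ab)
    have "well_posed j q a b (\<lambda>t. ?B t + (A t + - A t0))"
    proof (rule well_posed_perturb[OF wB[OF ab(2)] bounded_op_fun_const Q q ab(2), of "1/2"])
      fix f D assume L: "f \<in> Lp_space q a b" "D \<in> Lp_space q a b" and s: "integral_solution j a b ?B f 0 D"
      have Kle: "Lp_norm q a b (\<lambda>t. ?B t (D t)) \<le> K * Lp_norm q a b D"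
        unfolding K_def by (rule Lp_blinfun_const(2)[OF L(2) q1(2)])
      have Qle: "norm ((A t + - A t0) x) \<le> \<epsilon> * norm x + \<eta> * norm (j x)" if t: "t \<in> {a..b}" for t x
      proof -
        have "\<bar>t - t0\<bar> \<in> {0..\<tau>}" using t t0 ab by auto
        then have "\<omega> \<bar>t - t0\<bar> \<le> \<epsilon>" using r0(2)[of "\<bar>t - t0\<bar>"] near[OF t] by (simp add: r_def)
        then have "\<omega> \<bar>t - t0\<bar> * norm x \<le> \<epsilon> * norm x" by (rule mult_right_mono) simp
        moreover have "t \<in> {0..\<tau>}" using t ab by auto
        ultimately show ?thesis using le[of t x] by (simp add: blinfun.diff_left)
      qed
      have "Lp_norm q a b (\<lambda>t. (A t + - A t0) (D t)) \<le> (\<epsilon> * M + \<eta> * (b - a) * (1 + K * M)) * Lp_norm q a b f"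
        by (rule frozen_perturbation_bound[OF bounded_op_fun_const Q q ab(2) M(2)[OF ab(1-3) L s] Kle K L s _ \<eta> Qle])
          (use \<epsilon> in auto)
      also have "\<dots> \<le> (1 / 2) * Lp_norm q a b f"
      proof (rule mult_right_mono)
        have "\<eta> * (b - a) * (1 + K * M) \<le> \<eta> * l * (1 + K * M)"
          using \<open>b - a \<le> l\<close> \<eta> KM by (intro mult_right_mono mult_left_mono) auto
        then show "\<epsilon> * M + \<eta> * (b - a) * (1 + K * M) \<le> 1 / 2" using l2 \<epsilon>(2) by linarith
      qed simp
      finally show "Lp_norm q a b (\<lambda>t. (A t + - A t0) (D t)) \<le> (1 / 2) * Lp_norm q a b f" .
    qed auto
    then show ?thesis by simp
  qed
  ultimately show ?thesis by blast
qed

text \<open>The neighbourhoods obtained by freezing cover the compact interval; a Lebesgue number of the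
  cover is a length that works everywhere.\<close>
lemma well_posed_short:
  fixes j :: "'d::banach \<Rightarrow>\<^sub>L 'x::banach"
  assumes j: "inj (blinfun_apply j)" and A: "bounded_op_fun 0 \<tau> A" and q: "q > 1" and "0 < \<tau>"
    and MR: "\<And>t. t \<in> {0..\<tau>} \<Longrightarrow> MR_operator j (A t)" and Dini: "relative_Dini j \<nu> \<tau> A"
  obtains \<delta> where "\<delta> > 0" "\<And>a b. 0 \<le> a \<Longrightarrow> a < b \<Longrightarrow> b \<le> \<tau> \<Longrightarrow> b - a \<le> \<delta> \<Longrightarrow> well_posed j q a b A"
proof -
  obtain \<eta> \<omega> where \<eta>: "\<eta> \<ge> 0" and \<omega>: "continuous_on {0..\<tau>} \<omega>" "\<omega> 0 = (0::real)"
    and le: "\<And>x s t. s \<in> {0..\<tau>} \<Longrightarrow> t \<in> {0..\<tau>} \<Longrightarrow>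
      norm (A t x - A s x) \<le> \<omega> \<bar>t - s\<bar> * norm x + \<eta> * norm (j x)"
    using Dini unfolding relative_Dini_def by blast
  have "\<forall>t0\<in>{0..\<tau>}. \<exists>r>0. \<forall>a b. 0 \<le> a \<and> a < b \<and> b \<le> \<tau> \<and> {a..b} \<subseteq> ball t0 r \<longrightarrow> well_posed j q a b A"
    using well_posed_near_point[OF j A q \<open>0 < \<tau>\<close> _ MR \<omega> \<eta> le] by blast
  then obtain r where r: "\<And>t0. t0 \<in> {0..\<tau>} \<Longrightarrow> r t0 > 0"
    "\<And>t0 a b. t0 \<in> {0..\<tau>} \<Longrightarrow> 0 \<le> a \<Longrightarrow> a < b \<Longrightarrow> b \<le> \<tau> \<Longrightarrow> {a..b} \<subseteq> ball t0 (r t0) \<Longrightarrow> well_posed j q a b A"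
    by metis
  define C where "C = (\<lambda>t0. ball t0 (r t0)) ` {0..\<tau>}"
  have "{0..\<tau>} \<subseteq> \<Union> C" using r(1) by (force simp: C_def)
  moreover have "C \<noteq> {}" using \<open>0 < \<tau>\<close> by (auto simp: C_def)
  moreover have "\<And>V. V \<in> C \<Longrightarrow> open V" by (auto simp: C_def)
  ultimately obtain \<delta> where \<delta>: "\<delta> > 0" "\<And>T. T \<subseteq> {0..\<tau>} \<Longrightarrow> diameter T < \<delta> \<Longrightarrow> \<exists>V\<in>C. T \<subseteq> V"
    using Lebesgue_number_lemma[OF compact_Icc, of C 0 \<tau>] by metis
  show thesis
  proof (rule that[of "\<delta> / 2"])
    fix a b assume ab: "0 \<le> a" "a < b" "b \<le> \<tau>" "b - a \<le> \<delta> / 2"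
    have "diameter {a..b} = b - a" using ab by simp
    then obtain V where "V \<in> C" "{a..b} \<subseteq> V" using \<delta>(2)[of "{a..b}"] \<delta>(1) ab by auto
    then show "well_posed j q a b A" using r(2) ab by (auto simp: C_def)
  qed (use \<delta> in auto)
qed

lemma AE_interval_point:
  assumes "AE t in lebesgue_on {a..b::real}. Q t" "a \<le> c" "c < d" "d \<le> b"
  shows "\<exists>m\<in>{c<..<d}. Q m"
proof (rule ccontr)
  assume "\<not> ?thesis"
  then have "{c<..<d} \<subseteq> {t\<in>{a..b}. \<not> Q t}" using assms by auto
  moreover have "negligible {t\<in>{a..b}. \<not> Q t}"
    using assms(1) by (subst (asm) AE_lebesgue_on_iff_negligible) auto
  ultimately have "negligible {c<..<d}" by (rule negligible_subset[rotated])
  then show False using negligible_interval(2)[of c d] assms(3) by (simp add: box_real)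
qed

text \<open>From short intervals to long ones. A solution on \<open>[a,b']\<close> is continued from a point \<open>m\<close> by the sum of
  a solution \<open>E\<close> of the equation for \<open>A\<close> without right-hand side, started at the value in \<open>m\<close>, and a
  solution \<open>W\<close> for the remaining right-hand side, started at zero. As almost all values of a solution
  lie in \<open>D\<close>, the point \<open>m\<close> can be chosen such that \<open>E\<close> needs to start at elements of \<open>D\<close> only; this avoids
  the trace space. Moving the breaking point in this way costs half of \<open>\<delta>\<close>.\<close>
lemma well_posed_concat:
  fixes j :: "'d::banach \<Rightarrow>\<^sub>L 'x::banach"
  assumes A: "bounded_op_fun 0 \<tau> A" and Q: "bounded_op_fun 0 \<tau> Q" and q: "q > 1" and \<delta>: "\<delta> > 0"
    and short: "\<And>a b. 0 \<le> a \<Longrightarrow> a < b \<Longrightarrow> b \<le> \<tau> \<Longrightarrow> b - a \<le> \<delta> \<Longrightarrow> well_posed j q a b (\<lambda>t. A t + Q t)"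
    and hom: "\<And>m d. 0 \<le> m \<Longrightarrow> m < \<tau> \<Longrightarrow> \<exists>E\<in>Lp_space q m \<tau>. integral_solution j m \<tau> A (\<lambda>_. 0) (j d) E"
    and ab: "0 \<le> a" "a < b" "b \<le> \<tau>"
  shows "well_posed j q a b (\<lambda>t. A t + Q t)"
proof -
  let ?C = "\<lambda>t. A t + Q t"
  have q1: "q \<ge> 1" "q > 0" using q by auto
  have C: "bounded_op_fun 0 \<tau> ?C" by (intro bounded_op_fun_add A Q)
  have "\<forall>a b. 0 \<le> a \<and> a < b \<and> b \<le> \<tau> \<and> b - a \<le> real n * (\<delta> / 2) \<longrightarrow> well_posed j q a b ?C" for n
  proof (induction n)
    case (Suc n)
    show ?case
    proof (intro allI impI)
      fix a b assume ab: "0 \<le> a \<and> a < b \<and> b \<le> \<tau> \<and> b - a \<le> real (Suc n) * (\<delta> / 2)"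
      show "well_posed j q a b ?C"
      proof (cases "b - a \<le> \<delta>")
        case True
        then show ?thesis using short ab by blast
      next
        case False
        define b' where "b' = b - \<delta> / 2"
        have b': "a < b' - \<delta> / 2" "b' < b" "b - b' \<le> \<delta>" using False \<delta> by (auto simp: b'_def)
        have "b' - a \<le> real n * (\<delta> / 2)" using ab by (simp add: b'_def algebra_simps)
        then have w: "well_posed j q a b' ?C" using Suc ab b' \<delta> by simp
        have Cab: "bounded_op_fun a b ?C" by (rule bounded_op_fun_mono[OF C]) (use ab in auto)
        show ?thesis
          unfolding well_posed_def
        proof (intro conjI ballI impI)
          fix f :: "real \<Rightarrow> 'x" assume f: "f \<in> Lp_space q a b"
          have f1: "f \<in> Lp_space q a b'" by (rule Lp_mono_interval(1)[OF f]) (use b' in auto)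
          obtain D where D: "D \<in> Lp_space q a b'" "integral_solution j a b' ?C f 0 D"
            using w f1 by (auto simp: well_posed_def)
          obtain m where m: "m \<in> {b' - \<delta> / 2<..<b'}" "j (D m) = 0 + integral {a..m} (resid ?C f D)"
            using AE_interval_point[OF D(2)[unfolded integral_solution_def], of "b' - \<delta> / 2" b'] b' \<delta> by auto
          have mab: "0 \<le> m" "a \<le> m" "m < b" "m < \<tau>" "b - m \<le> \<delta>" "m \<le> b'"
            using m(1) b' ab \<delta> by (auto simp: b'_def)
          obtain E where E: "E \<in> Lp_space q m \<tau>" "integral_solution j m \<tau> A (\<lambda>_. 0) (j (D m)) E"
            using hom mab by blast
          have E': "E \<in> Lp_space q m b" by (rule Lp_mono_interval(1)[OF E(1)]) (use ab in auto)
          have Cmb: "bounded_op_fun m b ?C" and Qmb: "bounded_op_fun m b Q"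
            using bounded_op_fun_mono[OF C, of m b] bounded_op_fun_mono[OF Q, of m b] ab mab by auto
          have QE: "(\<lambda>t. Q t (E t)) \<in> Lp_space q m b" by (rule bounded_op_fun_in_Lp[OF Qmb q1(2) E'])
          have fm: "f \<in> Lp_space q m b" by (rule Lp_mono_interval(1)[OF f]) (use mab in auto)
          have "integral_solution j m b A (\<lambda>_. 0) (j (D m)) E"
            by (rule integral_solution_restrict[OF E(2)]) (use ab in auto)
          then have sE: "integral_solution j m b ?C (\<lambda>t. Q t (E t)) (j (D m)) E"
            by (rule integral_solution_AE_cong) (auto simp: resid_def blinfun.add_left)
          have r: "(\<lambda>t. f t - Q t (E t)) \<in> Lp_space q m b" by (rule Lp_diff(1)[OF fm QE q1(1)])
          then obtain W where W: "W \<in> Lp_space q m b" "integral_solution j m b ?C (\<lambda>t. f t - Q t (E t)) 0 W"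
            using short[of m b] mab ab by (auto simp: well_posed_def)
          have EW: "(\<lambda>t. E t + W t) \<in> Lp_space q m b" by (rule Lp_add(1)[OF E' W(1) q1(1)])
          have sEW: "integral_solution j m b ?C f (0 + integral {a..m} (resid ?C f D)) (\<lambda>t. E t + W t)"
            using integral_solution_add[OF Cmb q QE E' r W(1) sE W(2)] m(2) by simp
          have Dm: "D \<in> Lp_space q a m" "integral_solution j a m ?C f 0 D"
            using Lp_mono_interval(1)[OF D(1), of a m] integral_solution_restrict[OF D(2), of m] mab by auto
          show "\<exists>D\<in>Lp_space q a b. integral_solution j a b ?C f 0 D"
            using integral_solution_concat[OF Cab q mab(2) _ f Dm(1) EW Dm(2) sEW] mab by auto
        next
          fix D assume D: "D \<in> Lp_space q a b" "integral_solution j a b ?C (\<lambda>_. 0) 0 D"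
          have "D \<in> Lp_space q a b'" "integral_solution j a b' ?C (\<lambda>_. 0) 0 D"
            using Lp_mono_interval(1)[OF D(1), of a b'] integral_solution_restrict[OF D(2), of b'] b' by auto
          then have z: "AE t in lebesgue_on {a..b'}. D t = 0" using w by (auto simp: well_posed_def)
          then have "AE t in lebesgue_on {a..b'}. resid ?C (\<lambda>_. 0) D t = 0"
            by eventually_elim (simp add: resid_def blinfun.zero_right)
          then have "integral {a..b'} (resid ?C (\<lambda>_. 0) D) = 0"
            using integral_AE_cong[where f = "resid ?C (\<lambda>_. 0) D" and g = "\<lambda>_. 0" and a = a and b = b'] by simp
          then have "integral_solution j b' b ?C (\<lambda>_. 0) 0 D"
            using integral_solution_tail[OF Cab q Lp_zero(1) D(1) D(2), of b'] b' \<delta> by simp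
          moreover have "D \<in> Lp_space q b' b" by (rule Lp_mono_interval(1)[OF D(1)]) (use b' \<delta> in auto)
          moreover have "well_posed j q b' b ?C" using short[of b' b] b' ab \<delta> by auto
          ultimately have z2: "AE t in lebesgue_on {b'..b}. D t = 0" by (auto simp: well_posed_def)
          have "{a..b} \<subseteq> {a..b'} \<union> {b'..b}" by force
          then show "AE t in lebesgue_on {a..b}. D t = 0" using AE_lebesgue_on_Un[OF z z2] by simp
        qed
      qed
    qed
  qed auto
  moreover obtain n :: nat where "(b - a) / (\<delta> / 2) \<le> n" using real_arch_simple by blast
  then have "b - a \<le> real n * (\<delta> / 2)" using \<delta> by (simp add: field_simps)
  ultimately show ?thesis using ab by blast
qed

lemma range_in_trace_space:
  fixes j :: "'d::banach \<Rightarrow>\<^sub>L 'x::banach"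
  assumes j: "inj (blinfun_apply j)" and q: "q > 1" and "0 < \<tau>"
  shows "j d \<in> trace_space j q 0 \<tau>"
proof -
  have "(\<lambda>_. j d) \<in> Lp_space q 0 \<tau>" "(\<lambda>_. d) \<in> Lp_space q 0 \<tau>"
    using q \<open>0 < \<tau>\<close> by (auto intro!: continuous_imp_Lp)
  moreover have "has_weak_derivative_on 0 \<tau> (\<lambda>_. j d) (\<lambda>_. 0)"
    by (simp add: has_weak_derivative_on_def)
  ultimately have "(\<lambda>_. j d) \<in> MR_space j q 0 \<tau>"
    using Lp_zero(1)[of q 0 \<tau>] by (auto simp: MR_space_def W1p_space_def to_D_j[OF j] in_D_def)
  then show ?thesis unfolding trace_space_def by (intro CollectI exI[of _ "\<lambda>_. j d"]) simp
qed

lemma evolution_family_solution: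
  fixes j :: "'d::banach \<Rightarrow>\<^sub>L 'x::banach" and d :: 'd
  assumes j: "inj (blinfun_apply j)" and q: "q > 1" and "0 < \<tau>"
    and U: "associated_evolution_family j \<tau> A U" and s: "0 \<le> s" "s < \<tau>"
  defines "E \<equiv> \<lambda>t. to_D j (U t s (j d))"
  shows "E \<in> Lp_space q s \<tau>" "integral_solution j s \<tau> A (\<lambda>_. 0) (j d) E"
    "\<And>t. t \<in> {s..\<tau>} \<Longrightarrow> U t s (j d) = j d + integral {s..t} (resid A (\<lambda>_. 0) E)"
proof -
  have "MR_solution j q s \<tau> A (\<lambda>_. 0) (j d) (\<lambda>t. U t s (j d))"
    using U q s range_in_trace_space[OF j q \<open>0 < \<tau>\<close>, of d]
    by (auto simp: associated_evolution_family_def unique_MR_solution_def)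
  from MR_solution_imp_integral_solution[OF this s(2)]
  show "E \<in> Lp_space q s \<tau>" "integral_solution j s \<tau> A (\<lambda>_. 0) (j d) E"
    "\<And>t. t \<in> {s..\<tau>} \<Longrightarrow> U t s (j d) = j d + integral {s..t} (resid A (\<lambda>_. 0) E)"
    by (simp_all add: E_def)
qed

section \<open>The evolution family and its ramps\<close>

lemma continuous_on_integral_Lp:
  fixes v :: "real \<Rightarrow> 'x::banach"
  assumes "v \<in> Lp_space q s b" "q > 1"
  shows "continuous_on {s..b} (\<lambda>t. x + integral {s..t} v)"
  by (intro continuous_intros indefinite_integral_continuous_1 Lp_integrable_on_sub[OF assms]) auto

lemma Lp_linear_weight:
  fixes v :: "real \<Rightarrow> 'x::banach"
  assumes v: "v \<in> Lp_space q s b" and q: "q > 1" and "s < b"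
  shows "(\<lambda>r. (r - s) *\<^sub>R v r) \<in> Lp_space q s b"
    "Lp_norm q s b (\<lambda>r. (r - s) *\<^sub>R v r) \<le> (b - s) * Lp_norm q s b v"
proof -
  have sm: "strongly_measurable_on {s..b} (\<lambda>r. (r - s) *\<^sub>R v r)"
    by (intro strongly_measurable_on_scaleR Lp_space_measurable[OF v] continuous_imp_strongly_measurable_on continuous_intros)
  have le: "AE r in lebesgue_on {s..b}. norm ((r - s) *\<^sub>R v r) \<le> (b - s) * norm (v r)"
    by (intro AE_I2) (auto intro!: mult_right_mono)
  show "(\<lambda>r. (r - s) *\<^sub>R v r) \<in> Lp_space q s b"
    "Lp_norm q s b (\<lambda>r. (r - s) *\<^sub>R v r) \<le> (b - s) * Lp_norm q s b v"
    using Lp_dominated[OF sm v _ _ le] q \<open>s < b\<close> by simp_all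
qed

text \<open>The product rule \<open>((r - s) u)' = u + (r - s) u'\<close>. For continuous \<open>v\<close> it is the fundamental theorem of
  calculus; both sides depend continuously on \<open>v\<close> in \<open>L\<^sup>q\<close>.\<close>
lemma has_integral_product_rule:
  fixes v :: "real \<Rightarrow> 'x::banach" and x :: 'x
  assumes v: "v \<in> Lp_space q s b" and q: "q > 1" and sb: "s < b"
  defines "u \<equiv> \<lambda>t. x + integral {s..t} v"
  shows "((\<lambda>r. u r + (r - s) *\<^sub>R v r) has_integral (b - s) *\<^sub>R u b) {s..b}"
proof -
  let ?N = "Lp_norm q s b"
  have q1: "q \<ge> 1" "q > 0" using q by auto
  obtain w where w: "\<And>n. continuous_on {s..b} (w n)" and wL: "\<And>n. w n \<in> Lp_space q s b"
    and "\<And>n. ?N (\<lambda>t. v t - w n t) < inverse (Suc n)"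
    and lim: "(\<lambda>n. ?N (\<lambda>t. v t - w n t)) \<longlonglongrightarrow> 0"
    using Lp_continuous_sequence[OF v q sb] by blast
  define U where "U n t = x + integral {s..t} (w n)" for n t
  have Uc: "continuous_on {s..b} (U n)" for n unfolding U_def by (rule continuous_on_integral_Lp[OF wL q])
  have uc: "continuous_on {s..b} u" unfolding u_def by (rule continuous_on_integral_Lp[OF v q])
  have UL: "U n \<in> Lp_space q s b" and uL: "u \<in> Lp_space q s b" for n
    using Uc uc q sb by (auto intro: continuous_imp_Lp)
  show ?thesis
  proof (rule Lp_limit_has_integral[OF q sb, where f = "\<lambda>n r. U n r + (r - s) *\<^sub>R w n r"])
    show "(\<lambda>r. U n r + (r - s) *\<^sub>R w n r) \<in> Lp_space q s b" for n
      by (intro Lp_add Lp_linear_weight UL wL q sb q1)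
    show "(\<lambda>r. u r + (r - s) *\<^sub>R v r) \<in> Lp_space q s b"
      by (intro Lp_add Lp_linear_weight uL v q sb q1)
    show "((\<lambda>r. U n r + (r - s) *\<^sub>R w n r) has_integral (b - s) *\<^sub>R U n b) {s..b}" for n
    proof -
      have "((\<lambda>r. U n r + (r - s) *\<^sub>R w n r) has_integral (b - s) *\<^sub>R U n b - (s - s) *\<^sub>R U n s) {s..b}"
      proof (rule fundamental_theorem_of_calculus)
        fix r assume r: "r \<in> {s..b}"
        have "((\<lambda>t. integral {s..t} (w n)) has_vector_derivative w n r) (at r within {s..b})"
          by (rule integral_has_vector_derivative[OF w r])
        then have "(U n has_vector_derivative w n r) (at r within {s..b})"
          unfolding U_def by (auto intro!: derivative_eq_intros)
        moreover have "((\<lambda>r. r - s) has_real_derivative 1) (at r within {s..b})"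
          by (auto intro!: derivative_eq_intros)
        ultimately have "((\<lambda>r. (r - s) *\<^sub>R U n r) has_vector_derivative (r - s) *\<^sub>R w n r + 1 *\<^sub>R U n r) (at r within {s..b})"
          by (rule has_vector_derivative_scaleR[rotated])
        then show "((\<lambda>r. (r - s) *\<^sub>R U n r) has_vector_derivative U n r + (r - s) *\<^sub>R w n r) (at r within {s..b})"
          by (simp add: add.commute)
      qed (use sb in auto)
      then show ?thesis by simp
    qed
    show "(\<lambda>n. (b - s) *\<^sub>R U n b) \<longlonglongrightarrow> (b - s) *\<^sub>R u b"
      unfolding U_def u_def using sb by (intro tendsto_intros Lp_limit_integral[OF q sb wL v lim]) auto
    define c where "c = (b - s) powr (1 - 1 / q)"
    show "(\<lambda>n. ?N (\<lambda>t. (u t + (t - s) *\<^sub>R v t) - (U n t + (t - s) *\<^sub>R w n t))) \<longlonglongrightarrow> 0"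
    proof (rule tendsto_sandwich[OF _ _ tendsto_const])
      show "\<forall>\<^sub>F n in sequentially. ?N (\<lambda>t. (u t + (t - s) *\<^sub>R v t) - (U n t + (t - s) *\<^sub>R w n t))
         \<le> (c * (b - s) powr (1 / q) + (b - s)) * ?N (\<lambda>t. v t - w n t)"
      proof (intro always_eventually allI)
        fix n
        have dL: "(\<lambda>t. v t - w n t) \<in> Lp_space q s b" by (rule Lp_diff(1)[OF v wL q1(1)])
        have udL: "(\<lambda>t. u t - U n t) \<in> Lp_space q s b" by (rule Lp_diff(1)[OF uL UL q1(1)])
        have "norm (u t - U n t) \<le> c * ?N (\<lambda>t. v t - w n t)" if t: "t \<in> {s..b}" for t
        proof -
          have "u t - U n t = integral {s..t} (\<lambda>r. v r - w n r)"
            unfolding u_def U_def using t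
            by (simp add: Henstock_Kurzweil_Integration.integral_diff Lp_integrable_on_sub[OF v q] Lp_integrable_on_sub[OF wL q])
          then show ?thesis unfolding c_def using Lp_integral_norm_le[OF dL q t sb] by simp
        qed
        then have "?N (\<lambda>t. u t - U n t) \<le> c * ?N (\<lambda>t. v t - w n t) * (b - s) powr (1 / q)"
          using sb q1 by (intro Lp_bounded(2) Lp_space_measurable[OF udL]) (auto intro!: AE_I2 simp: c_def)
        moreover have "?N (\<lambda>t. (t - s) *\<^sub>R (v t - w n t)) \<le> (b - s) * ?N (\<lambda>t. v t - w n t)"
          by (rule Lp_linear_weight(2)[OF dL q sb])
        moreover have "?N (\<lambda>t. (u t - U n t) + (t - s) *\<^sub>R (v t - w n t))
           \<le> ?N (\<lambda>t. u t - U n t) + ?N (\<lambda>t. (t - s) *\<^sub>R (v t - w n t))"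
          by (rule Lp_add(2)[OF udL Lp_linear_weight(1)[OF dL q sb] q1(1)])
        moreover have "(\<lambda>t. (u t + (t - s) *\<^sub>R v t) - (U n t + (t - s) *\<^sub>R w n t)) = (\<lambda>t. (u t - U n t) + (t - s) *\<^sub>R (v t - w n t))"
          by (auto simp: algebra_simps)
        ultimately show "?N (\<lambda>t. (u t + (t - s) *\<^sub>R v t) - (U n t + (t - s) *\<^sub>R w n t))
         \<le> (c * (b - s) powr (1 / q) + (b - s)) * ?N (\<lambda>t. v t - w n t)"
          by (simp add: algebra_simps)
      qed
      show "(\<lambda>n. (c * (b - s) powr (1 / q) + (b - s)) * ?N (\<lambda>t. v t - w n t)) \<longlonglongrightarrow> 0"
        using tendsto_mult_left[OF lim] by simp
    qed simp
  qed
qed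

text \<open>Switching a solution of the equation without right-hand side on linearly during \<open>[s,s + h]\<close>, and
  keeping it afterwards, produces the right-hand side \<open>u\<close> on \<open>[s,s + h]\<close> and zero later. Sums of such
  solutions are exact solutions that look like Riemann sums of the variation of constants formula.\<close>
lemma ramp_solution:
  fixes j :: "'d::banach \<Rightarrow>\<^sub>L 'x::banach" and x :: 'x
  assumes A: "bounded_op_fun s b A" and q: "q > 1" and h: "h > 0" "s + h \<le> b"
    and E: "E \<in> Lp_space q s b" and sol: "integral_solution j s b A (\<lambda>_. 0) x E"
  defines "u \<equiv> \<lambda>t. x + integral {s..t} (resid A (\<lambda>_. 0) E)"
  shows "(\<lambda>t. min h (t - s) *\<^sub>R E t) \<in> Lp_space q s b"
    "(\<lambda>t. if t \<in> {s..s + h} then u t else 0) \<in> Lp_space q s b"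
    "integral_solution j s b A (\<lambda>t. if t \<in> {s..s + h} then u t else 0) 0 (\<lambda>t. min h (t - s) *\<^sub>R E t)"
proof -
  have q1: "q \<ge> 1" "q > 0" and sb: "s < b" using q h by auto
  define v where "v = resid A (\<lambda>_. 0) E"
  define f where "f t = (if t \<in> {s..s + h} then u t else 0)" for t
  define F where "F t = min h (t - s) *\<^sub>R E t" for t
  have vL: "v \<in> Lp_space q s b" unfolding v_def by (rule resid_Lp[OF A q Lp_zero(1) E])
  have sm: "strongly_measurable_on {s..b} F" unfolding F_def
    by (intro strongly_measurable_on_scaleR Lp_space_measurable[OF E] continuous_imp_strongly_measurable_on continuous_intros)
  have "AE t in lebesgue_on {s..b}. norm (F t) \<le> h * norm (E t)"
    unfolding F_def using h(1) by (intro AE_I2) (auto intro!: mult_right_mono)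
  from Lp_dominated(1)[OF sm E q1(2) _ this] have FL: "F \<in> Lp_space q s b" using h by simp
  have "continuous_on {s..s + h} u" unfolding u_def v_def[symmetric]
    by (rule continuous_on_integral_Lp[OF Lp_mono_interval(1)[OF vL] q]) (use h in auto)
  then have "u \<in> Lp_space q s (s + h)" using h q1 by (intro continuous_imp_Lp) auto
  then have fL: "f \<in> Lp_space q s b" unfolding f_def[abs_def] by (rule Lp_zero_extend(1)) (use h in auto)
  have low: "(resid A f F has_integral (t - s) *\<^sub>R u t) {s..t}" if t: "s \<le> t" "t \<le> s + h" for t
  proof (cases "s < t")
    case True
    have "v \<in> Lp_space q s t" by (rule Lp_mono_interval(1)[OF vL]) (use t h in auto)
    from has_integral_product_rule[OF this q True, of x]
    have "((\<lambda>r. u r + (r - s) *\<^sub>R v r) has_integral (t - s) *\<^sub>R u t) {s..t}" by (simp add: u_def v_def)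
    then show ?thesis
      by (rule has_integral_eq[rotated])
        (use t in \<open>auto simp: resid_def f_def F_def v_def blinfun.scaleR_right\<close>)
  next
    case False
    then show ?thesis using t has_integral_refl(2)[of "resid A f F" s] by simp
  qed
  have main: "integral {s..t} (resid A f F) = min h (t - s) *\<^sub>R u t" if t: "t \<in> {s..b}" for t
  proof (cases "t \<le> s + h")
    case True
    then show ?thesis using low[of t] t by (simp add: integral_unique min_def)
  next
    case False
    have "integral {s..s + h} (resid A f F) + integral {s + h..t} (resid A f F) = integral {s..t} (resid A f F)"
      using t False h by (intro Henstock_Kurzweil_Integration.integral_combine resid_integrable[OF A q fL FL]) auto
    moreover have "integral {s..s + h} (resid A f F) = h *\<^sub>R u (s + h)"
      using low[of "s + h"] h by (simp add: integral_unique)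
    moreover have "integral {s + h..t} (resid A f F) = integral {s + h..t} (\<lambda>r. h *\<^sub>R v r)"
      by (rule integral_spike[OF negligible_sing[of "s + h"]])
        (auto simp: resid_def f_def F_def v_def blinfun.scaleR_right)
    moreover have "integral {s + h..t} (\<lambda>r. h *\<^sub>R v r) = h *\<^sub>R integral {s + h..t} v" by simp
    moreover have "integral {s..s + h} v + integral {s + h..t} v = integral {s..t} v"
      using t False h by (intro Henstock_Kurzweil_Integration.integral_combine Lp_integrable_on_sub[OF vL q]) auto
    ultimately show ?thesis using False
      by (simp add: u_def v_def[symmetric] min_def scaleR_add_right[symmetric] add.assoc)
  qed
  have "integral_solution j s b A f 0 F"
    unfolding integral_solution_def using sol[unfolded integral_solution_def] AE_lebesgue_on_mem
  proof eventually_elim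
    case (elim t)
    then show ?case using main[OF elim(2)] by (simp add: F_def blinfun.scaleR_right u_def)
  qed
  then show "(\<lambda>t. min h (t - s) *\<^sub>R E t) \<in> Lp_space q s b"
    "(\<lambda>t. if t \<in> {s..s + h} then u t else 0) \<in> Lp_space q s b"
    "integral_solution j s b A (\<lambda>t. if t \<in> {s..s + h} then u t else 0) 0 (\<lambda>t. min h (t - s) *\<^sub>R E t)"
    using FL fL by (simp_all add: F_def[abs_def] f_def[abs_def])
qed

text \<open>Hoelder's inequality on an interval, from the case of the exponents \<open>1\<close> and \<open>\<mu> / q\<close> for \<open>\<parallel>f\<parallel> powr q\<close>.\<close>
lemma Lp_exponent_mono:
  fixes f :: "real \<Rightarrow> 'b::real_normed_vector"
  assumes f: "f \<in> Lp_space \<mu> a b" and q: "1 < q" "q \<le> \<mu>" and ab: "a < b"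
  shows "f \<in> Lp_space q a b" "Lp_norm q a b f \<le> (b - a) powr (1 / q - 1 / \<mu>) * Lp_norm \<mu> a b f"
proof -
  have "f \<in> Lp_space q a b \<and> Lp_norm q a b f \<le> (b - a) powr (1 / q - 1 / \<mu>) * Lp_norm \<mu> a b f"
  proof (cases "q = \<mu>")
    case True
    then show ?thesis using f ab by simp
  next
    case False
    define g where "g t = norm (f t) powr q" for t
    have [measurable]: "(\<lambda>t. norm (f t)) \<in> borel_measurable (lebesgue_on {a..b})"
      by (rule strongly_measurable_on_norm_borel[OF Lp_space_measurable[OF f]])
    have "g \<in> borel_measurable (lebesgue_on {a..b})" unfolding g_def by measurable
    then have gm: "strongly_measurable_on {a..b} g" by (rule strongly_measurable_on_real) simp
    have e: "\<bar>g t\<bar> powr (\<mu> / q) = norm (f t) powr \<mu>" for t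
      using q by (simp add: g_def powr_powr)
    have gL: "g \<in> Lp_space (\<mu> / q) a b"
      using gm Lp_space_integrable[OF f] by (simp add: Lp_space_def e)
    have r: "\<mu> / q > 1" using q False by (simp add: field_simps)
    note i = Lp_norm_1_le[OF gL r ab]
    have fq: "f \<in> Lp_space q a b"
      using i(1) Lp_space_measurable[OF f] by (simp add: Lp_space_def g_def)
    have "Lp_norm q a b f = (LINT t|lebesgue_on {a..b}. norm (g t)) powr (1 / q)"
      by (simp add: Lp_norm_def g_def)
    also have "\<dots> \<le> ((b - a) powr (1 - 1 / (\<mu> / q)) * Lp_norm (\<mu> / q) a b g) powr (1 / q)"
      using i(2) q by (intro powr_mono2) (auto intro!: Bochner_Integration.integral_nonneg)
    also have "Lp_norm (\<mu> / q) a b g = Lp_norm \<mu> a b f powr q"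
      using q by (simp add: Lp_norm_def e powr_powr)
    also have "((b - a) powr (1 - 1 / (\<mu> / q)) * Lp_norm \<mu> a b f powr q) powr (1 / q)
        = (b - a) powr ((1 - 1 / (\<mu> / q)) * (1 / q)) * Lp_norm \<mu> a b f"
      using q by (simp add: powr_mult powr_powr)
    also have "(1 - 1 / (\<mu> / q)) * (1 / q) = 1 / q - 1 / \<mu>" using q by (simp add: field_simps)
    finally show ?thesis using fq by simp
  qed
  then show "f \<in> Lp_space q a b" "Lp_norm q a b f \<le> (b - a) powr (1 / q - 1 / \<mu>) * Lp_norm \<mu> a b f" by auto
qed

lemma Lp_norm_le_of_subintervals:
  fixes f :: "real \<Rightarrow> 'b::real_normed_vector"
  assumes f: "f \<in> Lp_space p s b" and p: "p > 0" and sb: "s < b"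
    and le: "\<And>t. s < t \<Longrightarrow> t < b \<Longrightarrow> Lp_norm p s t f \<le> C"
  shows "Lp_norm p s b f \<le> C"
proof -
  \<comment> \<open>Points inside the interval that increase to \<open>b\<close>.\<close>
  define T where "T n = b - (b - s) / 2 * inverse (real (Suc n))" for n :: nat
  have T: "s < T n" "T n < b" for n
  proof -
    define z where "z = (b - s) / 2 * inverse (real (Suc n))"
    have "z \<le> (b - s) / 2 * 1"
      unfolding z_def using sb by (intro mult_left_mono) (auto simp: inverse_le_1_iff)
    then show "s < T n" unfolding T_def z_def[symmetric] using sb by simp
    show "T n < b" using sb by (simp add: T_def)
  qed
  have fT: "f \<in> Lp_space p s (T n)" for n
    by (rule Lp_mono_interval(1)[OF f]) (use T[of n] in auto)
  define F where "F n t = (if t \<in> {s..T n} then f t else 0)" for n t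
  have F: "F n \<in> Lp_space p s b" "Lp_norm p s b (F n) \<le> C" for n
    using Lp_zero_extend[OF fT[of n], of s b] le[OF T] T[of n] by (auto simp: F_def[abs_def])
  have "T \<longlonglongrightarrow> b - (b - s) / 2 * 0"
    unfolding T_def by (intro tendsto_intros LIMSEQ_inverse_real_of_nat)
  then have Tlim: "T \<longlonglongrightarrow> b" by simp
  have ne: "AE t in lebesgue_on {s..b}. t \<noteq> b"
    by (rule AE_lebesgue_on_neq)
  have "AE t in lebesgue_on {s..b}. (\<lambda>n. F n t) \<longlonglongrightarrow> f t"
    using ne AE_lebesgue_on_mem
  proof eventually_elim
    case (elim t)
    then have "\<forall>\<^sub>F n in sequentially. t < T n" by (intro order_tendstoD(1)[OF Tlim]) auto
    then have "\<forall>\<^sub>F n in sequentially. F n t = f t" by eventually_elim (use elim in \<open>auto simp: F_def\<close>)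
    then show ?case by (rule tendsto_eventually)
  qed
  from Lp_Fatou(2)[OF F(1) p F(2) this] show ?thesis .
qed

text \<open>The hypothesis on \<open>P\<close> with the exponent \<open>q\<close> in place of \<open>\<mu>\<close> and up to the right end of the interval.\<close>
lemma evolution_estimate:
  fixes j :: "'d::banach \<Rightarrow>\<^sub>L 'x::banach"
  assumes j: "inj (blinfun_apply j)" and "0 < \<tau>" and P: "bounded_op_fun 0 \<tau> P"
    and U: "associated_evolution_family j \<tau> A U" and \<mu>: "1 < \<mu>" and q: "1 < q" "q \<le> \<mu>" and c: "0 < c"
    and est: "Lmu_estimate j \<tau> U P \<mu> c" and s: "0 \<le> s" "s < b" "b \<le> \<tau>"
  shows "Lp_norm q s b (\<lambda>t. P t (to_D j (U t s (j d)))) \<le> c * \<tau> powr (1 / q - 1 / \<mu>) * norm (j d)"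
proof -
  let ?g = "\<lambda>t. P t (to_D j (U t s (j d)))"
  have st: "s < \<tau>" using s by simp
  have "bounded_op_fun s \<tau> P" by (rule bounded_op_fun_mono[OF P]) (use s in auto)
  then have gL: "?g \<in> Lp_space \<mu> s \<tau>"
    by (rule bounded_op_fun_in_Lp[OF _ _ evolution_family_solution(1)[OF j \<mu> \<open>0 < \<tau>\<close> U s(1) st]]) (use \<mu> in auto)
  have "Lp_norm \<mu> s t ?g \<le> c * norm (j d)" if "s < t" "t < \<tau>" for t
    using est s(1) that by (auto simp: Lmu_estimate_def Let_def Lp_norm_def)
  then have bd: "Lp_norm \<mu> s \<tau> ?g \<le> c * norm (j d)"
    by (intro Lp_norm_le_of_subintervals[OF gL _ st]) (use \<mu> in auto)
  note e = Lp_exponent_mono[OF gL q st]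
  have "Lp_norm q s b ?g \<le> Lp_norm q s \<tau> ?g"
    by (rule Lp_mono_interval(2)[OF e(1)]) (use s q in auto)
  also have "\<dots> \<le> (\<tau> - s) powr (1 / q - 1 / \<mu>) * Lp_norm \<mu> s \<tau> ?g" by (rule e(2))
  also have "\<dots> \<le> \<tau> powr (1 / q - 1 / \<mu>) * (c * norm (j d))"
    using s st q bd by (intro mult_mono powr_mono2) (auto simp: field_simps)
  finally show ?thesis by (simp add: mult_ac)
qed

text \<open>For bounded families strong continuity is joint continuity.\<close>
lemma strongly_continuous_apply:
  fixes V :: "'p::metric_space \<Rightarrow> 'x::real_normed_vector \<Rightarrow>\<^sub>L 'y::real_normed_vector" and y :: "'p \<Rightarrow> 'x"
  assumes V: "\<And>x. continuous_on S (\<lambda>z. V z x)" and K: "\<And>z. z \<in> S \<Longrightarrow> norm (V z) \<le> K" and y: "continuous_on S y"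
  shows "continuous_on S (\<lambda>z. V z (y z))"
  unfolding continuous_on_def
proof
  fix z0 assume z0: "z0 \<in> S"
  have 1: "((\<lambda>z. V z (y z0)) \<longlongrightarrow> V z0 (y z0)) (at z0 within S)"
    using V[of "y z0"] z0 by (auto simp: continuous_on_def)
  have "((\<lambda>z. y z - y z0) \<longlongrightarrow> 0) (at z0 within S)"
    using y z0 by (intro LIM_zero) (auto simp: continuous_on_def)
  then have "((\<lambda>z. K * norm (y z - y z0)) \<longlongrightarrow> 0) (at z0 within S)"
    by (intro tendsto_mult_right_zero tendsto_norm_zero)
  moreover have "\<forall>\<^sub>F z in at z0 within S. norm (V z (y z - y z0)) \<le> K * norm (y z - y z0)"
    unfolding eventually_at_filter
    by (intro always_eventually allI impI order_trans[OF norm_blinfun] mult_right_mono K) auto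
  ultimately have "((\<lambda>z. V z (y z - y z0)) \<longlongrightarrow> 0) (at z0 within S)"
    by (rule Lim_null_comparison[rotated])
  from tendsto_add[OF 1 this] show "((\<lambda>z. V z (y z)) \<longlongrightarrow> V z0 (y z0)) (at z0 within S)"
    by (simp add: blinfun.diff_right)
qed

text \<open>Uniform continuity of \<open>(t, s) \<mapsto> U t s (y s)\<close> on a compact triangle, read off at the diagonal.\<close>
lemma evolution_near_diagonal:
  fixes U :: "real \<Rightarrow> real \<Rightarrow> 'x::banach \<Rightarrow>\<^sub>L 'x"
  assumes U: "evolution_family \<tau> U" and bdd: "bounded {U t s | t s. 0 \<le> s \<and> s \<le> t \<and> t \<le> \<tau>}"
    and ab: "0 \<le> a" "b \<le> \<tau>" and y: "continuous_on {a..b} y" and \<epsilon>: "\<epsilon> > 0"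
  obtains \<delta> where "\<delta> > 0" "\<And>s t. a \<le> s \<Longrightarrow> s \<le> t \<Longrightarrow> t \<le> b \<Longrightarrow> t - s < \<delta> \<Longrightarrow>
    norm (U t s (y s) - y t) < \<epsilon> \<and> norm (y s - y t) < \<epsilon>"
proof -
  let ?T = "{(t, s). 0 \<le> s \<and> s \<le> t \<and> t \<le> \<tau>}"
  define T where "T = {(t, s). a \<le> s \<and> s \<le> t \<and> t \<le> b}"
  have TT: "T \<subseteq> ?T" using ab by (auto simp: T_def)
  have "closed T"
  proof -
    have "T = {z. a \<le> snd z} \<inter> {z. snd z \<le> fst z} \<inter> {z. fst z \<le> b}" by (auto simp: T_def)
    then show ?thesis by (auto intro!: closed_Int closed_Collect_le continuous_intros)
  qed
  moreover have "T \<subseteq> {a..b} \<times> {a..b}" by (auto simp: T_def)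
  ultimately have "compact T"
    by (metis compact_Icc compact_Int_closed compact_Times inf.absorb_iff2)
  obtain K where K: "\<And>t s. 0 \<le> s \<Longrightarrow> s \<le> t \<Longrightarrow> t \<le> \<tau> \<Longrightarrow> norm (U t s) \<le> K"
    using bdd unfolding bounded_iff by blast
  have "continuous_on T (\<lambda>z. U (fst z) (snd z) (y (snd z)))"
  proof (rule strongly_continuous_apply)
    show "continuous_on T (\<lambda>z. U (fst z) (snd z) x)" for x
      using U TT by (auto simp: evolution_family_def split_def intro: continuous_on_subset)
    show "norm (U (fst z) (snd z)) \<le> K" if "z \<in> T" for z using that K ab by (auto simp: T_def)
    show "continuous_on T (\<lambda>z. y (snd z))"
      by (rule continuous_on_compose2[OF y]) (auto intro!: continuous_intros simp: T_def)
  qed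
  then have "uniformly_continuous_on T (\<lambda>z. U (fst z) (snd z) (y (snd z)))"
    using \<open>compact T\<close> by (rule compact_uniformly_continuous)
  then obtain d where d: "d > 0" "\<And>z z'. z \<in> T \<Longrightarrow> z' \<in> T \<Longrightarrow> dist z' z < d \<Longrightarrow>
      dist (U (fst z') (snd z') (y (snd z'))) (U (fst z) (snd z) (y (snd z))) < \<epsilon>"
    using \<epsilon> unfolding uniformly_continuous_on_def by metis
  have "uniformly_continuous_on {a..b} y" using y by (intro compact_uniformly_continuous) auto
  then obtain d' where d': "d' > 0" "\<And>s t. s \<in> {a..b} \<Longrightarrow> t \<in> {a..b} \<Longrightarrow> dist s t < d' \<Longrightarrow> dist (y s) (y t) < \<epsilon>"
    using \<epsilon> unfolding uniformly_continuous_on_def by metis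
  show thesis
  proof (rule that[of "min d d'"])
    fix s t assume st: "a \<le> s" "s \<le> t" "t \<le> b" "t - s < min d d'"
    have "dist (t, s) (t, t) < d" using st by (simp add: dist_Pair_Pair dist_real_def)
    moreover have "(t, s) \<in> T" "(t, t) \<in> T" using st by (auto simp: T_def)
    ultimately have "dist (U t s (y s)) (U t t (y t)) < \<epsilon>" using d(2)[of "(t, t)" "(t, s)"] by simp
    moreover have "U t t = id_blinfun" using U st ab by (auto simp: evolution_family_def)
    moreover have "dist (y s) (y t) < \<epsilon>" using st by (intro d') (auto simp: dist_real_def)
    ultimately show "norm (U t s (y s) - y t) < \<epsilon> \<and> norm (y s - y t) < \<epsilon>" by (simp add: dist_norm)
  qed (use d d' in auto)
qed

section \<open>The estimate for the perturbation\<close>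

text \<open>A Riemann sum with left endpoints, compared with an integral over each cell.\<close>
lemma sum_left_endpoints_le:
  fixes g \<rho> :: "real \<Rightarrow> real"
  assumes g: "continuous_on {a..b} g" and h: "h > 0" and m: "a + real m * h \<le> b"
    and le: "\<And>k t. k < m \<Longrightarrow> t \<in> {a + real k * h..a + real (Suc k) * h} \<Longrightarrow> \<rho> (a + real k * h) \<le> g t"
  shows "(\<Sum>k<m. h * \<rho> (a + real k * h)) \<le> integral {a..a + real m * h} g"
  using m le
proof (induction m)
  case (Suc m)
  define s where "s = a + real m * h"
  have e: "a + real (Suc m) * h = s + h" by (simp add: s_def algebra_simps)
  have sb: "a \<le> s" "s + h \<le> b" using Suc.prems(1) h unfolding e by (auto simp: s_def)
  have int: "g integrable_on {c..d}" if "a \<le> c" "d \<le> b" for c d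
    by (rule integrable_continuous_real, rule continuous_on_subset[OF g]) (use that in auto)
  have IH: "(\<Sum>k<m. h * \<rho> (a + real k * h)) \<le> integral {a..s} g"
    unfolding s_def by (rule Suc.IH) (use Suc.prems sb h in \<open>auto simp: s_def\<close>)
  have "integral {s..s + h} (\<lambda>_. \<rho> s) \<le> integral {s..s + h} g"
    by (rule integral_le[OF _ int]) (use sb Suc.prems(2)[of m] e in \<open>auto simp: s_def\<close>)
  then have "h * \<rho> s \<le> integral {s..s + h} g" using h by simp
  moreover have "integral {a..s} g + integral {s..s + h} g = integral {a..s + h} g"
    using sb h by (intro Henstock_Kurzweil_Integration.integral_combine int) auto
  ultimately show ?case using IH unfolding e by (simp add: s_def)
qed simp

lemma grid_sum_single:
  fixes u :: "nat \<Rightarrow> 'x::real_normed_vector"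
  assumes h: "h > (0::real)" and t: "a < t" "t < a + real n * h" and off: "\<And>k. k \<le> n \<Longrightarrow> t \<noteq> a + real k * h"
  obtains k where "k < n" "t \<in> {a + real k * h..a + real k * h + h}"
    "(\<Sum>i<n. if t \<in> {a + real i * h..a + real i * h + h} then u i else 0) = u k"
proof -
  define k where "k = nat \<lfloor>(t - a) / h\<rfloor>"
  have pos: "0 \<le> (t - a) / h" using t h by simp
  have k: "real k \<le> (t - a) / h" "(t - a) / h < real k + 1"
    using pos floor_correct[of "(t - a) / h"] by (auto simp: k_def)
  then have k': "a + real k * h \<le> t" "t < a + real k * h + h"
    using h by (auto simp: field_simps)
  have kn: "k < n"
  proof (rule ccontr)
    assume "\<not> k < n"
    then have "real n * h \<le> real k * h" using h by (intro mult_right_mono) auto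
    then show False using k'(1) t(2) by linarith
  qed
  have lt: "a + real k * h < t" using off[of k] kn k'(1) by force
  have "(t \<in> {a + real i * h..a + real i * h + h}) = (i = k)" for i
  proof
    assume i: "t \<in> {a + real i * h..a + real i * h + h}"
    show "i = k"
    proof (rule linorder_cases[of i k])
      assume "i < k"
      then have "real i + 1 \<le> real k" by linarith
      then have "(real i + 1) * h \<le> real k * h" using h by (intro mult_right_mono) auto
      then show ?thesis using i lt by (simp add: algebra_simps)
    next
      assume "k < i"
      then have "real k + 1 \<le> real i" by linarith
      then have "(real k + 1) * h \<le> real i * h" using h by (intro mult_right_mono) auto
      then show ?thesis using i k'(2) by (simp add: algebra_simps)
    qed
  qed (use k' in auto)
  then have "(\<Sum>i<n. if t \<in> {a + real i * h..a + real i * h + h} then u i else 0) = (\<Sum>i<n. if i = k then u i else 0)"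
    by simp
  also have "\<dots> = u k" using kn by (simp add: sum.delta')
  finally show thesis using that[OF kn] k' by simp
qed

text \<open>The heart of the proof: the solution operator \<open>S\<close> for \<open>A\<close> satisfies
  \<open>\<parallel>P (S f)\<parallel>\<^sub>q \<le> C * \<parallel>f\<parallel>\<^sub>1\<close>, which Hoelder's inequality turns into the bound below.
  Formally \<open>S f\<close> is the integral of \<open>U t s (f s)\<close> over \<open>s\<close>, and Minkowski's inequality for integrals
  applies. Since \<open>P t\<close> is bounded only on \<open>D\<close>, whereas the integral converges in \<open>X\<close>, the integral is
  replaced by exact solutions: \<open>f\<close> is close to a continuous function \<open>y\<close> with values in \<open>D\<close>, and the sum
  \<open>FF\<close> of the ramps \<open>F k\<close>, started at the grid points \<open>s k\<close> with values \<open>y (s k)\<close>, solves the equation for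
  the right-hand side \<open>rr\<close> that equals \<open>U t (s k) (y (s k))\<close> on the \<open>k\<close>-th cell, hence is uniformly close to
  \<open>y\<close>. The triangle inequality bounds \<open>P FF\<close> by a Riemann sum for the \<open>L\<^sup>1\<close>-norm of \<open>y\<close>, and the a priori
  estimate controls the difference of \<open>FF\<close> and the solution for \<open>f\<close> in \<open>L\<^sup>q\<close> with values in \<open>D\<close>.\<close>
lemma perturbation_estimate:
  fixes j :: "'d::banach \<Rightarrow>\<^sub>L 'x::banach"
  assumes emb: "dense_embedding j" and "0 < \<tau>" and A: "bounded_op_fun 0 \<tau> A" and P: "bounded_op_fun 0 \<tau> P"
    and q: "q > 1" and U: "associated_evolution_family j \<tau> A U"
    and M: "M \<ge> 0" "\<And>f D. f \<in> Lp_space q a b \<Longrightarrow> D \<in> Lp_space q a b \<Longrightarrow> integral_solution j a b A f 0 D \<Longrightarrow>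
      Lp_norm q a b D \<le> M * Lp_norm q a b f"
    and C: "C \<ge> 0" "\<And>s d. 0 \<le> s \<Longrightarrow> s < b \<Longrightarrow> Lp_norm q s b (\<lambda>t. P t (to_D j (U t s (j d)))) \<le> C * norm (j d)"
    and ab: "0 \<le> a" "a < b" "b \<le> \<tau>"
    and f: "f \<in> Lp_space q a b" and D: "D \<in> Lp_space q a b" and sol: "integral_solution j a b A f 0 D"
  shows "Lp_norm q a b (\<lambda>t. P t (D t)) \<le> C * (b - a) powr (1 - 1 / q) * Lp_norm q a b f"
proof -
  let ?N = "Lp_norm q a b"
  have j: "inj (blinfun_apply j)" and dense: "closure (range (blinfun_apply j)) = UNIV"
    using emb by (auto simp: dense_embedding_def)
  have q1: "q \<ge> 1" "q > 0" using q by auto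
  have Aab: "bounded_op_fun a b A" and Pab: "bounded_op_fun a b P"
    using bounded_op_fun_mono[OF A] bounded_op_fun_mono[OF P] ab by auto
  obtain K where K: "K \<ge> 0" "\<And>g. g \<in> Lp_space q a b \<Longrightarrow> ?N (\<lambda>t. P t (g t)) \<le> K * ?N g"
    using bounded_op_fun_Lp[OF Pab] q1 by (metis order_refl)
  define c1 where "c1 = (b - a) powr (1 - 1 / q)"
  define c2 where "c2 = (b - a) powr (1 / q)"
  have main: "?N (\<lambda>t. P t (D t)) \<le> K * (M * (\<epsilon> + \<epsilon> * c2)) + C * (c1 * (?N f + \<epsilon>) + \<epsilon> * (b - a))"
    if \<epsilon>: "\<epsilon> > 0" for \<epsilon>
  proof -
    obtain \<phi> where \<phi>: "continuous_on {a..b} \<phi>" and f\<phi>: "?N (\<lambda>t. f t - j (\<phi> t)) < \<epsilon>"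
      using Lp_dense[OF q1(1) less_imp_le[OF ab(2)] dense f \<epsilon>] by blast
    define y where "y t = j (\<phi> t)" for t
    have yc: "continuous_on {a..b} y" unfolding y_def using \<phi> by (intro continuous_intros)
    have yL: "y \<in> Lp_space q a b" using yc q1 ab by (intro continuous_imp_Lp) auto
    have ev: "evolution_family \<tau> U" "bounded {U t s | t s. 0 \<le> s \<and> s \<le> t \<and> t \<le> \<tau>}"
      using U by (auto simp: associated_evolution_family_def)
    obtain \<delta> where \<delta>: "\<delta> > 0" "\<And>s t. a \<le> s \<Longrightarrow> s \<le> t \<Longrightarrow> t \<le> b \<Longrightarrow> t - s < \<delta> \<Longrightarrow>
        norm (U t s (y s) - y t) < \<epsilon> \<and> norm (y s - y t) < \<epsilon>"
      using evolution_near_diagonal[OF ev ab(1,3) yc \<epsilon>] by metis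
    obtain n :: nat where n0: "(b - a) / \<delta> < real n" using reals_Archimedean2 by blast
    have n: "n > 0" using n0 ab \<delta> by (metis diff_gt_0_iff_gt divide_pos_pos less_trans of_nat_0_less_iff)
    define h where "h = (b - a) / real n"
    have h: "h > 0" "h < \<delta>" "a + real n * h = b"
      using n0 n ab \<delta> by (auto simp: h_def field_simps)
    define s where "s k = a + real k * h" for k
    have sk: "a \<le> s k" "s k + h \<le> b" "s k < b" "0 \<le> s k" "s k < \<tau>" if "k < n" for k
    proof -
      show "a \<le> s k" using h by (simp add: s_def)
      have "(real k + 1) * h \<le> real n * h" using that h by (intro mult_right_mono) auto
      then show *: "s k + h \<le> b" using h(3) by (simp add: s_def algebra_simps)
      then show "s k < b" "0 \<le> s k" "s k < \<tau>" using h(1) ab \<open>a \<le> s k\<close> by linarith+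
    qed
    define E where "E k t = to_D j (U t (s k) (j (\<phi> (s k))))" for k t
    define F where "F k t = (if t \<in> {s k..b} then min h (t - s k) *\<^sub>R E k t else 0)" for k t
    define u where "u k t = U t (s k) (y (s k))" for k t
    define r where "r k t = (if t \<in> {s k..b} then (if t \<in> {s k..s k + h} then u k t else 0) else 0)" for k t
    have step: "F k \<in> Lp_space q a b" "r k \<in> Lp_space q a b" "integral_solution j a b A (r k) 0 (F k)"
      "?N (\<lambda>t. P t (F k t)) \<le> h * (C * norm (y (s k)))" if k: "k < n" for k
    proof -
      have Ek: "E k = (\<lambda>t. to_D j (U t (s k) (j (\<phi> (s k)))))" by (simp add: E_def[abs_def])
      note ES = evolution_family_solution[OF j q \<open>0 < \<tau>\<close> U sk(4,5)[OF k], where d = "\<phi> (s k)", folded Ek]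
      have EL: "E k \<in> Lp_space q (s k) b" using Lp_mono_interval(1)[OF ES(1), of "s k" b] ab by simp
      have Es: "integral_solution j (s k) b A (\<lambda>_. 0) (y (s k)) (E k)"
        using integral_solution_restrict[OF ES(2), of b] ab by (simp add: y_def)
      have Ask: "bounded_op_fun (s k) b A" and Psk: "bounded_op_fun (s k) b P"
        using bounded_op_fun_mono[OF A, of "s k" b] bounded_op_fun_mono[OF P, of "s k" b] sk[OF k] ab by auto
      let ?u = "\<lambda>t. y (s k) + integral {s k..t} (resid A (\<lambda>_. 0) (E k))"
      have ueq: "?u t = u k t" if "t \<in> {s k..b}" for t
        using ES(3)[of t] that ab by (simp add: u_def y_def)
      note R = ramp_solution[OF Ask q h(1) sk(2)[OF k] EL Es]
      have FL: "(\<lambda>t. min h (t - s k) *\<^sub>R E k t) \<in> Lp_space q (s k) b" by (rule R(1))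
      show "F k \<in> Lp_space q a b"
        unfolding F_def[abs_def] by (rule Lp_zero_extend(1)[OF FL]) (use sk[OF k] in auto)
      have "(\<lambda>t. if t \<in> {s k..b} then (if t \<in> {s k..s k + h} then ?u t else 0) else 0) = r k"
        using ueq by (auto simp: r_def)
      moreover have "(\<lambda>t. if t \<in> {s k..b} then (if t \<in> {s k..s k + h} then ?u t else 0) else 0) \<in> Lp_space q a b"
        by (rule Lp_zero_extend(1)[OF R(2)]) (use sk[OF k] in auto)
      moreover have "integral_solution j a b A
          (\<lambda>t. if t \<in> {s k..b} then (if t \<in> {s k..s k + h} then ?u t else 0) else 0) 0 (F k)"
        unfolding F_def[abs_def]
        by (rule integral_solution_zero_extend[OF Aab q _ _ R(2) R(1) R(3)]) (use sk[OF k] in auto)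
      ultimately show "r k \<in> Lp_space q a b" "integral_solution j a b A (r k) 0 (F k)" by simp_all
      have PE: "(\<lambda>t. P t (E k t)) \<in> Lp_space q (s k) b" by (rule bounded_op_fun_in_Lp[OF Psk q1(2) EL])
      have PF: "(\<lambda>t. P t (min h (t - s k) *\<^sub>R E k t)) \<in> Lp_space q (s k) b"
        by (rule bounded_op_fun_in_Lp[OF Psk q1(2) FL])
      have "(\<lambda>t. P t (F k t)) = (\<lambda>t. if t \<in> {s k..b} then P t (min h (t - s k) *\<^sub>R E k t) else 0)"
        by (auto simp: F_def blinfun.zero_right)
      then have "?N (\<lambda>t. P t (F k t)) = Lp_norm q (s k) b (\<lambda>t. P t (min h (t - s k) *\<^sub>R E k t))"
        using Lp_zero_extend(2)[OF PF, of a b] sk[OF k] by simp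
      also have "\<dots> \<le> h * Lp_norm q (s k) b (\<lambda>t. P t (E k t))"
      proof (rule Lp_dominated(2)[OF Lp_space_measurable[OF PF] PE q1(2)])
        show "AE t in lebesgue_on {s k..b}. norm (P t (min h (t - s k) *\<^sub>R E k t)) \<le> h * norm (P t (E k t))"
          using h(1) by (intro AE_I2) (auto simp: blinfun.scaleR_right intro!: mult_right_mono)
      qed (use h in auto)
      also have "\<dots> \<le> h * (C * norm (y (s k)))"
        using C(2)[OF sk(4)[OF k] sk(3)[OF k], of "\<phi> (s k)"] h by (intro mult_left_mono) (auto simp: E_def y_def)
      finally show "?N (\<lambda>t. P t (F k t)) \<le> h * (C * norm (y (s k)))" .
    qed
    define FF where "FF t = (\<Sum>k<n. F k t)" for t
    define rr where "rr t = (\<Sum>k<n. r k t)" for t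
    have FFL: "FF \<in> Lp_space q a b" and rrL: "rr \<in> Lp_space q a b"
      using Lp_sum[of q "{..<n}" F a b] Lp_sum[of q "{..<n}" r a b] step(1,2) q1
      by (auto simp: FF_def[abs_def] rr_def[abs_def])
    have FFsol: "integral_solution j a b A rr 0 FF"
      unfolding FF_def[abs_def] rr_def[abs_def] using step by (intro integral_solution_sum[OF Aab q]) auto
    have near: "AE t in lebesgue_on {a..b}. norm (rr t - y t) \<le> \<epsilon>"
    proof -
      have off: "AE t in lebesgue_on {a..b}. t \<notin> s ` {..n}"
        by (subst AE_lebesgue_on_iff_negligible, simp, rule negligible_subset[OF negligible_finite[of "s ` {..n}"]]) auto
      show ?thesis using off AE_lebesgue_on_mem
      proof eventually_elim
        case (elim t)
        have offk: "t \<noteq> a + real k * h" if "k \<le> n" for k using elim(1) that by (auto simp: s_def)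
        have t: "a < t" "t < a + real n * h" using elim(2) offk[of 0] offk[of n] h(3) by auto
        obtain k where k: "k < n" "t \<in> {a + real k * h..a + real k * h + h}"
          "(\<Sum>i<n. if t \<in> {a + real i * h..a + real i * h + h} then u i t else 0) = u k t"
          using grid_sum_single[OF h(1) t offk, of "\<lambda>i. u i t"] by blast
        have "rr t = (\<Sum>i<n. if t \<in> {a + real i * h..a + real i * h + h} then u i t else 0)"
          unfolding rr_def by (rule sum.cong) (use elim(2) in \<open>auto simp: r_def s_def\<close>)
        then have "rr t = U t (s k) (y (s k))" using k(3) by (simp add: u_def)
        moreover have "norm (U t (s k) (y (s k)) - y t) < \<epsilon>"
          using \<delta>(2)[of "s k" t] sk(1)[OF k(1)] k(2) elim(2) h(2) by (auto simp: s_def)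
        ultimately show ?case by simp
      qed
    qed
    have rry: "(\<lambda>t. rr t - y t) \<in> Lp_space q a b" by (rule Lp_diff(1)[OF rrL yL q1(1)])
    have "?N (\<lambda>t. rr t - y t) \<le> \<epsilon> * c2"
      unfolding c2_def by (rule Lp_bounded(2)[OF Lp_space_measurable[OF rry] q1(2) _ _ near]) (use \<epsilon> ab in auto)
    moreover have fy: "(\<lambda>t. f t - y t) \<in> Lp_space q a b" by (rule Lp_diff(1)[OF f yL q1(1)])
    moreover have "?N (\<lambda>t. (f t - y t) - (rr t - y t)) \<le> ?N (\<lambda>t. f t - y t) + ?N (\<lambda>t. rr t - y t)"
      by (rule Lp_diff(2)[OF fy rry q1(1)])
    ultimately have frr: "?N (\<lambda>t. f t - rr t) \<le> \<epsilon> + \<epsilon> * c2" using f\<phi> by (simp add: y_def)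
    have DFL: "(\<lambda>t. D t - FF t) \<in> Lp_space q a b" by (rule Lp_diff(1)[OF D FFL q1(1)])
    have "integral_solution j a b A (\<lambda>t. f t - rr t) 0 (\<lambda>t. D t - FF t)"
      using integral_solution_diff[OF Aab q f D rrL FFL sol FFsol] by simp
    then have "?N (\<lambda>t. D t - FF t) \<le> M * ?N (\<lambda>t. f t - rr t)"
      by (intro M(2) DFL Lp_diff f rrL q1)
    also have "\<dots> \<le> M * (\<epsilon> + \<epsilon> * c2)" using frr M(1) by (rule mult_left_mono)
    finally have "K * ?N (\<lambda>t. D t - FF t) \<le> K * (M * (\<epsilon> + \<epsilon> * c2))" using K(1) by (rule mult_left_mono)
    then have part1: "?N (\<lambda>t. P t (D t - FF t)) \<le> K * (M * (\<epsilon> + \<epsilon> * c2))" using K(2)[OF DFL] by linarith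
    have sum_y: "(\<Sum>k<n. h * norm (y (s k))) \<le> c1 * (?N f + \<epsilon>) + \<epsilon> * (b - a)"
    proof -
      have "(\<Sum>k<n. h * norm (y (a + real k * h))) \<le> integral {a..a + real n * h} (\<lambda>t. norm (y t) + \<epsilon>)"
      proof (rule sum_left_endpoints_le[where b = b])
        show "continuous_on {a..b} (\<lambda>t. norm (y t) + \<epsilon>)" by (intro continuous_intros yc)
        fix k t assume k: "k < n" and t: "t \<in> {a + real k * h..a + real (Suc k) * h}"
        have "s k \<le> t" "t \<le> s k + h" using t by (auto simp: s_def algebra_simps)
        then have "norm (y (s k) - y t) < \<epsilon>" using \<delta>(2)[of "s k" t] sk[OF k] h(2) by auto
        then show "norm (y (a + real k * h)) \<le> norm (y t) + \<epsilon>"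
          using norm_triangle_ineq2[of "y (s k)" "y t"] by (simp add: s_def)
      qed (use h in auto)
      also have "integral {a..a + real n * h} (\<lambda>t. norm (y t) + \<epsilon>) = integral {a..b} (\<lambda>t. norm (y t)) + \<epsilon> * (b - a)"
      proof -
        have "(\<lambda>t. norm (y t)) integrable_on {a..b}" by (intro integrable_continuous_real continuous_intros yc)
        then show ?thesis using ab h(3)
          by (simp add: Henstock_Kurzweil_Integration.integral_add[OF _ integrable_const_ivl] mult.commute)
      qed
      also have "integral {a..b} (\<lambda>t. norm (y t)) \<le> c1 * ?N y"
        unfolding c1_def using integral_unique[OF Lp_norm_has_integral[OF yL q ab(2)]] Lp_norm_1_le(2)[OF yL q ab(2)] by simp
      also have "?N y \<le> ?N f + \<epsilon>"
        using Lp_diff(2)[OF f fy q1(1)] f\<phi> by (simp add: y_def[abs_def])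
      finally show ?thesis by (simp add: s_def c1_def mult_left_mono)
    qed
    have "?N (\<lambda>t. P t (FF t)) \<le> (\<Sum>k<n. ?N (\<lambda>t. P t (F k t)))"
      using Lp_sum[of q "{..<n}" "\<lambda>k t. P t (F k t)" a b] bounded_op_fun_in_Lp[OF Pab q1(2) step(1)] q1
      by (simp add: FF_def blinfun.sum_right)
    also have "\<dots> \<le> (\<Sum>k<n. h * (C * norm (y (s k))))" by (intro sum_mono step(4)) auto
    also have "\<dots> = C * (\<Sum>k<n. h * norm (y (s k)))" by (simp add: sum_distrib_left mult_ac)
    also have "\<dots> \<le> C * (c1 * (?N f + \<epsilon>) + \<epsilon> * (b - a))" using sum_y C(1) by (rule mult_left_mono)
    finally have part2: "?N (\<lambda>t. P t (FF t)) \<le> C * (c1 * (?N f + \<epsilon>) + \<epsilon> * (b - a))" .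
    have "?N (\<lambda>t. P t (D t - FF t) + P t (FF t)) \<le> ?N (\<lambda>t. P t (D t - FF t)) + ?N (\<lambda>t. P t (FF t))"
      by (intro Lp_add(2) bounded_op_fun_in_Lp[OF Pab] DFL FFL q1)
    then show ?thesis using part1 part2 by (simp add: blinfun.diff_right)
  qed
  have "(\<lambda>\<epsilon>. K * (M * (\<epsilon> + \<epsilon> * c2)) + C * (c1 * (?N f + \<epsilon>) + \<epsilon> * (b - a))) \<midarrow>0\<rightarrow>
      K * (M * (0 + 0 * c2)) + C * (c1 * (?N f + 0) + 0 * (b - a))"
    by (intro tendsto_intros)
  then have lim: "((\<lambda>\<epsilon>. K * (M * (\<epsilon> + \<epsilon> * c2)) + C * (c1 * (?N f + \<epsilon>) + \<epsilon> * (b - a)))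
      \<longlongrightarrow> C * (c1 * ?N f)) (at_right 0)"
    by (auto intro: filterlim_mono[OF _ _ at_le])
  have "?N (\<lambda>t. P t (D t)) \<le> C * (c1 * ?N f)"
    by (rule tendsto_lowerbound[OF lim])
      (auto simp: eventually_at_filter intro!: always_eventually main)
  then show ?thesis by (simp add: c1_def mult.assoc)
qed

theorem theorem3p1:
  fixes j :: "'d::banach \<Rightarrow>\<^sub>L 'x::banach"
    and A P :: "real \<Rightarrow> 'd \<Rightarrow>\<^sub>L 'x"
    and U :: "real \<Rightarrow> real \<Rightarrow> 'x \<Rightarrow>\<^sub>L 'x"
    and \<tau> \<nu> \<mu> c :: real
  assumes "dense_embedding j"
    and "0 < \<tau>"
    and "op_strongly_measurable_on {0..\<tau>} A"
    and "bounded (A ` {0..\<tau>})"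
    and "\<forall>t\<in>{0..\<tau>}. MR_operator j (A t)"
    and "1 < \<nu>"
    and "relative_Dini j \<nu> \<tau> A"
    and "associated_evolution_family j \<tau> A U"
    and "op_strongly_measurable_on {0..\<tau>} P"
    and "bounded (P ` {0..\<tau>})"
    and "1 < \<mu>"
    and "0 < c"
    and "Lmu_estimate j \<tau> U P \<mu> c"
  shows "\<forall>q. 1 < q \<and> q \<le> \<mu> \<longrightarrow> MR_family j q \<tau> (\<lambda>t. A t + P t)"
proof (intro allI impI, elim conjE)
  fix q :: real assume q: "1 < q" "q \<le> \<mu>"
  have j: "inj (blinfun_apply j)" using assms(1) by (simp add: dense_embedding_def)
  have A: "bounded_op_fun 0 \<tau> A" and P: "bounded_op_fun 0 \<tau> P"
    using assms(3,4,9,10) by (simp_all add: bounded_op_fun_def)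
  have hom: "\<exists>E\<in>Lp_space q m \<tau>. integral_solution j m \<tau> A (\<lambda>_. 0) (j d) E" if "0 \<le> m" "m < \<tau>" for m d
    using evolution_family_solution(1,2)[OF j q(1) assms(2,8) that] by blast
  obtain \<delta>0 where \<delta>0: "\<delta>0 > 0" "\<And>a b. 0 \<le> a \<Longrightarrow> a < b \<Longrightarrow> b \<le> \<tau> \<Longrightarrow> b - a \<le> \<delta>0 \<Longrightarrow> well_posed j q a b A"
    using well_posed_short[OF j A q(1) assms(2) _ assms(7)] assms(5) by blast
  \<comment> \<open>Maximal regularity of \<open>A\<close> itself: concatenation with perturbation zero.\<close>
  have wA: "well_posed j q a b A" if "0 \<le> a" "a < b" "b \<le> \<tau>" for a b
    using well_posed_concat[OF A bounded_op_fun_const[of 0 \<tau> 0] q(1) \<delta>0(1) _ hom that] \<delta>0(2) by simp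
  obtain M where M: "M \<ge> 0" "\<And>a b f D. 0 \<le> a \<Longrightarrow> a < b \<Longrightarrow> b \<le> \<tau> \<Longrightarrow> f \<in> Lp_space q a b \<Longrightarrow>
    D \<in> Lp_space q a b \<Longrightarrow> integral_solution j a b A f 0 D \<Longrightarrow> Lp_norm q a b D \<le> M * Lp_norm q a b f"
    using well_posed_uniformly_bounded[OF A q(1) assms(2) wA] by metis
  define C where "C = c * \<tau> powr (1 / q - 1 / \<mu>)"
  have C: "C \<ge> 0" using assms(12) by (simp add: C_def)
  define r where "r = 1 - 1 / q"
  have r: "r > 0" using q by (simp add: r_def)
  \<comment> \<open>On intervals of length \<open>\<delta>\<close> the perturbation \<open>P\<close> is a contraction with constant \<open>1 / 2\<close>.\<close>
  define \<delta> where "\<delta> = (1 / (2 * (C + 1))) powr (1 / r)"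
  have \<delta>: "\<delta> > 0" using C by (simp add: \<delta>_def)
  have \<delta>r: "C * \<delta> powr r \<le> 1 / 2"
    using C r by (simp add: \<delta>_def powr_powr field_simps)
  have short: "well_posed j q a b (\<lambda>t. A t + P t)" if ab: "0 \<le> a" "a < b" "b \<le> \<tau>" "b - a \<le> \<delta>" for a b
  proof (rule well_posed_perturb[OF wA[OF ab(1-3)] bounded_op_fun_mono[OF A ab(1,3)] bounded_op_fun_mono[OF P ab(1,3)] q(1) ab(2), of "1 / 2"])
    fix f D assume L: "f \<in> Lp_space q a b" "D \<in> Lp_space q a b" "integral_solution j a b A f 0 D"
    have "Lp_norm q a b (\<lambda>t. P t (D t)) \<le> C * (b - a) powr (1 - 1 / q) * Lp_norm q a b f"
    proof (rule perturbation_estimate[OF assms(1,2) A P q(1) assms(8) M(1) M(2)[OF ab(1-3)] C _ ab(1-3) L])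
      show "Lp_norm q s b (\<lambda>t. P t (to_D j (U t s (j d)))) \<le> C * norm (j d)" if "0 \<le> s" "s < b" for s d
        unfolding C_def by (rule evolution_estimate[OF j assms(2) P assms(8,11) q assms(12,13) that ab(3)])
    qed
    also have "\<dots> \<le> 1 / 2 * Lp_norm q a b f"
    proof (rule mult_right_mono)
      have "C * (b - a) powr (1 - 1 / q) \<le> C * \<delta> powr r"
        unfolding r_def[symmetric] using ab C r by (intro mult_left_mono powr_mono2) auto
      then show "C * (b - a) powr (1 - 1 / q) \<le> 1 / 2" using \<delta>r by linarith
    qed simp
    finally show "Lp_norm q a b (\<lambda>t. P t (D t)) \<le> 1 / 2 * Lp_norm q a b f" .
  qed auto
  have "well_posed j q a b (\<lambda>t. A t + P t)" if "0 \<le> a" "a < b" "b \<le> \<tau>" for a b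
    by (rule well_posed_concat[OF A P q(1) \<delta> short hom that])
  then show "MR_family j q \<tau> (\<lambda>t. A t + P t)"
    using MR_family_iff_well_posed[OF j bounded_op_fun_add[OF A P] q(1)] by blast
qed

end
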